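(* Let $X$ be a paracompact locally contractible Hausdorff space, $K$ a locally contractible topological group, $\Gamma$ a discrete abelian group, $\hat K$ a central extension of $K$ by a $K(\Gamma,1)$-group $Z$, and $f\colon X\to K$ a continuous based map. Then $$\partial_2^{\hat K}\circ\pi_2(f)=-\alpha_2\big(\iota_1(\delta_0(f))\big)\colon\pi_2(X)\to\Gamma .$$
   Context: A central extension $Z\hookrightarrow\hat K\to K$ is assumed to be a locally trivial principal $Z$-bundle. A $K(\Gamma,1)$-group ($\Gamma$ discrete abelian) is a connected, locally contractible abelian topological group $Z$ with $\pi_1(Z)\cong\Gamma$ whose universal covering group $\tilde Z$ is contractible and divisible; $\pi_1(Z)$ is identified with $\Gamma=\ker(\tilde Z\to Z)$ by lifting loops to paths starting at the identity and taking the end point. $\underline Z$ is the sheaf of germs of continuous $Z$-valued functions. $\delta_0\colon C(X,K)=\check H^0(X,\underline K)\to\check H^1(X,\underline Z)\cong\operatorname{Bun}(X,Z)$ is the connecting map: $\delta_0(f)$ is the class of the $Z$-bundle $f^*\hat K$. The class of a principal bundle with local sections $s_i$ is given by the cocycle $g_{ij}$ with $s_i=s_jg_{ij}$; so $\delta_0(f)$ is represented by $\hat f_i\hat f_j^{-1}$ for continuous local lifts $\hat f_i\colon U_i\to\hat K$ of $f$. $\iota_1\colon\check H^1(X,\underline Z)\to\check H^2(X,\Gamma)$ is the connecting isomorphism of $0\to\underline\Gamma\to\underline{\tilde Z}\to\underline Z\to0$ (lift the cocycle to $\tilde g_{ij}$ and take $\tilde g_{jk}-\tilde g_{ik}+\tilde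 g_{ij}$). Realize $\mathbb S^2=\partial\Delta^3$, $\Delta^3=[e_0,\dots,e_3]$, with faces $F_j$ opposite $e_j$ and open cover $\Lambda_j=\mathbb S^2\setminus F_j$. $S_2\colon\check H^2(\mathbb S^2,\Gamma)\to\Gamma$ is the isomorphism sending the class of a totally antisymmetric cochain with values $\gamma_j$ on $\bigcap_{k\neq j}\Lambda_k$ (increasing indices) to $\sum_{j=0}^3(-1)^j\gamma_j$. $\alpha_2\colon\check H^2(X,\Gamma)\to\operatorname{Hom}(\pi_2(X),\Gamma)$ is $\alpha_2(c)([\sigma])=S_2(\sigma^*c)$. $\partial_2^{\hat K}\colon\pi_2(K)\to\pi_1(Z)\cong\Gamma$ is the connecting map in the long exact homotopy sequence of the $Z$-bundle $\hat K\to K$. Orientations: $\pi_1$ is described by loops on $\partial\Delta^2$ traversed $e_0\to e_1\to e_2\to e_0$, and $\pi_2$ by maps on $\partial\Delta^3$, with signs such that for each $h\colon\partial\Delta^2=\partial F_3\to Z$ the $Z$-bundle $P_h\to\partial\Delta^3$ with cocycle $g_{i3}=h\circ p$ for $i<3$, $g_{ij}=\mathbf 1$ for $i,j<3$ satisfies $\partial_2^{P_h}([\mathrm{id}])=[h]$; here $p\colon\partial\Delta^3\setminus(\operatorname{int}F_3\cup\{e_3\})\to\partial F_3$ is a retraction mapping $F_j\setminus\{e_3\}$ to $F_j\cap F_3$ and the part of $\Lambda_j$ in its domain into $\Lambda_j\cap\partial F_3$, $j<3$. *)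

theory Defs
  imports "HOL-Homology.Homology"
begin

text \<open>
  Topological groups are types of class \<^class>\<open>topological_group_add\<close>.  The group law is written
  \<open>+\<close> but is not assumed commutative; abelian groups have class
  \<^class>\<open>topological_ab_group_add\<close>.  Spaces are given by their topology.
\<close>

definition paracompact_space :: "'a topology \<Rightarrow> bool" where
  "paracompact_space X \<longleftrightarrow>
     (\<forall>\<U>. (\<forall>U\<in>\<U>. openin X U) \<and> \<Union>\<U> = topspace X \<longrightarrow>
        (\<exists>\<V>. (\<forall>V\<in>\<V>. openin X V \<and> (\<exists>U\<in>\<U>. V \<subseteq> U)) \<and> \<Union>\<V> = topspace X \<and>
             locally_finite_in X \<V>))"

definition locally_contractible_space :: "'a topology \<Rightarrow> bool" where
  "locally_contractible_space X \<longleftrightarrow>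
     neighbourhood_base_of (\<lambda>V. contractible_space (subtopology X V)) X"

definition additive_hom :: "('a::group_add \<Rightarrow> 'b::group_add) \<Rightarrow> bool" where
  "additive_hom h \<longleftrightarrow> (\<forall>x y. h (x + y) = h x + h y)"

text \<open>
  A cover is a family \<open>U\<close> of open sets over an index set \<open>I\<close>.  An \<open>n\<close>-cochain assigns to every list
  of \<open>n + 1\<close> indices a continuous function on the corresponding intersection; only the values on
  that intersection matter.  These are cochains in the sheaf of germs of continuous functions; if
  the coefficient group is discrete, this is the constant sheaf.
\<close>

definition open_cover :: "'x topology \<Rightarrow> 'i set \<Rightarrow> ('i \<Rightarrow> 'x set) \<Rightarrow> bool" where
  "open_cover X I U \<longleftrightarrow> (\<forall>i\<in>I. openin X (U i)) \<and> (\<Union>i\<in>I. U i) = topspace X"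

definition cover_inter :: "('i \<Rightarrow> 'x set) \<Rightarrow> 'i list \<Rightarrow> 'x set" where
  "cover_inter U is = (\<Inter>i\<in>set is. U i)"

definition cech_cochain ::
  "'x topology \<Rightarrow> nat \<Rightarrow> 'i set \<Rightarrow> ('i \<Rightarrow> 'x set) \<Rightarrow> ('i list \<Rightarrow> 'x \<Rightarrow> 'a::topological_space) \<Rightarrow> bool"
where
  "cech_cochain X n I U g \<longleftrightarrow>
     (\<forall>is. set is \<subseteq> I \<and> length is = Suc n \<longrightarrow>
        continuous_map (subtopology X (cover_inter U is)) euclidean (g is))"

definition omit_nth :: "nat \<Rightarrow> 'i list \<Rightarrow> 'i list" where
  "omit_nth k is = take k is @ drop (Suc k) is"

definition cech_coboundary :: "('i list \<Rightarrow> 'x \<Rightarrow> 'a::ab_group_add) \<Rightarrow> 'i list \<Rightarrow> 'x \<Rightarrow> 'a" where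
  "cech_coboundary g is x =
     (\<Sum>k<length is. if even k then g (omit_nth k is) x else - g (omit_nth k is) x)"

definition cech_cocycle ::
  "'x topology \<Rightarrow> nat \<Rightarrow> 'i set \<Rightarrow> ('i \<Rightarrow> 'x set) \<Rightarrow>
     ('i list \<Rightarrow> 'x \<Rightarrow> 'a::topological_ab_group_add) \<Rightarrow> bool"
where
  "cech_cocycle X n I U g \<longleftrightarrow>
     open_cover X I U \<and> cech_cochain X n I U g \<and>
     (\<forall>is. set is \<subseteq> I \<and> length is = n + 2 \<longrightarrow>
        (\<forall>x\<in>cover_inter U is. cech_coboundary g is x = 0))"

text \<open>
  Equality in the direct limit over all open covers.  It suffices to consider common refinements
  \<open>\<V>\<close> that are sets of open sets indexed by themselves; \<open>r\<close> and \<open>s\<close> are refinement maps.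
\<close>

definition cech_cohomologous ::
  "'x topology \<Rightarrow> nat \<Rightarrow>
     'i set \<Rightarrow> ('i \<Rightarrow> 'x set) \<Rightarrow> ('i list \<Rightarrow> 'x \<Rightarrow> 'a::topological_ab_group_add) \<Rightarrow>
     'j set \<Rightarrow> ('j \<Rightarrow> 'x set) \<Rightarrow> ('j list \<Rightarrow> 'x \<Rightarrow> 'a) \<Rightarrow> bool"
where
  "cech_cohomologous X n I U g J W h \<longleftrightarrow>
     (\<exists>\<V> r s k. open_cover X \<V> id \<and>
        (\<forall>V\<in>\<V>. r V \<in> I \<and> V \<subseteq> U (r V) \<and> s V \<in> J \<and> V \<subseteq> W (s V)) \<and>
        (if n = 0 then k = (\<lambda>_ _. 0) else cech_cochain X (n - 1) \<V> id k) \<and>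
        (\<forall>is. set is \<subseteq> \<V> \<and> length is = Suc n \<longrightarrow>
           (\<forall>x\<in>cover_inter id is. g (map r is) x - h (map s is) x = cech_coboundary k is x)))"

text \<open>
  A cohomology class is the set of all its representatives on covers indexed by themselves; the
  class of a cocycle is defined for covers with an arbitrary index type.
\<close>

type_synonym ('x, 'a) cech_class = "('x set set \<times> ('x set list \<Rightarrow> 'x \<Rightarrow> 'a)) set"

definition cech_class ::
  "'x topology \<Rightarrow> nat \<Rightarrow> 'i set \<Rightarrow> ('i \<Rightarrow> 'x set) \<Rightarrow>
     ('i list \<Rightarrow> 'x \<Rightarrow> 'a::topological_ab_group_add) \<Rightarrow> ('x, 'a) cech_class"
where
  "cech_class X n I U g =
     {(\<U>, h). cech_cocycle X n \<U> id h \<and> cech_cohomologous X n I U g \<U> id h}"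

definition cech_pullback ::
  "'y topology \<Rightarrow> ('y \<Rightarrow> 'x) \<Rightarrow> nat \<Rightarrow> ('x, 'a::topological_ab_group_add) cech_class \<Rightarrow>
     ('y, 'a) cech_class"
where
  "cech_pullback Y \<sigma> n c =
     (THE d. \<exists>\<U> g. (\<U>, g) \<in> c \<and>
        d = cech_class Y n \<U> (\<lambda>U. topspace Y \<inter> \<sigma> -` U) (\<lambda>is. g is \<circ> \<sigma>))"

text \<open>
  The connecting map in degree \<open>n\<close> of the sequence \<open>0 \<rightarrow> A \<rightarrow> B \<rightarrow> C \<rightarrow> 0\<close> of sheaves of germs of
  continuous functions, given by \<open>j : A \<rightarrow> B\<close> and \<open>q : B \<rightarrow> C\<close>.
\<close>

definition cech_connecting ::
  "'x topology \<Rightarrow> nat \<Rightarrow> ('a::topological_ab_group_add \<Rightarrow> 'b::topological_ab_group_add) \<Rightarrow>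
     ('b \<Rightarrow> 'c::topological_ab_group_add) \<Rightarrow> ('x, 'c) cech_class \<Rightarrow> ('x, 'a) cech_class"
where
  "cech_connecting X n j q c =
     (THE d. \<exists>\<U> g gt a. (\<U>, g) \<in> c \<and> cech_cochain X n \<U> id gt \<and>
        (\<forall>is. set is \<subseteq> \<U> \<and> length is = Suc n \<longrightarrow> (\<forall>x\<in>cover_inter id is. q (gt is x) = g is x)) \<and>
        cech_cochain X (Suc n) \<U> id a \<and>
        (\<forall>is. set is \<subseteq> \<U> \<and> length is = n + 2 \<longrightarrow>
           (\<forall>x\<in>cover_inter id is. j (a is x) = cech_coboundary gt is x)) \<and>
        d = cech_class X (Suc n) \<U> id a)"

definition principal_bundle ::
  "'p topology \<Rightarrow> 'b topology \<Rightarrow> ('p \<Rightarrow> 'b) \<Rightarrow> ('p \<Rightarrow> 'z::topological_group_add \<Rightarrow> 'p) \<Rightarrow> bool"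
where
  "principal_bundle P B \<pi> act \<longleftrightarrow>
     continuous_map P B \<pi> \<and>
     continuous_map (prod_topology P euclidean) P (\<lambda>(y, z). act y z) \<and>
     (\<forall>y\<in>topspace P. act y 0 = y \<and> (\<forall>a b. act (act y a) b = act y (a + b)) \<and>
        (\<forall>a. \<pi> (act y a) = \<pi> y)) \<and>
     (\<forall>b\<in>topspace B. \<exists>U s. openin B U \<and> b \<in> U \<and> continuous_map (subtopology B U) P s \<and>
        (\<forall>u\<in>U. \<pi> (s u) = u) \<and>
        homeomorphic_map (prod_topology (subtopology B U) euclidean)
          (subtopology P {y \<in> topspace P. \<pi> y \<in> U}) (\<lambda>(u, z). act (s u) z))"

text \<open>Convention: local sections \<open>s\<close> determine the cocycle \<open>g\<close> by \<open>s\<^sub>U = s\<^sub>V \<cdot> g\<^sub>U\<^sub>V\<close>.\<close>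

definition bundle_class ::
  "'p topology \<Rightarrow> 'b topology \<Rightarrow> ('p \<Rightarrow> 'b) \<Rightarrow> ('p \<Rightarrow> 'z::topological_ab_group_add \<Rightarrow> 'p) \<Rightarrow>
     ('b, 'z) cech_class"
where
  "bundle_class P B \<pi> act =
     (THE c. \<exists>\<U> s g. open_cover B \<U> id \<and>
        (\<forall>U\<in>\<U>. continuous_map (subtopology B U) P (s U) \<and> (\<forall>x\<in>U. \<pi> (s U x) = x)) \<and>
        cech_cochain B 1 \<U> id g \<and>
        (\<forall>U\<in>\<U>. \<forall>V\<in>\<U>. \<forall>x\<in>U \<inter> V. s U x = act (s V x) (g [U, V] x)) \<and>
        c = cech_class B 1 \<U> id g)"

definition central_extension ::
  "('z::topological_ab_group_add \<Rightarrow> 'e::topological_group_add) \<Rightarrow> ('e \<Rightarrow> 'k::topological_group_add) \<Rightarrow> bool"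
where
  "central_extension i p \<longleftrightarrow>
     additive_hom i \<and> additive_hom p \<and> inj i \<and> range i = {y. p y = 0} \<and>
     (\<forall>z y. i z + y = y + i z) \<and>
     principal_bundle euclidean euclidean p (\<lambda>y z. y + i z)"

definition delta0 ::
  "'x topology \<Rightarrow> ('z::topological_ab_group_add \<Rightarrow> 'e::topological_group_add) \<Rightarrow>
     ('e \<Rightarrow> 'k::topological_group_add) \<Rightarrow> ('x \<Rightarrow> 'k) \<Rightarrow> ('x, 'z) cech_class"
where
  "delta0 X i p f =
     bundle_class (subtopology (prod_topology X euclidean) {(x, y). f x = p y}) X
       fst (\<lambda>(x, y) z. (x, y + i z))"

text \<open>
  \<open>q\<close> is the universal covering of the group \<open>Z\<close> (its domain is simply connected because it is
  contractible), and \<open>j\<close> identifies the discrete group \<open>\<Gamma>\<close> with the kernel of \<open>q\<close>, hence with the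
  fundamental group of \<open>Z\<close>.
\<close>

definition K_Gamma_1_group ::
  "('g::{topological_ab_group_add,discrete_topology} \<Rightarrow> 'w::topological_ab_group_add) \<Rightarrow>
     ('w \<Rightarrow> 'z::topological_ab_group_add) \<Rightarrow> bool"
where
  "K_Gamma_1_group j q \<longleftrightarrow>
     connected (UNIV :: 'z set) \<and> locally_contractible_space (euclidean :: 'z topology) \<and>
     additive_hom q \<and> covering_space UNIV q UNIV \<and>
     contractible (UNIV :: 'w set) \<and>
     (\<forall>n::nat. n > 0 \<longrightarrow> (\<forall>w :: 'w. \<exists>v. (\<Sum>_<n. v) = w)) \<and>
     additive_hom j \<and> inj j \<and> range j = {w. q w = 0}"

definition iota1 ::
  "'x topology \<Rightarrow> ('g::{topological_ab_group_add,discrete_topology} \<Rightarrow> 'w::topological_ab_group_add) \<Rightarrow>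
     ('w \<Rightarrow> 'z::topological_ab_group_add) \<Rightarrow> ('x, 'z) cech_class \<Rightarrow> ('x, 'g) cech_class"
where
  "iota1 X j q = cech_connecting X 1 j q"

definition vertex :: "nat \<Rightarrow> nat \<Rightarrow> real" where
  "vertex j = (\<lambda>i. if i = j then 1 else 0)"

definition simplex_face :: "nat \<Rightarrow> nat \<Rightarrow> (nat \<Rightarrow> real) set" where
  "simplex_face n j = {x \<in> standard_simplex n. x j = 0}"

definition simplex_boundary :: "nat \<Rightarrow> (nat \<Rightarrow> real) set" where
  "simplex_boundary n = (\<Union>j\<le>n. simplex_face n j)"

text \<open>
  The simplices \<^term>\<open>standard_simplex n\<close> are nested, so that the face of the \<open>3\<close>-simplex opposite to
  the last vertex is literally the \<open>2\<close>-simplex, with boundary \<^term>\<open>simplex_boundary 2\<close>.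
\<close>

lemma simplex_face_3_3: "simplex_face 3 3 = standard_simplex 2"
proof -
  have *: "{..3::nat} = insert 3 {..2}" by auto
  have **: "x i = 0" if "\<forall>i>3. x i = 0" "x 3 = 0" "2 < i" for x :: "nat \<Rightarrow> real" and i
    using that by (cases "i = 3") auto
  show ?thesis
    by (auto simp: simplex_face_def standard_simplex_def * intro: **)
qed

text \<open>
  The \<open>n\<close>-th homotopy group as a set of based homotopy classes of maps on the boundary of the
  \<open>(n + 1)\<close>-simplex, with base point \<open>e\<^sub>0\<close>.
\<close>

definition based_class ::
  "nat \<Rightarrow> 'x topology \<Rightarrow> 'x \<Rightarrow> ((nat \<Rightarrow> real) \<Rightarrow> 'x) \<Rightarrow> ((nat \<Rightarrow> real) \<Rightarrow> 'x) set"
where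
  "based_class n X x0 \<sigma> =
     {\<tau>. homotopic_with (\<lambda>h. h (vertex 0) = x0) (top_of_set (simplex_boundary (Suc n))) X \<sigma> \<tau>}"

definition homotopy_group_set ::
  "nat \<Rightarrow> 'x topology \<Rightarrow> 'x \<Rightarrow> ((nat \<Rightarrow> real) \<Rightarrow> 'x) set set"
where
  "homotopy_group_set n X x0 =
     based_class n X x0 `
       {\<sigma>. continuous_map (top_of_set (simplex_boundary (Suc n))) X \<sigma> \<and> \<sigma> (vertex 0) = x0}"

definition homotopy_group_map ::
  "nat \<Rightarrow> 'y topology \<Rightarrow> 'y \<Rightarrow> ('x \<Rightarrow> 'y) \<Rightarrow> ((nat \<Rightarrow> real) \<Rightarrow> 'x) set \<Rightarrow> ((nat \<Rightarrow> real) \<Rightarrow> 'y) set"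
where
  "homotopy_group_map n Y y0 f S = (THE T. \<exists>\<sigma>\<in>S. T = based_class n Y y0 (f \<circ> \<sigma>))"

text \<open>
  The connecting map from the second homotopy group of the base to the first homotopy group of the
  structure group: represent the class by a map \<open>\<sigma>\<close> that is constant on the faces \<open>F\<^sub>0\<close>, \<open>F\<^sub>1\<close>, \<open>F\<^sub>2\<close>,
  lift it on the disc \<open>F\<^sub>3\<close> to a map \<open>\<tau>\<close> into the total space, and take the loop \<open>\<ell>\<close> of the values
  of \<open>\<tau>\<close> on the boundary of \<open>F\<^sub>3\<close>, which lie in the fibre \<open>y0 \<cdot> Z\<close> over the base point.

  Using \<open>F\<^sub>3\<close>, with boundary loop \<open>e\<^sub>0 \<rightarrow> e\<^sub>1 \<rightarrow> e\<^sub>2 \<rightarrow> e\<^sub>0\<close>, fixes the sign.  It is the normalisation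
  in which the bundle over the boundary of the \<open>3\<close>-simplex with cocycle \<open>g\<^sub>i\<^sub>3 = h \<circ> p\<close> and
  \<open>g\<^sub>i\<^sub>j = 0\<close> (\<open>i, j < 3\<close>) sends the class of the identity to the class of \<open>h\<close>.  Indeed \<open>s\<^sub>0 = s\<^sub>1 = s\<^sub>2\<close>
  glue to a section \<open>u\<close> off \<open>e\<^sub>3\<close>, and \<open>s\<^sub>3\<close> and \<open>u \<cdot> (- h \<circ> p)\<close> glue to a section \<open>v\<close> on
  \<open>F\<^sub>0 \<union> F\<^sub>1 \<union> F\<^sub>2\<close>, where \<open>u = v \<cdot> h\<close> on the boundary of \<open>F\<^sub>3\<close>.  Shrinking \<open>F\<^sub>0 \<union> F\<^sub>1 \<union> F\<^sub>2\<close> to the base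
  point makes \<open>v\<close> constant and turns \<open>u\<close> into \<open>\<tau>\<close>, so the resulting loop is homotopic to \<open>h\<close>.
\<close>

definition connecting2 ::
  "'p topology \<Rightarrow> ('p \<Rightarrow> 'b) \<Rightarrow> ('p \<Rightarrow> 'z::topological_group_add \<Rightarrow> 'p) \<Rightarrow> 'p \<Rightarrow>
     ((nat \<Rightarrow> real) \<Rightarrow> 'b) set \<Rightarrow> ((nat \<Rightarrow> real) \<Rightarrow> 'z) set"
where
  "connecting2 P \<pi> act y0 S =
     (THE T. \<exists>\<sigma>\<in>S. \<exists>\<tau> l.
        (\<forall>j<3. \<forall>x\<in>simplex_face 3 j. \<sigma> x = \<pi> y0) \<and>
        continuous_map (top_of_set (simplex_face 3 3)) P \<tau> \<and>
        (\<forall>x\<in>simplex_face 3 3. \<pi> (\<tau> x) = \<sigma> x) \<and> \<tau> (vertex 0) = y0 \<and>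
        (\<forall>x\<in>simplex_boundary 2. \<tau> x = act y0 (l x)) \<and>
        T = based_class 1 euclidean 0 l)"

definition edge_path :: "nat \<Rightarrow> nat \<Rightarrow> real \<Rightarrow> nat \<Rightarrow> real" where
  "edge_path a b t = (\<lambda>i. (1 - t) * vertex a i + t * vertex b i)"

definition triangle_loop :: "real \<Rightarrow> nat \<Rightarrow> real" where
  "triangle_loop = edge_path 0 1 +++ edge_path 1 2 +++ edge_path 2 0"

definition pi1_to_Gamma ::
  "('g::{topological_ab_group_add,discrete_topology} \<Rightarrow> 'w::topological_ab_group_add) \<Rightarrow>
     ('w \<Rightarrow> 'z::topological_ab_group_add) \<Rightarrow> ((nat \<Rightarrow> real) \<Rightarrow> 'z) set \<Rightarrow> 'g"
where
  "pi1_to_Gamma j q S =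
     (THE \<gamma>. \<exists>h\<in>S. \<exists>g. path g \<and> pathstart g = 0 \<and>
        (\<forall>t\<in>{0..1}. q (g t) = h (triangle_loop t)) \<and> pathfinish g = j \<gamma>)"

definition sphere_cover :: "nat \<Rightarrow> (nat \<Rightarrow> real) set" where
  "sphere_cover j = simplex_boundary 3 - simplex_face 3 j"

definition totally_antisymmetric :: "('i list \<Rightarrow> 'x \<Rightarrow> 'a::ab_group_add) \<Rightarrow> bool" where
  "totally_antisymmetric g \<longleftrightarrow>
     (\<forall>is x. \<not> distinct is \<longrightarrow> g is x = 0) \<and>
     (\<forall>is a b js x. g (is @ a # b # js) x = - g (is @ b # a # js) x)"

definition S2 :: "(nat \<Rightarrow> real, 'g::{topological_ab_group_add,discrete_topology}) cech_class \<Rightarrow> 'g" where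
  "S2 c =
     (THE s. \<exists>g \<gamma>. cech_cocycle (top_of_set (simplex_boundary 3)) 2 {..3} sphere_cover g \<and>
        totally_antisymmetric g \<and>
        (\<forall>j\<le>3. \<forall>x\<in>cover_inter sphere_cover (removeAll j [0..<4]). g (removeAll j [0..<4]) x = \<gamma> j) \<and>
        c = cech_class (top_of_set (simplex_boundary 3)) 2 {..3} sphere_cover g \<and>
        s = (\<Sum>j\<le>3. if even j then \<gamma> j else - \<gamma> j))"

definition alpha2 ::
  "('x, 'g::{topological_ab_group_add,discrete_topology}) cech_class \<Rightarrow>
     ((nat \<Rightarrow> real) \<Rightarrow> 'x) set \<Rightarrow> 'g"
where
  "alpha2 c S =
     (THE s. \<exists>\<sigma>\<in>S. s = S2 (cech_pullback (top_of_set (simplex_boundary 3)) \<sigma> 2 c))"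

end

theory Submission
  imports Defs "HOL-Analysis.Analysis"
begin

text \<open>
  Since \<open>p\<close> and \<open>q\<close> are homomorphisms with local sections, every map on a compact space that is
  homotopic to \<open>0\<close> lifts through them.  Hence, if \<open>f \<circ> \<sigma>\<close> is homotopic to \<open>\<sigma>'\<close>, then \<open>\<sigma>' = f \<circ> \<sigma> + p \<circ> \<psi>\<close>, and
  adding \<open>\<psi>\<close> to local lifts of \<open>f \<circ> \<sigma>\<close> gives local lifts of \<open>\<sigma>'\<close> with the same difference cocycle.
  So \<open>f \<circ> \<sigma>\<close> may be replaced by a map \<open>\<sigma>'\<close> that vanishes on \<open>F\<^sub>0\<close>, \<open>F\<^sub>1\<close>, \<open>F\<^sub>2\<close> and has a lift \<open>\<tau>\<close> on \<open>F\<^sub>3\<close>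
  with boundary loop \<open>l\<close>.  Extending \<open>\<tau>\<close> radially over the complement of \<open>e\<^sub>3\<close> and using \<open>0\<close> near \<open>e\<^sub>3\<close>, the
  difference cocycle on the open stars is \<open>g\<^sub>i\<^sub>3 = l \<circ> \<rho>\<close>.  Lifting \<open>l\<close> on the three stars of the triangle, with
  the jump \<open>\<gamma>\<close> placed at \<open>e\<^sub>0\<close>, gives the \<open>2\<close>-cocycle with the single value \<open>a\<^sub>0\<^sub>2\<^sub>3 = \<gamma>\<close>, which enters \<open>S2\<close>
  with sign \<open>-1\<close>.  Two boundary loops with the same \<open>\<gamma>\<close> differ by a loop that lifts to the contractible
  covering group, so they are homotopic.
\<close>

section \<open>Cech cochains and refinements\<close>

text \<open>Every map in the statement is a definite description, so besides computing one value on
  convenient data the proof must show that no other choice of cover, lift, representative or loop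
  gives another. Most of this load is carried by one equation, that \<open>S2\<close> of the
  pullback is \<open>- \<gamma>\<close>: it is proved for arbitrary \<open>\<sigma>\<close>,
  \<open>\<sigma>'\<close>, \<open>\<tau>\<close>, \<open>l\<close> and path lift, while its
  left-hand side involves \<open>\<sigma>\<close> alone. Hence \<open>\<gamma>\<close> cannot depend
  on the lifts. The group structure stands in for a homotopy lifting property of \<open>p\<close>:
  instead of a homotopy \<open>H\<close> only its total increment
  \<open>- H (0, y) + H (1, y)\<close> is lifted, over a compact source. The order of the summands
  matters, because \<open>K\<close> and its extension may be noncommutative. That \<open>S2\<close>
  is well defined is a separate matter: there a comparison on an unknown refinement has to be moved
  back to the four stars.\<close>

lemma continuous_map_eq_tendsto:
  "continuous_map X euclidean f \<longleftrightarrow> (\<forall>x\<in>topspace X. (f \<longlongrightarrow> f x) (atin X x))"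
  by (simp add: continuous_map_atin)

lemma continuous_map_group_add:
  fixes f g :: "'x \<Rightarrow> 'a::topological_group_add"
  assumes "continuous_map X euclidean f" "continuous_map X euclidean g"
  shows "continuous_map X euclidean (\<lambda>x. f x + g x)"
  using assms by (auto simp: continuous_map_eq_tendsto intro!: tendsto_add)

lemma continuous_map_group_uminus:
  fixes f :: "'x \<Rightarrow> 'a::topological_group_add"
  assumes "continuous_map X euclidean f"
  shows "continuous_map X euclidean (\<lambda>x. - f x)"
  using assms by (auto simp: continuous_map_eq_tendsto intro!: tendsto_minus)

lemma continuous_map_group_diff:
  fixes f g :: "'x \<Rightarrow> 'a::topological_group_add"
  assumes "continuous_map X euclidean f" "continuous_map X euclidean g"
  shows "continuous_map X euclidean (\<lambda>x. f x - g x)"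
  unfolding diff_conv_add_uminus
  by (intro continuous_map_group_add continuous_map_group_uminus assms)

lemmas continuous_map_group_intros =
  continuous_map_group_add continuous_map_group_uminus continuous_map_group_diff

lemma cover_inter_simps [simp]:
  "cover_inter U [] = UNIV"
  "cover_inter U (i # is) = U i \<inter> cover_inter U is"
  by (auto simp: cover_inter_def)

lemma cover_inter_map_mono:
  assumes "\<And>i. i \<in> set is \<Longrightarrow> V i \<subseteq> U (r i)"
  shows "cover_inter V is \<subseteq> cover_inter U (map r is)"
  using assms by (auto simp: cover_inter_def)

lemma cech_coboundary_2: "cech_coboundary g [i, j] x = g [j] x - g [i] x"
  and cech_coboundary_3: "cech_coboundary g [i, j, k] x = g [j, k] x - g [i, k] x + g [i, j] x"
  and cech_coboundary_4: "cech_coboundary g [i, j, k, l] x =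
    g [j, k, l] x - g [i, k, l] x + g [i, j, l] x - g [i, j, k] x"
  by (simp_all add: cech_coboundary_def omit_nth_def lessThan_Suc)

lemmas cech_coboundary_simps = cech_coboundary_2 cech_coboundary_3 cech_coboundary_4

lemma cech_coboundary_map:
  "cech_coboundary g (map r is) x = cech_coboundary (\<lambda>js. g (map r js)) is x"
  by (simp add: cech_coboundary_def omit_nth_def take_map drop_map cong: if_cong)

lemma cech_coboundary_add:
  "cech_coboundary (\<lambda>is x. g is x + h is x) is x = cech_coboundary g is x + cech_coboundary h is x"
  unfolding cech_coboundary_def by (subst sum.distrib [symmetric], rule sum.cong) auto

lemma cech_coboundary_uminus:
  "cech_coboundary (\<lambda>is x. - g is x) is x = - cech_coboundary g is x"
  unfolding cech_coboundary_def by (subst sum_negf [symmetric], rule sum.cong) auto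

lemma cech_coboundary_diff:
  "cech_coboundary (\<lambda>is x. g is x - h is x) is x = cech_coboundary g is x - cech_coboundary h is x"
  using cech_coboundary_add [of g "\<lambda>is x. - h is x"] by (simp add: cech_coboundary_uminus)

lemma cech_coboundary_zero: "cech_coboundary (\<lambda>_ _. 0) is x = 0"
  unfolding cech_coboundary_def by (rule sum.neutral) simp

lemma all_lists_length_1: "(\<forall>is. set is \<subseteq> I \<and> length is = Suc 0 \<longrightarrow> P is) \<longleftrightarrow> (\<forall>i\<in>I. P [i])"
  and all_lists_length_2: "(\<forall>is. set is \<subseteq> I \<and> length is = 2 \<longrightarrow> P is) \<longleftrightarrow> (\<forall>i\<in>I. \<forall>j\<in>I. P [i, j])"
  and all_lists_length_3: "(\<forall>is. set is \<subseteq> I \<and> length is = 3 \<longrightarrow> P is) \<longleftrightarrow>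
    (\<forall>i\<in>I. \<forall>j\<in>I. \<forall>k\<in>I. P [i, j, k])"
  and all_lists_length_4: "(\<forall>is. set is \<subseteq> I \<and> length is = 4 \<longrightarrow> P is) \<longleftrightarrow>
    (\<forall>i\<in>I. \<forall>j\<in>I. \<forall>k\<in>I. \<forall>l\<in>I. P [i, j, k, l])"
  by (auto simp: length_Suc_conv eval_nat_numeral)

lemma cech_cochain_0: "cech_cochain X 0 I U g \<longleftrightarrow>
    (\<forall>i\<in>I. continuous_map (subtopology X (U i)) euclidean (g [i]))"
  unfolding cech_cochain_def all_lists_length_1 by simp

lemma cech_cochain_1: "cech_cochain X (Suc 0) I U g \<longleftrightarrow>
    (\<forall>i\<in>I. \<forall>j\<in>I. continuous_map (subtopology X (U i \<inter> U j)) euclidean (g [i, j]))"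
  unfolding cech_cochain_def numeral_2_eq_2 [symmetric] all_lists_length_2 by simp

lemma cech_cochain_2: "cech_cochain X 2 I U g \<longleftrightarrow>
    (\<forall>i\<in>I. \<forall>j\<in>I. \<forall>k\<in>I. continuous_map (subtopology X (U i \<inter> U j \<inter> U k)) euclidean (g [i, j, k]))"
proof -
  have eq: "Suc 2 = 3" by simp
  show ?thesis
    unfolding cech_cochain_def eq all_lists_length_3 by (simp add: Int_assoc)
qed

lemma cech_cocycle_1: "cech_cocycle X (Suc 0) I U g \<longleftrightarrow> open_cover X I U \<and> cech_cochain X (Suc 0) I U g \<and>
    (\<forall>i\<in>I. \<forall>j\<in>I. \<forall>k\<in>I. \<forall>x \<in> U i \<inter> U j \<inter> U k. g [j, k] x - g [i, k] x + g [i, j] x = 0)"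
proof -
  have eq: "Suc 0 + 2 = 3" by simp
  show ?thesis
    unfolding cech_cocycle_def eq all_lists_length_3 by (simp add: Int_assoc cech_coboundary_simps)
qed

lemma cech_cocycle_2: "cech_cocycle X 2 I U g \<longleftrightarrow> open_cover X I U \<and> cech_cochain X 2 I U g \<and>
    (\<forall>i\<in>I. \<forall>j\<in>I. \<forall>k\<in>I. \<forall>l\<in>I. \<forall>x \<in> U i \<inter> U j \<inter> U k \<inter> U l.
       g [j, k, l] x - g [i, k, l] x + g [i, j, l] x - g [i, j, k] x = 0)"
proof -
  have eq: "2 + 2 = (4::nat)" by simp
  show ?thesis
    unfolding cech_cocycle_def eq all_lists_length_4 by (simp add: Int_assoc cech_coboundary_simps)
qed

lemma continuous_map_subtopology_mono:
  "continuous_map (subtopology X S) Y f \<Longrightarrow> T \<subseteq> S \<Longrightarrow> continuous_map (subtopology X T) Y f"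
  by (rule continuous_map_from_subtopology_mono)

lemma cech_cochain_refine:
  assumes g: "cech_cochain X n I U g" and r: "\<And>V. V \<in> J \<Longrightarrow> r V \<in> I \<and> W V \<subseteq> U (r V)"
  shows "cech_cochain X n J W (\<lambda>is. g (map r is))"
  unfolding cech_cochain_def
proof (intro allI impI)
  fix "is" assume "is": "set is \<subseteq> J \<and> length is = Suc n"
  have "continuous_map (subtopology X (cover_inter U (map r is))) euclidean (g (map r is))"
    by (rule g [unfolded cech_cochain_def, rule_format]) (use "is" r in auto)
  then show "continuous_map (subtopology X (cover_inter W is)) euclidean (g (map r is))"
    by (rule continuous_map_subtopology_mono) (use "is" r in \<open>auto intro!: cover_inter_map_mono\<close>)
qed

lemma cech_cocycle_refine:
  assumes g: "cech_cocycle X n I U g" and W: "open_cover X J W"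
    and r: "\<And>V. V \<in> J \<Longrightarrow> r V \<in> I \<and> W V \<subseteq> U (r V)"
  shows "cech_cocycle X n J W (\<lambda>is. g (map r is))"
  unfolding cech_cocycle_def
proof (intro conjI allI impI ballI)
  show "cech_cochain X n J W (\<lambda>is. g (map r is))"
    using g r by (auto simp: cech_cocycle_def intro!: cech_cochain_refine)
  fix "is" x assume "is": "set is \<subseteq> J \<and> length is = n + 2" and x: "x \<in> cover_inter W is"
  have "x \<in> cover_inter U (map r is)"
    using x cover_inter_map_mono [of "is" W U r] "is" r by auto
  then show "cech_coboundary (\<lambda>is. g (map r is)) is x = 0"
    unfolding cech_coboundary_map [symmetric]
  proof (rule g [unfolded cech_cocycle_def, THEN conjunct2, THEN conjunct2, rule_format, rotated])
    show "set (map r is) \<subseteq> I \<and> length (map r is) = n + 2" using "is" r by auto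
  qed
qed (rule W)

lemma open_cover_image:
  assumes "open_cover X J W"
  shows "open_cover X (W ` J) id"
  using assms by (auto simp: open_cover_def)

text \<open>The sets \<open>W V\<close> themselves serve as common refinement. Both refinement maps
  factor through the same choice \<open>inv_into J W\<close>, so the two pulled-back cochains
  coincide and \<open>k = 0\<close> works.\<close>

lemma cech_cohomologous_refine:
  assumes W: "open_cover X J W" and n: "n > 0"
    and r: "\<And>V. V \<in> J \<Longrightarrow> r V \<in> I \<and> W V \<subseteq> U (r V)"
  shows "cech_cohomologous X n I U g J W (\<lambda>is. g (map r is))"
  unfolding cech_cohomologous_def
proof (intro exI conjI)
  let ?s = "inv_into J W"
  show "open_cover X (W ` J) id" by (rule open_cover_image [OF W])
  show "\<forall>V\<in>W ` J. (r \<circ> ?s) V \<in> I \<and> V \<subseteq> U ((r \<circ> ?s) V) \<and> ?s V \<in> J \<and> V \<subseteq> W (?s V)"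
  proof
    fix V assume "V \<in> W ` J"
    then have "?s V \<in> J" "W (?s V) = V" by (simp_all add: inv_into_into f_inv_into_f)
    then show "(r \<circ> ?s) V \<in> I \<and> V \<subseteq> U ((r \<circ> ?s) V) \<and> ?s V \<in> J \<and> V \<subseteq> W (?s V)"
      using r [of "?s V"] by simp
  qed
  show "if n = 0 then (\<lambda>_ _. 0) = (\<lambda>_ _. 0) else cech_cochain X (n - 1) (W ` J) id (\<lambda>_ _. 0)"
    by (simp add: cech_cochain_def)
qed (simp add: cech_coboundary_zero comp_def)

section \<open>The equivalence relation between cocycles\<close>

lemma cech_cohomologous_sym:
  assumes "cech_cohomologous X n I U g J W h" "n > 0"
  shows "cech_cohomologous X n J W h I U g"
proof -
  obtain \<V> r s k where 1: "open_cover X \<V> id"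
    "\<forall>V\<in>\<V>. r V \<in> I \<and> V \<subseteq> U (r V) \<and> s V \<in> J \<and> V \<subseteq> W (s V)"
    "cech_cochain X (n - 1) \<V> id k"
    "\<And>is x. set is \<subseteq> \<V> \<Longrightarrow> length is = Suc n \<Longrightarrow> x\<in>cover_inter id is \<Longrightarrow>
      g (map r is) x - h (map s is) x = cech_coboundary k is x"
    using assms unfolding cech_cohomologous_def by auto
  show ?thesis
    unfolding cech_cohomologous_def
  proof (intro exI conjI)
    show "open_cover X \<V> id" by fact
    show "\<forall>V\<in>\<V>. s V \<in> J \<and> V \<subseteq> W (s V) \<and> r V \<in> I \<and> V \<subseteq> U (r V)" using 1 by auto
    show "if n = 0 then (\<lambda>is x. - k is x) = (\<lambda>_ _. 0) else cech_cochain X (n - 1) \<V> id (\<lambda>is x. - k is x)"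
      using 1(3) assms(2) by (auto simp: cech_cochain_def intro!: continuous_map_group_uminus)
    show "\<forall>is. set is \<subseteq> \<V> \<and> length is = Suc n \<longrightarrow> (\<forall>x\<in>cover_inter id is.
        h (map s is) x - g (map r is) x = cech_coboundary (\<lambda>is x. - k is x) is x)"
      using 1(4) unfolding cech_coboundary_uminus by (metis minus_diff_eq)
  qed
qed

text \<open>The cochain \<open>k\<close> is given by the prism operator of the two refinement maps.\<close>

lemma cech_cocycle_prism:
  assumes g: "cech_cocycle X n I U g" and n: "n = 1 \<or> n = 2"
    and r: "\<And>V. V \<in> \<V> \<Longrightarrow> r V \<in> I \<and> V \<subseteq> U (r V) \<and> s V \<in> I \<and> V \<subseteq> U (s V)"
  obtains k where "cech_cochain X (n - 1) \<V> id k"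
    "\<And>is x. set is \<subseteq> \<V> \<Longrightarrow> length is = Suc n \<Longrightarrow> x \<in> cover_inter id is \<Longrightarrow>
      g (map r is) x - g (map s is) x = cech_coboundary k is x"
  using n
proof
  assume n1: "n = 1"
  define k where "k is x = - g [r (is ! 0), s (is ! 0)] x" for "is" x
  show thesis
  proof (rule that)
    show "cech_cochain X (n - 1) \<V> id k"
      unfolding n1 k_def [abs_def] diff_self_eq_0 cech_cochain_0
    proof (intro ballI continuous_map_group_uminus)
      fix V assume "V \<in> \<V>"
      then have V: "r V \<in> I" "s V \<in> I" "id V \<subseteq> U (r V) \<inter> U (s V)" using r by auto
      then have "continuous_map (subtopology X (U (r V) \<inter> U (s V))) euclidean (g [r V, s V])"
        using g unfolding n1 cech_cocycle_1 cech_cochain_1 One_nat_def by blast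
      then show "continuous_map (subtopology X (id V)) euclidean (g [r ([V] ! 0), s ([V] ! 0)])"
        using V(3) by (simp add: continuous_map_subtopology_mono)
    qed
    have *: "g [r i, r j] x - g [s i, s j] x = cech_coboundary k [i, j] x"
      if "i \<in> \<V>" "j \<in> \<V>" "x \<in> i" "x \<in> j" for i j x
    proof -
      have eq: "g [b, c] x - g [a, c] x + g [a, b] x = 0"
        if "a \<in> I" "b \<in> I" "c \<in> I" "x \<in> U a" "x \<in> U b" "x \<in> U c" for a b c
        using g that unfolding n1 cech_cocycle_1 One_nat_def by blast
      \<comment> \<open>The two triangles that subdivide the square with corners \<open>r i\<close>,
        \<open>r j\<close>, \<open>s i\<close>, \<open>s j\<close>; the diagonal term
        \<open>g [r i, s j] x\<close> cancels.\<close>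
      have "g [r j, s j] x - g [r i, s j] x + g [r i, r j] x = 0"
        "g [s i, s j] x - g [r i, s j] x + g [r i, s i] x = 0"
        by (rule eq; use r that in auto)+
      then show ?thesis
        by (simp add: cech_coboundary_simps k_def algebra_simps)
    qed
    show "g (map r is) x - g (map s is) x = cech_coboundary k is x"
      if "set is \<subseteq> \<V>" "length is = Suc n" "x \<in> cover_inter id is" for "is" x
      using that * n1 by (auto simp: length_Suc_conv)
  qed
next
  assume n2: "n = 2"
  define k where "k is x = g [r (is ! 0), r (is ! 1), s (is ! 1)] x - g [r (is ! 0), s (is ! 0), s (is ! 1)] x"
    for "is" x
  show thesis
  proof (rule that)
    have g2: "continuous_map (subtopology X (U a \<inter> U b \<inter> U c)) euclidean (g [a, b, c])"
      if "a \<in> I" "b \<in> I" "c \<in> I" for a b c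
      using g that unfolding n2 cech_cocycle_2 cech_cochain_2 by blast
    show "cech_cochain X (n - 1) \<V> id k"
      unfolding n2 k_def [abs_def] diff_Suc_1 numeral_2_eq_2 cech_cochain_1
    proof (intro ballI continuous_map_group_intros)
      fix i j assume ij: "i \<in> \<V>" "j \<in> \<V>"
      have "id i \<inter> id j \<subseteq> U (r i) \<inter> U (r j) \<inter> U (s j)" "id i \<inter> id j \<subseteq> U (r i) \<inter> U (s i) \<inter> U (s j)"
        using r [OF ij(1)] r [OF ij(2)] by auto
      then show "continuous_map (subtopology X (id i \<inter> id j)) euclidean
             (g [r ([i, j] ! 0), r ([i, j] ! 1), s ([i, j] ! 1)])"
        "continuous_map (subtopology X (id i \<inter> id j)) euclidean
             (g [r ([i, j] ! 0), s ([i, j] ! 0), s ([i, j] ! 1)])"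
        using r [OF ij(1)] r [OF ij(2)] continuous_map_subtopology_mono [OF g2] by simp_all
    qed
    have *: "g [r i, r j, r l] x - g [s i, s j, s l] x = cech_coboundary k [i, j, l] x"
      if "i \<in> \<V>" "j \<in> \<V>" "l \<in> \<V>" "x \<in> i" "x \<in> j" "x \<in> l" for i j l x
    proof -
      have eq: "g [b, c, d] x - g [a, c, d] x + g [a, b, d] x - g [a, b, c] x = 0"
        if "a \<in> I" "b \<in> I" "c \<in> I" "d \<in> I" "x \<in> U a" "x \<in> U b" "x \<in> U c" "x \<in> U d" for a b c d
        using g that unfolding n2 cech_cocycle_2 by blast
      \<comment> \<open>The three tetrahedra of the standard subdivision of the prism between the
        triangles \<open>r i, r j, r l\<close> and \<open>s i, s j, s l\<close>.\<close>
      have "g [s i, s j, s l] x - g [r i, s j, s l] x + g [r i, s i, s l] x - g [r i, s i, s j] x = 0"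
        "g [r j, s j, s l] x - g [r i, s j, s l] x + g [r i, r j, s l] x - g [r i, r j, s j] x = 0"
        "g [r j, r l, s l] x - g [r i, r l, s l] x + g [r i, r j, s l] x - g [r i, r j, r l] x = 0"
        by (rule eq; use r that in auto)+
      then have e: "g [s i, s j, s l] x = g [r i, s j, s l] x - g [r i, s i, s l] x + g [r i, s i, s j] x"
        "g [r j, s j, s l] x = g [r i, s j, s l] x - g [r i, r j, s l] x + g [r i, r j, s j] x"
        "g [r i, r j, r l] x = g [r j, r l, s l] x - g [r i, r l, s l] x + g [r i, r j, s l] x"
        by (simp_all add: algebra_simps)
      show ?thesis
        by (simp add: cech_coboundary_simps k_def e)
    qed
    show "g (map r is) x - g (map s is) x = cech_coboundary k is x"
      if "set is \<subseteq> \<V>" "length is = Suc n" "x \<in> cover_inter id is" for "is" x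
      using that * n2 by (auto simp: length_Suc_conv eval_nat_numeral)
  qed
qed

lemma open_cover_common_refinement:
  assumes "open_cover X \<V> id" "open_cover X \<W> id"
  obtains \<N> a b where "open_cover X \<N> id"
    "\<And>N. N \<in> \<N> \<Longrightarrow> a N \<in> \<V> \<and> N \<subseteq> a N \<and> b N \<in> \<W> \<and> N \<subseteq> b N"
proof -
  define \<N> where "\<N> = {V \<inter> W |V W. V \<in> \<V> \<and> W \<in> \<W>}"
  have "\<exists>V W. V \<in> \<V> \<and> N \<subseteq> V \<and> W \<in> \<W> \<and> N \<subseteq> W" if "N \<in> \<N>" for N
    using that unfolding \<N>_def by blast
  then obtain a b where ab: "\<And>N. N \<in> \<N> \<Longrightarrow> a N \<in> \<V> \<and> N \<subseteq> a N \<and> b N \<in> \<W> \<and> N \<subseteq> b N"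
    by metis
  have "\<Union>\<N> = \<Union>\<V> \<inter> \<Union>\<W>"
    unfolding \<N>_def by blast
  moreover have "openin X N" if "N \<in> \<N>" for N
    using that assms unfolding \<N>_def open_cover_def by auto
  ultimately have "open_cover X \<N> id"
    using assms unfolding open_cover_def by simp
  then show thesis
    using ab by (rule that)
qed

text \<open>On a common refinement the middle cocycle \<open>h\<close> appears pulled back along two
  unrelated maps, \<open>s \<circ> a\<close> and \<open>r' \<circ> b\<close>.
  \<open>cech_cocycle_prism\<close> makes these pullbacks cohomologous; this is where
  \<open>h\<close> has to be a cocycle and where the degree is restricted to 1 and 2.\<close>

lemma cech_cohomologous_trans:
  assumes gh: "cech_cohomologous X n I U g J V h" and hm: "cech_cohomologous X n J V h L W m"
    and h: "cech_cocycle X n J V h" and n: "n = 1 \<or> n = 2"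
  shows "cech_cohomologous X n I U g L W m"
proof -
  have n0: "n \<noteq> 0" using n by auto
  obtain \<V> r s k where 1: "open_cover X \<V> id"
    "\<forall>N\<in>\<V>. r N \<in> I \<and> N \<subseteq> U (r N) \<and> s N \<in> J \<and> N \<subseteq> V (s N)"
    "cech_cochain X (n - 1) \<V> id k"
    "\<And>is x. set is \<subseteq> \<V> \<Longrightarrow> length is = Suc n \<Longrightarrow> x\<in>cover_inter id is \<Longrightarrow>
      g (map r is) x - h (map s is) x = cech_coboundary k is x"
    using gh n0 unfolding cech_cohomologous_def by auto
  obtain \<V>' r' s' k' where 2: "open_cover X \<V>' id"
    "\<forall>N\<in>\<V>'. r' N \<in> J \<and> N \<subseteq> V (r' N) \<and> s' N \<in> L \<and> N \<subseteq> W (s' N)"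
    "cech_cochain X (n - 1) \<V>' id k'"
    "\<And>is x. set is \<subseteq> \<V>' \<Longrightarrow> length is = Suc n \<Longrightarrow> x\<in>cover_inter id is \<Longrightarrow>
      h (map r' is) x - m (map s' is) x = cech_coboundary k' is x"
    using hm n0 unfolding cech_cohomologous_def by auto
  obtain \<N> a b where N: "open_cover X \<N> id"
    and ab: "\<And>N. N \<in> \<N> \<Longrightarrow> a N \<in> \<V> \<and> N \<subseteq> a N \<and> b N \<in> \<V>' \<and> N \<subseteq> b N"
    by (rule open_cover_common_refinement [OF 1(1) 2(1)]) (rule that)
  obtain l where l: "cech_cochain X (n - 1) \<N> id l"
    "\<And>is x. set is \<subseteq> \<N> \<Longrightarrow> length is = Suc n \<Longrightarrow> x \<in> cover_inter id is \<Longrightarrow>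
      h (map (s \<circ> a) is) x - h (map (r' \<circ> b) is) x = cech_coboundary l is x"
  proof (rule cech_cocycle_prism [OF h n, of \<N> "s \<circ> a" "r' \<circ> b"])
    fix N assume "N \<in> \<N>"
    then show "(s \<circ> a) N \<in> J \<and> N \<subseteq> V ((s \<circ> a) N) \<and> (r' \<circ> b) N \<in> J \<and> N \<subseteq> V ((r' \<circ> b) N)"
      using ab [of N] 1(2) 2(2) by fastforce
  qed blast+
  let ?k = "\<lambda>is x. k (map a is) x + l is x + k' (map b is) x"
  show ?thesis
    unfolding cech_cohomologous_def
  proof (intro exI conjI allI impI ballI)
    show "open_cover X \<N> id" by fact
    show "(r \<circ> a) N \<in> I" "N \<subseteq> U ((r \<circ> a) N)" "(s' \<circ> b) N \<in> L" "N \<subseteq> W ((s' \<circ> b) N)" if "N \<in> \<N>" for N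
      using that ab [of N] 1(2) 2(2) by fastforce+
    have "cech_cochain X (n - 1) \<N> id (\<lambda>is. k (map a is))"
      "cech_cochain X (n - 1) \<N> id (\<lambda>is. k' (map b is))"
      using cech_cochain_refine [OF 1(3), of \<N> a id] cech_cochain_refine [OF 2(3), of \<N> b id] ab
      by auto
    then have "cech_cochain X (n - 1) \<N> id ?k"
      using l(1) by (auto simp: cech_cochain_def intro!: continuous_map_group_intros)
    then show "if n = 0 then ?k = (\<lambda>_ _. 0) else cech_cochain X (n - 1) \<N> id ?k"
      using n0 by simp
    fix "is" x assume "is": "set is \<subseteq> \<N> \<and> length is = Suc n" and x: "x \<in> cover_inter id is"
    have xa: "x \<in> cover_inter id (map a is)" "x \<in> cover_inter id (map b is)"
      using x cover_inter_map_mono [of "is" id id a] cover_inter_map_mono [of "is" id id b] "is" ab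
      by auto
    have "g (map r (map a is)) x - h (map s (map a is)) x = cech_coboundary k (map a is) x"
      by (rule 1(4)) (use "is" xa ab in auto)
    moreover have "h (map r' (map b is)) x - m (map s' (map b is)) x = cech_coboundary k' (map b is) x"
      by (rule 2(4)) (use "is" xa ab in auto)
    moreover have "h (map (s \<circ> a) is) x - h (map (r' \<circ> b) is) x = cech_coboundary l is x"
      by (rule l(2)) (use "is" x in auto)
    ultimately show "g (map (r \<circ> a) is) x - m (map (s' \<circ> b) is) x = cech_coboundary ?k is x"
      by (simp add: cech_coboundary_add cech_coboundary_map comp_def algebra_simps)
  qed
qed

lemma cech_class_eq:
  assumes "cech_cohomologous X n I U g J V h" "cech_cocycle X n I U g" "cech_cocycle X n J V h"
    and n: "n = 1 \<or> n = 2"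
  shows "cech_class X n I U g = cech_class X n J V h"
proof -
  have "n > 0" using n by auto
  then show ?thesis
    unfolding cech_class_def
    using cech_cohomologous_trans [OF cech_cohomologous_sym [OF assms(1)] _ assms(2) n]
      cech_cohomologous_trans [OF assms(1) _ assms(3) n] by auto
qed

text \<open>A class contains only representatives on covers indexed by themselves. Reindexing by the
  sets of the cover exhibits one, so that definite descriptions that start from a member of a class
  have something to refer to.\<close>

lemma cech_class_rep:
  assumes "cech_cocycle X n I U g" "n = 1 \<or> n = 2"
  shows "(U ` I, \<lambda>is. g (map (inv_into I U) is)) \<in> cech_class X n I U g"
proof -
  have "open_cover X (U ` I) id"
    using assms by (auto simp: cech_cocycle_def intro: open_cover_image)
  moreover have "inv_into I U V \<in> I \<and> id V \<subseteq> U (inv_into I U V)" if "V \<in> U ` I" for V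
    using that by (simp add: f_inv_into_f inv_into_into)
  moreover have "n > 0" using assms by auto
  ultimately show ?thesis
    using cech_cocycle_refine [OF assms(1), of "U ` I" id "inv_into I U"]
      cech_cohomologous_refine [of X "U ` I" id n "inv_into I U" I U g]
    unfolding cech_class_def by simp
qed

text \<open>A common member of the two classes, which exists by \<open>cech_class_rep\<close>, links
  \<open>g\<close> to \<open>h\<close>.\<close>

lemma cech_class_eq_imp_cohomologous:
  assumes "cech_class X n I U g = cech_class X n J V h"
    and g: "cech_cocycle X n I U g" and n: "n = 1 \<or> n = 2"
  shows "cech_cohomologous X n I U g J V h"
proof -
  have n0: "n > 0" using n by auto
  obtain \<U> g' where "(\<U>, g') \<in> cech_class X n I U g"
    using cech_class_rep [OF g n] by blast
  moreover from this have "(\<U>, g') \<in> cech_class X n J V h" using assms by simp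
  ultimately have *: "cech_cocycle X n \<U> id g'" "cech_cohomologous X n I U g \<U> id g'"
    "cech_cohomologous X n J V h \<U> id g'"
    unfolding cech_class_def by auto
  show ?thesis
    by (rule cech_cohomologous_trans [OF *(2) cech_cohomologous_sym [OF *(3) n0] *(1) n])
qed

section \<open>Refinements on paracompact spaces\<close>

text \<open>The classical argument: the members of a locally finite refinement that meet
  \<open>C\<close> have closures missing \<open>a\<close>, and by local finiteness the closure of
  their union is the union of these closures.\<close>

lemma paracompact_Hausdorff_imp_regular_space:
  assumes para: "paracompact_space X" and haus: "Hausdorff_space X"
  shows "regular_space X"
  unfolding regular_space_def
proof (intro allI impI, elim conjE)
  fix C a assume C: "closedin X C" and a: "a \<in> topspace X - C"
  define \<U> where "\<U> = insert (topspace X - C) {V. openin X V \<and> a \<notin> X closure_of V}"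
  have "\<Union>\<U> = topspace X"
  proof
    show "\<Union>\<U> \<subseteq> topspace X" by (auto simp: \<U>_def dest: openin_subset)
    show "topspace X \<subseteq> \<Union>\<U>"
    proof
      fix y assume y: "y \<in> topspace X"
      show "y \<in> \<Union>\<U>"
      proof (cases "y \<in> C")
        case True
        then obtain U V where UV: "openin X U" "openin X V" "a \<in> U" "y \<in> V" "disjnt U V"
          using haus a y unfolding Hausdorff_space_def by (metis DiffE)
        then have "a \<notin> X closure_of V"
          by (auto simp: in_closure_of disjnt_iff)
        then show ?thesis using UV by (auto simp: \<U>_def)
      qed (use y in \<open>auto simp: \<U>_def\<close>)
    qed
  qed
  moreover have "\<forall>U\<in>\<U>. openin X U"
    using C by (auto simp: \<U>_def)
  ultimately obtain \<V> where \<V>: "\<And>V. V \<in> \<V> \<Longrightarrow> openin X V \<and> (\<exists>U\<in>\<U>. V \<subseteq> U)"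
    "\<Union>\<V> = topspace X" "locally_finite_in X \<V>"
    using para unfolding paracompact_space_def by metis
  define \<W> where "\<W> = {V \<in> \<V>. V \<inter> C \<noteq> {}}"
  have "locally_finite_in X \<W>"
    using \<V>(3) by (rule locally_finite_in_subset) (auto simp: \<W>_def)
  then have cl: "X closure_of \<Union>\<W> = \<Union>((\<lambda>S. X closure_of S) ` \<W>)"
    by (rule closure_of_locally_finite_Union)
  have "a \<notin> X closure_of V" if "V \<in> \<W>" for V
  proof -
    have "V \<in> \<V>" "V \<inter> C \<noteq> {}" using that by (auto simp: \<W>_def)
    then obtain U where U: "U \<in> \<U>" "V \<subseteq> U" using \<V>(1) by blast
    then have "a \<notin> X closure_of U" using \<open>V \<inter> C \<noteq> {}\<close> by (auto simp: \<U>_def)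
    then show ?thesis using closure_of_mono [OF U(2)] by blast
  qed
  then have 1: "a \<in> topspace X - X closure_of \<Union>\<W>"
    using a cl by auto
  have 2: "openin X (topspace X - X closure_of \<Union>\<W>)" by auto
  have 3: "openin X (\<Union>\<W>)" using \<V>(1) by (auto simp: \<W>_def)
  have 4: "C \<subseteq> \<Union>\<W>"
    using \<V>(2) closedin_subset [OF C] by (fastforce simp: \<W>_def)
  have "disjnt (topspace X - X closure_of \<Union>\<W>) (\<Union>\<W>)"
    using closure_of_subset [OF openin_subset [OF 3]] by (auto simp: disjnt_iff)
  then show "\<exists>U V. openin X U \<and> openin X V \<and> a \<in> U \<and> C \<subseteq> V \<and> disjnt U V"
    using 1 2 3 4 by blast
qed

text \<open>Supplies lifts of a \<open>1\<close>-cocycle over all double intersections of one cover, which the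
  connecting map needs.\<close>

lemma paracompact_pair_refinement:
  assumes para: "paracompact_space X" and haus: "Hausdorff_space X"
    and \<U>: "open_cover X \<U> id"
    and loc: "\<And>U V x. U \<in> \<U> \<Longrightarrow> V \<in> \<U> \<Longrightarrow> x \<in> U \<Longrightarrow> x \<in> V \<Longrightarrow> \<exists>N. openin X N \<and> x \<in> N \<and> Q U V N"
    and mono: "\<And>U V N N'. Q U V N \<Longrightarrow> N' \<subseteq> N \<Longrightarrow> Q U V N'"
  obtains \<N> r where "open_cover X \<N> id" "\<And>N. N \<in> \<N> \<Longrightarrow> r N \<in> \<U> \<and> N \<subseteq> r N"
    "\<And>M N. M \<in> \<N> \<Longrightarrow> N \<in> \<N> \<Longrightarrow> M \<inter> N \<noteq> {} \<Longrightarrow> Q (r M) (r N) (M \<inter> N)"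
proof -
  have reg: "regular_space X" by (rule paracompact_Hausdorff_imp_regular_space [OF para haus])
  \<comment> \<open>Regularity provides a cover by sets whose closures, and not only the sets, lie
    in members of \<open>\<U>\<close>.\<close>
  define \<S> where "\<S> = {S. openin X S \<and> (\<exists>U\<in>\<U>. X closure_of S \<subseteq> U)}"
  have U\<U>: "\<Union>\<U> = topspace X" "\<And>U. U \<in> \<U> \<Longrightarrow> openin X U"
    using \<U> by (auto simp: open_cover_def)
  have "\<Union>\<S> = topspace X"
  proof
    show "\<Union>\<S> \<subseteq> topspace X" by (auto simp: \<S>_def dest: openin_subset)
    show "topspace X \<subseteq> \<Union>\<S>"
    proof
      fix x assume x: "x \<in> topspace X"
      then obtain U where U: "U \<in> \<U>" "x \<in> U" using U\<U> by blast
      then have "closedin X (topspace X - U)" "x \<in> topspace X - (topspace X - U)"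
        using U\<U> x by auto
      then obtain S where S: "openin X S" "x \<in> S" "disjnt (topspace X - U) (X closure_of S)"
        using reg unfolding regular_space by blast
      then have "X closure_of S \<subseteq> U"
        using closure_of_subset_topspace [of X S] by (auto simp: disjnt_iff)
      then show "x \<in> \<Union>\<S>" using S U by (auto simp: \<S>_def)
    qed
  qed
  moreover have "\<forall>S\<in>\<S>. openin X S" by (auto simp: \<S>_def)
  ultimately obtain \<V> where \<V>: "\<And>V. V \<in> \<V> \<Longrightarrow> openin X V \<and> (\<exists>S\<in>\<S>. V \<subseteq> S)"
    "\<Union>\<V> = topspace X" "locally_finite_in X \<V>"
    using para unfolding paracompact_space_def by metis
  have "\<exists>U\<in>\<U>. X closure_of V \<subseteq> U" if V: "V \<in> \<V>" for V
  proof -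
    obtain S where "S \<in> \<S>" "V \<subseteq> S" using \<V>(1) [OF V] by blast
    then show ?thesis using closure_of_mono [of V S X] by (auto simp: \<S>_def)
  qed
  then obtain u where u: "\<And>V. V \<in> \<V> \<Longrightarrow> u V \<in> \<U> \<and> X closure_of V \<subseteq> u V" by metis
  \<comment> \<open>Local finiteness in a sharper form: near \<open>x\<close> only those
    \<open>V\<close> are met whose closure contains \<open>x\<close>. There are finitely many of
    them, so one neighbourhood serves all their pairs.\<close>
  have "\<exists>N V. openin X N \<and> x \<in> N \<and> V \<in> \<V> \<and> N \<subseteq> V \<and>
      (\<forall>V\<in>\<V>. V \<inter> N \<noteq> {} \<longrightarrow> x \<in> X closure_of V) \<and>
      (\<forall>V\<in>\<V>. \<forall>W\<in>\<V>. x \<in> X closure_of V \<longrightarrow> x \<in> X closure_of W \<longrightarrow> Q (u V) (u W) N)"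
    if x: "x \<in> topspace X" for x
  proof -
    obtain V0 where V0: "V0 \<in> \<V>" "x \<in> V0" using \<V>(2) x by blast
    obtain M where M: "openin X M" "x \<in> M" "finite {V \<in> \<V>. V \<inter> M \<noteq> {}}"
      using \<V>(3) x unfolding locally_finite_in_def by blast
    define F where "F = {V \<in> \<V>. V \<inter> M \<noteq> {}}"
    define C where "C = {V \<in> F. x \<in> X closure_of V}"
    have fin: "finite F" using M(3) by (simp add: F_def)
    then have fin': "finite C" by (simp add: C_def)
    have CF: "V \<in> C" if "V \<in> \<V>" "x \<in> X closure_of V" for V
      using that M by (auto simp: C_def F_def in_closure_of)
    have "\<forall>P\<in>C\<times>C. \<exists>N. openin X N \<and> x \<in> N \<and> Q (u (fst P)) (u (snd P)) N"
    proof (clarify, simp)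
      fix V W assume "V \<in> C" "W \<in> C"
      then have "u V \<in> \<U>" "u W \<in> \<U>" "x \<in> u V" "x \<in> u W"
        using u by (auto simp: C_def F_def)
      then show "\<exists>N. openin X N \<and> x \<in> N \<and> Q (u V) (u W) N" by (rule loc)
    qed
    then obtain n where n: "\<And>P. P \<in> C\<times>C \<Longrightarrow> openin X (n P) \<and> x \<in> n P \<and> Q (u (fst P)) (u (snd P)) (n P)"
      by metis
    \<comment> \<open>The last family cuts away the finitely many \<open>V\<close> that meet
      \<open>M\<close> but whose closure misses \<open>x\<close>.\<close>
    define N where "N = \<Inter>(insert (V0 \<inter> M) (n ` (C\<times>C) \<union> (\<lambda>V. topspace X - X closure_of V) ` (F - C)))"
    have "openin X N"
      unfolding N_def
    proof (rule openin_Inter)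
      show "openin X S" if "S \<in> insert (V0 \<inter> M) (n ` (C\<times>C) \<union> (\<lambda>V. topspace X - X closure_of V) ` (F - C))" for S
        using that n V0 \<V>(1) M(1) by auto
    qed (use fin fin' in auto)
    moreover have "x \<in> N"
      using n V0 M(2) x by (auto simp: N_def C_def)
    moreover have "N \<subseteq> V0" by (auto simp: N_def)
    moreover have "x \<in> X closure_of V" if "V \<in> \<V>" "V \<inter> N \<noteq> {}" for V
    proof (rule ccontr)
      assume "x \<notin> X closure_of V"
      then have "V \<in> F - C" using that by (auto simp: F_def C_def N_def)
      then have "N \<subseteq> topspace X - X closure_of V" by (auto simp: N_def)
      moreover have "V \<subseteq> X closure_of V"
        using \<V>(1) that by (simp add: closure_of_subset openin_subset)
      ultimately show False using that by auto
    qed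
    moreover have "Q (u V) (u W) N" if "V \<in> \<V>" "W \<in> \<V>" "x \<in> X closure_of V" "x \<in> X closure_of W" for V W
    proof -
      have P: "(V, W) \<in> C \<times> C" using CF that by auto
      then have "N \<subseteq> n (V, W)" unfolding N_def by blast
      then show ?thesis using mono n [OF P] by auto
    qed
    ultimately show ?thesis using V0(1) by blast
  qed
  then obtain N v where N: "\<And>x. x \<in> topspace X \<Longrightarrow> openin X (N x) \<and> x \<in> N x \<and> v x \<in> \<V> \<and> N x \<subseteq> v x \<and>
      (\<forall>V\<in>\<V>. V \<inter> N x \<noteq> {} \<longrightarrow> x \<in> X closure_of V) \<and>
      (\<forall>V\<in>\<V>. \<forall>W\<in>\<V>. x \<in> X closure_of V \<longrightarrow> x \<in> X closure_of W \<longrightarrow> Q (u V) (u W) (N x))"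
    by metis
  define c where "c = inv_into (topspace X) N"
  have c: "c M \<in> topspace X" "N (c M) = M" if "M \<in> N ` topspace X" for M
    using that by (auto simp: c_def inv_into_into f_inv_into_f)
  show thesis
  proof (rule that)
    show "open_cover X (N ` topspace X) id"
    proof -
      have "\<Union>(N ` topspace X) = topspace X"
        using N openin_subset by fastforce
      then show ?thesis using N by (auto simp: open_cover_def)
    qed
    show "(u \<circ> v \<circ> c) M \<in> \<U> \<and> M \<subseteq> (u \<circ> v \<circ> c) M" if M: "M \<in> N ` topspace X" for M
    proof -
      have v: "v (c M) \<in> \<V>" "M \<subseteq> v (c M)" using N [OF c(1) [OF M]] c(2) [OF M] by auto
      moreover have "v (c M) \<subseteq> X closure_of (v (c M))"
        using \<V>(1) [OF v(1)] by (simp add: closure_of_subset openin_subset)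
      ultimately show ?thesis using u [OF v(1)] by auto
    qed
    show "Q ((u \<circ> v \<circ> c) M) ((u \<circ> v \<circ> c) L) (M \<inter> L)"
      if M: "M \<in> N ` topspace X" and L: "L \<in> N ` topspace X" and ne: "M \<inter> L \<noteq> {}" for M L
    proof -
      note NM = N [OF c(1) [OF M]] and NL = N [OF c(1) [OF L]]
      have v: "v (c M) \<in> \<V>" "M \<subseteq> v (c M)" "v (c L) \<in> \<V>" "L \<subseteq> v (c L)"
        using NM NL c(2) [OF M] c(2) [OF L] by auto
      \<comment> \<open>The centre \<open>c M\<close> alone controls the pair: \<open>M\<close> and
        \<open>L\<close> lie in \<open>v (c M)\<close> and \<open>v (c L)\<close>, so both of these
        meet \<open>N (c M)\<close> and hence have \<open>c M\<close> in their closures.\<close>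
      then have "v (c M) \<inter> N (c M) \<noteq> {}" "v (c L) \<inter> N (c M) \<noteq> {}"
        using ne c(2) [OF M] by auto
      then have "Q (u (v (c M))) (u (v (c L))) (N (c M))"
        using NM v by auto
      then show ?thesis
        using c(2) [OF M] mono [where N' = "M \<inter> L"] by auto
    qed
  qed
qed

section \<open>Lifting through homomorphisms with local sections\<close>

lemma additive_hom_add: "additive_hom h \<Longrightarrow> h (x + y) = h x + h y"
  unfolding additive_hom_def by blast

lemma additive_hom_zero:
  assumes "additive_hom h" shows "h 0 = 0"
  by (rule add_left_imp_eq [of "h 0"]) (simp add: additive_hom_add [OF assms, symmetric])

lemma additive_hom_uminus:
  assumes "additive_hom h" shows "h (- x) = - h x"
  using additive_hom_add [OF assms, of x "- x"] additive_hom_zero [OF assms]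
  by (simp add: minus_unique)

lemma additive_hom_diff:
  assumes "additive_hom h" shows "h (x - y) = h x - h y"
  using additive_hom_add [OF assms, of x "- y"] additive_hom_uminus [OF assms, of y] by simp

lemmas additive_hom_simps = additive_hom_zero additive_hom_add additive_hom_uminus additive_hom_diff

lemma continuous_map_locally_constant:
  fixes G :: "'x \<Rightarrow> 'a::topological_space"
  assumes "\<And>x. x \<in> topspace X \<Longrightarrow> \<exists>N. openin X N \<and> x \<in> N \<and> (\<forall>y\<in>N. G y = G x)"
  shows "continuous_map X euclidean G"
  unfolding continuous_map_def
proof (intro conjI allI impI)
  fix U :: "'a set" assume "openin euclidean U"
  show "openin X {x \<in> topspace X. G x \<in> U}"
  proof (subst openin_subopen, clarify)
    fix x assume x: "x \<in> topspace X" "G x \<in> U"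
    obtain N where N: "openin X N" "x \<in> N" "\<forall>y\<in>N. G y = G x" using assms [OF x(1)] by blast
    then show "\<exists>T. openin X T \<and> x \<in> T \<and> T \<subseteq> {x \<in> topspace X. G x \<in> U}"
      using x openin_subset by (intro exI [of _ N]) fastforce
  qed
qed simp

text \<open>What a central extension and the covering \<open>q\<close> have in common. Together with
  additivity it carries every lifting argument below, so each is given once for both maps.\<close>

definition local_sections :: "('e::topological_space \<Rightarrow> 'k::topological_space) \<Rightarrow> bool" where
  "local_sections \<pi> \<longleftrightarrow> (\<forall>y. \<exists>U s. open U \<and> y \<in> U \<and> continuous_on U s \<and> (\<forall>u\<in>U. \<pi> (s u) = u))"

lemma central_extension_trivialization:
  assumes "central_extension i p"
  obtains U s where "open U" "b \<in> U" "continuous_on U s" "\<And>u. u \<in> U \<Longrightarrow> p (s u) = u"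
    "homeomorphic_map (prod_topology (subtopology euclidean U) euclidean)
       (subtopology euclidean {y \<in> topspace euclidean. p y \<in> U}) (\<lambda>(u, z). s u + i z)"
proof -
  have "\<exists>U s. openin euclidean U \<and> b \<in> U \<and> continuous_map (subtopology euclidean U) euclidean s \<and>
      (\<forall>u\<in>U. p (s u) = u) \<and>
      homeomorphic_map (prod_topology (subtopology euclidean U) euclidean)
        (subtopology euclidean {y \<in> topspace euclidean. p y \<in> U}) (\<lambda>(u, z). s u + i z)"
    using assms unfolding central_extension_def principal_bundle_def by simp
  then show thesis using that by auto
qed

lemma central_extension_local_sections:
  assumes "central_extension i p" shows "local_sections p"
  unfolding local_sections_def
proof
  fix y
  obtain U s where "open U" "y \<in> U" "continuous_on U s" "\<And>u. u \<in> U \<Longrightarrow> p (s u) = u"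
    by (rule central_extension_trivialization [OF assms, where b = y]) (rule that)
  then show "\<exists>U s. open U \<and> y \<in> U \<and> continuous_on U s \<and> (\<forall>u\<in>U. p (s u) = u)" by blast
qed

lemma K_Gamma_1_local_sections:
  assumes "K_Gamma_1_group j q" shows "local_sections q"
  unfolding local_sections_def
proof
  fix y
  have cov: "covering_space UNIV q UNIV" using assms by (simp add: K_Gamma_1_group_def)
  then have "y \<in> q ` UNIV" using covering_space_imp_surjective by blast
  then obtain w where w: "q w = y" by blast
  obtain T u q' where "w \<in> T" "openin (top_of_set UNIV) T" "q w \<in> u" "openin (top_of_set UNIV) u"
    "homeomorphism T u q q'"
    by (rule covering_space_local_homeomorphism [OF cov, of w]) (auto intro: that)
  then show "\<exists>U s. open U \<and> y \<in> U \<and> continuous_on U s \<and> (\<forall>u\<in>U. q (s u) = u)"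
    using w by (intro exI [of _ u] exI [of _ q']) (auto simp: homeomorphism_def)
qed

lemma local_sections_lift:
  assumes "local_sections \<pi>" "continuous_map X euclidean f" "x \<in> topspace X"
  obtains N F where "openin X N" "x \<in> N" "continuous_map (subtopology X N) euclidean F"
    "\<And>y. y \<in> N \<Longrightarrow> \<pi> (F y) = f y"
proof -
  obtain U s where U: "open U" "f x \<in> U" "continuous_on U s" "\<forall>u\<in>U. \<pi> (s u) = u"
    using assms(1) unfolding local_sections_def by blast
  show thesis
  proof
    let ?N = "{y \<in> topspace X. f y \<in> U}"
    show "openin X ?N"
      using openin_continuous_map_preimage [OF assms(2), of U] U by simp
    have "continuous_map (subtopology X ?N) (top_of_set U) f"
      using assms(2) by (auto simp: continuous_map_in_subtopology continuous_map_from_subtopology)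
    moreover have "continuous_map (top_of_set U) euclidean s"
      using U(3) by simp
    ultimately show "continuous_map (subtopology X ?N) euclidean (s \<circ> f)"
      by (rule continuous_map_compose)
  qed (use U assms(3) in auto)
qed

text \<open>Topologically \<open>i\<close> is an embedding, because a trivialization over a
  neighbourhood of \<open>0\<close> identifies the fibre over \<open>0\<close> with the structure
  group; the inverse chart recovers \<open>G\<close> from \<open>F\<close>.\<close>

lemma central_extension_continuous_kernel:
  fixes i :: "'z::topological_ab_group_add \<Rightarrow> 'e::topological_group_add"
  assumes ce: "central_extension i p" and F: "continuous_map X euclidean F"
    and FG: "\<And>x. x \<in> topspace X \<Longrightarrow> F x = i (G x)"
  shows "continuous_map X euclidean G"
proof -
  obtain U s where U: "open U" "0 \<in> U" "continuous_on U s" "\<And>u. u \<in> U \<Longrightarrow> p (s u) = u"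
    and h: "homeomorphic_map (prod_topology (subtopology euclidean U) euclidean)
          (subtopology euclidean {y \<in> topspace euclidean. p y \<in> U}) (\<lambda>(u, z). s u + i z)"
    by (rule central_extension_trivialization [OF ce, where b = 0]) (rule that)
  obtain k where k: "homeomorphic_maps (prod_topology (subtopology euclidean U) euclidean)
          (subtopology euclidean {y \<in> topspace euclidean. p y \<in> U}) (\<lambda>(u, z). s u + i z) k"
    using h unfolding homeomorphic_map_maps by blast
  have p: "additive_hom p" "\<And>z. p (i z) = 0"
    using ce unfolding central_extension_def by auto
  \<comment> \<open>The section \<open>s\<close> may be nonzero at \<open>0\<close>; adding
    \<open>s 0\<close> puts the map into the form \<open>s 0 + i (G x)\<close> that the chart
    describes.\<close>
  have "continuous_map X (subtopology euclidean {y \<in> topspace euclidean. p y \<in> U}) (\<lambda>x. s 0 + F x)"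
    unfolding continuous_map_in_subtopology
    using F FG p U by (auto intro!: continuous_map_group_add simp: additive_hom_add)
  then have "continuous_map X (prod_topology (subtopology euclidean U) euclidean) (k \<circ> (\<lambda>x. s 0 + F x))"
    using k unfolding homeomorphic_maps_def by (auto intro: continuous_map_compose)
  then have "continuous_map X euclidean (snd \<circ> (k \<circ> (\<lambda>x. s 0 + F x)))"
    by (rule continuous_map_compose) (rule continuous_map_snd)
  then show ?thesis
  proof (rule continuous_map_eq)
    fix x assume "x \<in> topspace X"
    moreover have "k (s 0 + i (G x)) = (0, G x)"
      using k U(2) unfolding homeomorphic_maps_def by force
    ultimately show "(snd \<circ> (k \<circ> (\<lambda>x. s 0 + F x))) x = G x" using FG by simp
  qed
qed

text \<open>\<open>q\<close> is injective near \<open>0\<close>, so \<open>0\<close> is isolated in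
  its kernel. Nearby values of \<open>F\<close> differ by a small element of that kernel, hence not
  at all, and \<open>G\<close> is locally constant.\<close>

lemma K_Gamma_1_continuous_kernel:
  assumes KG: "K_Gamma_1_group j q" and F: "continuous_map X euclidean F"
    and FG: "\<And>x. x \<in> topspace X \<Longrightarrow> F x = j (G x)"
  shows "continuous_map X euclidean G"
proof (rule continuous_map_locally_constant)
  fix x0 assume x0: "x0 \<in> topspace X"
  have cov: "covering_space UNIV q UNIV" and q: "additive_hom q" and inj: "inj j"
    and ker: "range j = {w. q w = 0}" using KG by (auto simp: K_Gamma_1_group_def)
  obtain T u q' where T: "0 \<in> T" "openin (top_of_set UNIV) T"
    "homeomorphism T u q q'"
    by (rule covering_space_local_homeomorphism [OF cov, of 0]) (auto intro: that)
  define N where "N = {x \<in> topspace X. F x - F x0 \<in> T}"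
  have "continuous_map X euclidean (\<lambda>x. F x - F x0)"
    by (intro continuous_map_group_diff F) simp
  then have "openin X N"
    unfolding N_def using T(2) by (auto intro: openin_continuous_map_preimage)
  moreover have "x0 \<in> N" using x0 T(1) by (simp add: N_def)
  moreover have "G x = G x0" if x: "x \<in> N" for x
  proof -
    have "q (j a) = 0" for a using ker by blast
    then have "q (F x - F x0) = q 0"
      using x x0 FG q by (simp add: N_def additive_hom_simps)
    then have "F x - F x0 = 0"
      using T x unfolding homeomorphism_def N_def by (metis (mono_tags, lifting) mem_Collect_eq)
    then show ?thesis using FG x x0 inj by (simp add: N_def inj_eq)
  qed
  ultimately show "\<exists>N. openin X N \<and> x0 \<in> N \<and> (\<forall>y\<in>N. G y = G x0)" by blast
qed

text \<open>Evaluation of a homotopy at two independent times, as required for the uniform control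
  of increments in \<open>compact_homotopy_lift\<close>.\<close>

lemma continuous_map_prod_duplicate:
  assumes H: "continuous_map (prod_topology T Y) Z H"
  shows "continuous_map (prod_topology (prod_topology T T) Y) Z (\<lambda>ab. H (fst (fst ab), snd ab))"
    and "continuous_map (prod_topology (prod_topology T T) Y) Z (\<lambda>ab. H (snd (fst ab), snd ab))"
proof -
  have "continuous_map (prod_topology (prod_topology T T) Y) (prod_topology T Y) (\<lambda>ab. (fst (fst ab), snd ab))"
    "continuous_map (prod_topology (prod_topology T T) Y) (prod_topology T Y) (\<lambda>ab. (snd (fst ab), snd ab))"
    by (auto simp: continuous_map_pairwise comp_def continuous_map_snd
        intro: continuous_map_compose [OF continuous_map_fst continuous_map_fst, unfolded comp_def]
          continuous_map_compose [OF continuous_map_fst continuous_map_snd, unfolded comp_def])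
  from this [THEN continuous_map_compose, OF H]
  show "continuous_map (prod_topology (prod_topology T T) Y) Z (\<lambda>ab. H (fst (fst ab), snd ab))"
    "continuous_map (prod_topology (prod_topology T T) Y) Z (\<lambda>ab. H (snd (fst ab), snd ab))"
    by (simp_all add: comp_def)
qed

text \<open>For close times the increments of \<open>H\<close> take values in the domain of a local section, and the
  lifts of the increments add up because \<open>\<pi>\<close> is a homomorphism.\<close>

lemma compact_homotopy_lift:
  fixes \<pi> :: "'e::topological_group_add \<Rightarrow> 'k::topological_group_add"
  assumes hom: "additive_hom \<pi>" and sec: "local_sections \<pi>" and Y: "compact_space Y"
    and H: "continuous_map (prod_topology (top_of_set {0..1::real}) Y) euclidean H"
  obtains F where "continuous_map Y euclidean F"
    "\<And>y. y \<in> topspace Y \<Longrightarrow> \<pi> (F y) = - H (0, y) + H (1, y)"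
    "\<And>y. y \<in> topspace Y \<Longrightarrow> (\<And>t. t \<in> {0..1} \<Longrightarrow> H (t, y) = H (0, y)) \<Longrightarrow> F y = 0"
proof -
  obtain U s0 where U: "open U" "0 \<in> U" "continuous_on U s0" "\<forall>u\<in>U. \<pi> (s0 u) = u"
    using sec unfolding local_sections_def by blast
  \<comment> \<open>Normalised so that a zero increment lifts to \<open>0\<close>. This yields the
    third conclusion, through which base points are preserved later.\<close>
  define s where "s u = s0 u - s0 0" for u
  have s: "continuous_map (top_of_set U) euclidean s" "\<And>u. u \<in> U \<Longrightarrow> \<pi> (s u) = u" "s 0 = 0"
    using U by (auto simp: s_def [abs_def] additive_hom_simps [OF hom] intro!: continuous_intros)
  let ?I = "top_of_set {0..1::real}"
  define B where "B y \<longleftrightarrow> (\<forall>t\<in>{0..1}. H (t, y) = H (0, y))" for y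
  have B: "H (t, y) = H (0, y)" if "B y" "t \<in> {0..1}" for t y
    using that unfolding B_def by blast
  define P where "P t \<longleftrightarrow> (\<exists>F. continuous_map Y euclidean F \<and>
    (\<forall>y\<in>topspace Y. \<pi> (F y) = - H (0, y) + H (t, y) \<and> (B y \<longrightarrow> F y = 0)))" for t
  have "P 1"
  \<comment> \<open>Induction over the connected interval replaces a subdivision by a Lebesgue
    number: \<open>P\<close> passes between any two times near \<open>t0\<close>.\<close>
  proof (rule connected_induction_simple [of "{0..1}" 0 1 P])
    show "P 0" unfolding P_def
      by (rule exI [of _ "\<lambda>_. 0"]) (simp add: additive_hom_zero [OF hom])
    fix t0 :: real assume t0: "t0 \<in> {0..1}"
    let ?D = "\<lambda>ab. - H (fst (fst ab), snd ab) + H (snd (fst ab), snd ab)"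
    have D: "continuous_map (prod_topology (prod_topology ?I ?I) Y) euclidean ?D"
      by (intro continuous_map_group_intros continuous_map_prod_duplicate H)
    define W where "W = {ab \<in> topspace (prod_topology (prod_topology ?I ?I) Y). ?D ab \<in> U}"
    have W: "openin (prod_topology (prod_topology ?I ?I) Y) W"
      unfolding W_def using U(1) by (intro openin_continuous_map_preimage [OF D]) simp
    \<comment> \<open>Compactness of \<open>Y\<close> makes the smallness of the increments near the
      diagonal point \<open>(t0, t0)\<close> uniform in \<open>y\<close>.\<close>
    have "\<exists>A V. openin (prod_topology ?I ?I) A \<and> openin Y V \<and> (t0, t0) \<in> A \<and> topspace Y \<subseteq> V \<and> A \<times> V \<subseteq> W"
    proof (rule tube_lemma_right [OF W])
      show "compactin Y (topspace Y)" using Y by (simp add: compact_space_def)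
      show "{(t0, t0)} \<times> topspace Y \<subseteq> W" using t0 U(2) by (auto simp: W_def)
    qed (use t0 in auto)
    then obtain A V where A: "openin (prod_topology ?I ?I) A" "(t0, t0) \<in> A" and V: "topspace Y \<subseteq> V" "A \<times> V \<subseteq> W"
      by (elim exE conjE)
    obtain A1 A2 where A12: "openin ?I A1" "openin ?I A2" "t0 \<in> A1" "t0 \<in> A2" "A1 \<times> A2 \<subseteq> A"
      using A(1) [unfolded openin_prod_topology_alt, rule_format, OF A(2)] by (elim exE conjE)
    have step: "P b" if "a \<in> A1 \<inter> A2" "b \<in> A1 \<inter> A2" and Pa: "P a" for a b
    proof -
      have "A1 \<subseteq> {0..1}" using openin_subset [OF A12(1)] by simp
      then have ab: "a \<in> {0..1}" "b \<in> {0..1}" using that by auto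
      obtain F where F: "continuous_map Y euclidean F"
        "\<And>y. y \<in> topspace Y \<Longrightarrow> \<pi> (F y) = - H (0, y) + H (a, y)"
        "\<And>y. y \<in> topspace Y \<Longrightarrow> B y \<Longrightarrow> F y = 0"
        using Pa unfolding P_def by blast
      have inU: "- H (a, y) + H (b, y) \<in> U" if "y \<in> topspace Y" for y
      proof -
        have "((a, b), y) \<in> W" using V A12(5) that \<open>a \<in> A1 \<inter> A2\<close> \<open>b \<in> A1 \<inter> A2\<close> by auto
        then show ?thesis by (simp add: W_def)
      qed
      have Ha: "continuous_map Y euclidean (\<lambda>y. H (t, y))" if "t \<in> {0..1}" for t
        by (rule continuous_map_compose [OF _ H, unfolded comp_def])
          (use that in \<open>simp add: continuous_map_paired\<close>)
      have "continuous_map Y (top_of_set U) (\<lambda>y. - H (a, y) + H (b, y))"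
        unfolding continuous_map_in_subtopology
        using inU ab by (auto intro!: continuous_map_group_intros Ha)
      then have "continuous_map Y euclidean (\<lambda>y. s (- H (a, y) + H (b, y)))"
        using s(1) by (rule continuous_map_compose [unfolded comp_def])
      \<comment> \<open>The new lift is appended on the right, so that
        \<open>(- H (0, y) + H (a, y)) + (- H (a, y) + H (b, y))\<close> telescopes in a
        noncommutative group.\<close>
      then have "continuous_map Y euclidean (\<lambda>y. F y + s (- H (a, y) + H (b, y)))"
        by (intro continuous_map_group_intros F(1))
      moreover have "\<pi> (F y + s (- H (a, y) + H (b, y))) = - H (0, y) + H (b, y)" if "y \<in> topspace Y" for y
        using F(2) s(2) inU that by (simp add: additive_hom_simps [OF hom] add.assoc [symmetric])
      moreover have "F y + s (- H (a, y) + H (b, y)) = 0"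
        if "y \<in> topspace Y" "B y" for y
        using F(3) [OF that] B [OF that(2) ab(1)] B [OF that(2) ab(2)] s(3) by simp
      ultimately show "P b" unfolding P_def by blast
    qed
    show "\<exists>T. openin ?I T \<and> t0 \<in> T \<and> (\<forall>x\<in>T. \<forall>y\<in>T. P x \<longrightarrow> P y)"
    proof (intro exI conjI ballI impI)
      show "openin ?I (A1 \<inter> A2)" using A12(1,2) by (rule openin_Int)
      show "t0 \<in> A1 \<inter> A2" using A12(3,4) by blast
    qed (rule step)
  qed simp_all
  then obtain F where F: "continuous_map Y euclidean F" "\<forall>y\<in>topspace Y. \<pi> (F y) = - H (0, y) + H (1, y) \<and>
      (B y \<longrightarrow> F y = 0)"
    unfolding P_def by blast
  show thesis
  proof (rule that [OF F(1)])
    fix y assume y: "y \<in> topspace Y"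
    then show "\<pi> (F y) = - H (0, y) + H (1, y)" using F(2) by blast
    assume "\<And>t. t \<in> {0..1} \<Longrightarrow> H (t, y) = H (0, y)"
    then have "B y" unfolding B_def by blast
    then show "F y = 0" using F(2) y by blast
  qed
qed

section \<open>Difference cocycles\<close>

definition local_lifts ::
  "('e::topological_space \<Rightarrow> 'k) \<Rightarrow> 'x topology \<Rightarrow> ('x \<Rightarrow> 'k) \<Rightarrow> 'i set \<Rightarrow> ('i \<Rightarrow> 'x set) \<Rightarrow> ('i \<Rightarrow> 'x \<Rightarrow> 'e) \<Rightarrow> bool"
where
  "local_lifts p X f I U s \<longleftrightarrow>
     (\<forall>a\<in>I. continuous_map (subtopology X (U a)) euclidean (s a) \<and> (\<forall>x\<in>U a. p (s a x) = f x))"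

definition difference_cochain ::
  "('z \<Rightarrow> 'e::group_add) \<Rightarrow> 'i set \<Rightarrow> ('i \<Rightarrow> 'x set) \<Rightarrow> ('i \<Rightarrow> 'x \<Rightarrow> 'e) \<Rightarrow> ('i list \<Rightarrow> 'x \<Rightarrow> 'z) \<Rightarrow> bool"
where
  "difference_cochain i I U s g \<longleftrightarrow>
     (\<forall>a\<in>I. \<forall>b\<in>I. \<forall>x\<in>U a \<inter> U b. s a x = s b x + i (g [a, b] x))"

text \<open>The data of \<open>cech_connecting\<close> in degree 1, but for covers with any index
  set: pulled-back covers and the cover by stars are not indexed by themselves.\<close>

definition connecting_data ::
  "('g \<Rightarrow> 'w::topological_ab_group_add) \<Rightarrow> ('w \<Rightarrow> 'z) \<Rightarrow> 'x topology \<Rightarrow> 'i set \<Rightarrow> ('i \<Rightarrow> 'x set) \<Rightarrow>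
     ('i list \<Rightarrow> 'x \<Rightarrow> 'z) \<Rightarrow> ('i list \<Rightarrow> 'x \<Rightarrow> 'w) \<Rightarrow> ('i list \<Rightarrow> 'x \<Rightarrow> 'g) \<Rightarrow> bool"
where
  "connecting_data j q X I U g gt a \<longleftrightarrow> cech_cochain X 1 I U gt \<and>
     (\<forall>b\<in>I. \<forall>c\<in>I. \<forall>x\<in>U b \<inter> U c. q (gt [b, c] x) = g [b, c] x) \<and>
     (\<forall>b\<in>I. \<forall>c\<in>I. \<forall>d\<in>I. \<forall>x\<in>U b \<inter> U c \<inter> U d.
        j (a [b, c, d] x) = gt [c, d] x - gt [b, d] x + gt [b, c] x)"

lemma central_extension_kernelD:
  assumes "central_extension i p" "p y = 0"
  shows "i (inv_into UNIV i y) = y"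
  using assms unfolding central_extension_def by (intro f_inv_into_f) simp

lemma K_Gamma_1_kernelD:
  assumes "K_Gamma_1_group j q" "q w = 0"
  shows "j (inv_into UNIV j w) = w"
  using assms unfolding K_Gamma_1_group_def by (intro f_inv_into_f) simp

lemma difference_cochain_exists:
  assumes ce: "central_extension i p" and s: "local_lifts p X f I U s"
  obtains g where "difference_cochain i I U s g"
proof
  show "difference_cochain i I U s (\<lambda>is x. inv_into UNIV i (- s (is ! 1) x + s (is ! 0) x))"
    unfolding difference_cochain_def
  proof (intro ballI)
    fix a b x assume ab: "a \<in> I" "b \<in> I" "x \<in> U a \<inter> U b"
    have p: "additive_hom p" using ce by (simp add: central_extension_def)
    have "p (- s b x + s a x) = 0"
      using s ab by (simp add: local_lifts_def additive_hom_simps [OF p])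
    then show "s a x = s b x + i (inv_into UNIV i (- s ([a, b] ! 1) x + s ([a, b] ! 0) x))"
      by (simp add: central_extension_kernelD [OF ce] add.assoc [symmetric])
  qed
qed

text \<open>Passing from \<open>s c\<close> to \<open>s a\<close> directly or through
  \<open>s b\<close> gives the cocycle identity after cancelling \<open>s c x\<close>. Continuity of
  the cochain comes from \<open>central_extension_continuous_kernel\<close>.\<close>

lemma difference_cocycle:
  assumes ce: "central_extension i p" and oc: "open_cover X I U" and s: "local_lifts p X f I U s"
    and g: "difference_cochain i I U s g"
  shows "cech_cocycle X 1 I U g"
  unfolding One_nat_def cech_cocycle_1 cech_cochain_1
proof (intro conjI ballI oc)
  have i: "additive_hom i" "inj i" using ce by (auto simp: central_extension_def)
  have d: "s a x = s b x + i (g [a, b] x)" if "a \<in> I" "b \<in> I" "x \<in> U a" "x \<in> U b" for a b x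
    using g that unfolding difference_cochain_def by blast
  have sc: "continuous_map (subtopology X (U a)) euclidean (s a)" if "a \<in> I" for a
    using s that unfolding local_lifts_def by blast
  show "continuous_map (subtopology X (U a \<inter> U b)) euclidean (g [a, b])" if ab: "a \<in> I" "b \<in> I" for a b
  proof (rule central_extension_continuous_kernel [OF ce])
    show "continuous_map (subtopology X (U a \<inter> U b)) euclidean (\<lambda>x. - s b x + s a x)"
      by (intro continuous_map_group_intros continuous_map_subtopology_mono [OF sc [OF ab(1)]]
          continuous_map_subtopology_mono [OF sc [OF ab(2)]]) auto
    fix x assume "x \<in> topspace (subtopology X (U a \<inter> U b))"
    then have "x \<in> U a" "x \<in> U b" by auto
    from d [OF ab this] show "- s b x + s a x = i (g [a, b] x)"
      by (simp add: add.assoc [symmetric])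
  qed
  fix a b c x assume abc: "a \<in> I" "b \<in> I" "c \<in> I" and "x \<in> U a \<inter> U b \<inter> U c"
  then have x: "x \<in> U a" "x \<in> U b" "x \<in> U c" by auto
  have "s c x + i (g [a, c] x) = s c x + (i (g [b, c] x) + i (g [a, b] x))"
    using d [OF abc(1,3) x(1,3)] d [OF abc(1,2) x(1,2)] d [OF abc(2,3) x(2,3)]
    by (simp add: add.assoc)
  then have "i (g [a, c] x) = i (g [b, c] x + g [a, b] x)"
    by (simp add: additive_hom_simps [OF i(1)])
  then have "g [a, c] x = g [b, c] x + g [a, b] x" by (rule injD [OF i(2)])
  then show "g [b, c] x - g [a, c] x + g [a, b] x = 0" by simp
qed

lemma open_cover_inter_image:
  assumes "open_cover X I U" "open_cover X J V"
  obtains \<N> a b where "open_cover X \<N> id"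
    "\<And>N. N \<in> \<N> \<Longrightarrow> a N \<in> I \<and> N \<subseteq> U (a N) \<and> b N \<in> J \<and> N \<subseteq> V (b N)"
proof -
  obtain \<N> a b where N: "open_cover X \<N> id"
    and ab: "\<And>N. N \<in> \<N> \<Longrightarrow> a N \<in> U ` I \<and> N \<subseteq> a N \<and> b N \<in> V ` J \<and> N \<subseteq> b N"
    by (rule open_cover_common_refinement [OF open_cover_image [OF assms(1)] open_cover_image [OF assms(2)]])
      (rule that)
  show thesis
  proof (rule that [OF N])
    fix N assume "N \<in> \<N>"
    from ab [OF this] show "inv_into I U (a N) \<in> I \<and> N \<subseteq> U (inv_into I U (a N)) \<and>
        inv_into J V (b N) \<in> J \<and> N \<subseteq> V (inv_into J V (b N))"
      by (simp add: inv_into_into f_inv_into_f)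
  qed
qed

lemma cech_cohomologous_1I:
  assumes "open_cover X \<V> id"
    and "\<And>N. N \<in> \<V> \<Longrightarrow> r N \<in> I \<and> N \<subseteq> U (r N) \<and> s N \<in> J \<and> N \<subseteq> V (s N)"
    and "\<And>N. N \<in> \<V> \<Longrightarrow> continuous_map (subtopology X N) euclidean (k N)"
    and "\<And>M N x. M \<in> \<V> \<Longrightarrow> N \<in> \<V> \<Longrightarrow> x \<in> M \<Longrightarrow> x \<in> N \<Longrightarrow>
      g [r M, r N] x - h [s M, s N] x = k N x - k M x"
  shows "cech_cohomologous X 1 I U g J V h"
  unfolding cech_cohomologous_def
proof (intro exI conjI)
  show "open_cover X \<V> id" by fact
  show "\<forall>N\<in>\<V>. r N \<in> I \<and> N \<subseteq> U (r N) \<and> s N \<in> J \<and> N \<subseteq> V (s N)" using assms(2) by blast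
  show "if (1::nat) = 0 then (\<lambda>is. k (hd is)) = (\<lambda>_ _. 0) else cech_cochain X (1 - 1) \<V> id (\<lambda>is. k (hd is))"
    using assms(3) by (simp add: cech_cochain_0)
  show "\<forall>is. set is \<subseteq> \<V> \<and> length is = Suc 1 \<longrightarrow> (\<forall>x\<in>cover_inter id is.
      g (map r is) x - h (map s is) x = cech_coboundary (\<lambda>is. k (hd is)) is x)"
    unfolding One_nat_def numeral_2_eq_2 [symmetric] all_lists_length_2
    using assms(4) by (simp add: cech_coboundary_simps)
qed

lemma cech_cohomologous_1E:
  assumes "cech_cohomologous X 1 I U g J V h"
  obtains \<V> r s k where "open_cover X \<V> id"
    "\<And>N. N \<in> \<V> \<Longrightarrow> r N \<in> I \<and> N \<subseteq> U (r N) \<and> s N \<in> J \<and> N \<subseteq> V (s N)"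
    "\<And>N. N \<in> \<V> \<Longrightarrow> continuous_map (subtopology X N) euclidean (k N)"
    "\<And>M N x. M \<in> \<V> \<Longrightarrow> N \<in> \<V> \<Longrightarrow> x \<in> M \<Longrightarrow> x \<in> N \<Longrightarrow>
      g [r M, r N] x - h [s M, s N] x = k N x - k M x"
proof -
  have e: "Suc 1 = 2" "1 - 1 = (0::nat)" "(1::nat) \<noteq> 0" by simp_all
  obtain \<V> r s k where 1: "open_cover X \<V> id"
    "\<forall>N\<in>\<V>. r N \<in> I \<and> N \<subseteq> U (r N) \<and> s N \<in> J \<and> N \<subseteq> V (s N)"
    "cech_cochain X 0 \<V> id k"
    "\<forall>is. set is \<subseteq> \<V> \<and> length is = 2 \<longrightarrow> (\<forall>x\<in>cover_inter id is.
      g (map r is) x - h (map s is) x = cech_coboundary k is x)"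
    using assms unfolding cech_cohomologous_def
    by (simp only: e if_False) (elim exE conjE, rule that)
  show thesis
  proof (rule that [where k = "\<lambda>N. k [N]"])
    show "open_cover X \<V> id" by fact
    show "r N \<in> I \<and> N \<subseteq> U (r N) \<and> s N \<in> J \<and> N \<subseteq> V (s N)" if "N \<in> \<V>" for N
      using 1(2) that by blast
    show "continuous_map (subtopology X N) euclidean (k [N])" if "N \<in> \<V>" for N
      using 1(3) that unfolding cech_cochain_0 by simp
    show "g [r M, r N] x - h [s M, s N] x = k [N] x - k [M] x"
      if "M \<in> \<V>" "N \<in> \<V>" "x \<in> M" "x \<in> N" for M N x
      using 1(4) that unfolding all_lists_length_2 by (simp add: cech_coboundary_simps)
  qed
qed

lemma cech_cohomologous_2I:
  assumes "open_cover X \<V> id"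
    and "\<And>N. N \<in> \<V> \<Longrightarrow> r N \<in> I \<and> N \<subseteq> U (r N) \<and> s N \<in> J \<and> N \<subseteq> V (s N)"
    and "\<And>M N. M \<in> \<V> \<Longrightarrow> N \<in> \<V> \<Longrightarrow> continuous_map (subtopology X (M \<inter> N)) euclidean (k M N)"
    and "\<And>L M N x. L \<in> \<V> \<Longrightarrow> M \<in> \<V> \<Longrightarrow> N \<in> \<V> \<Longrightarrow> x \<in> L \<Longrightarrow> x \<in> M \<Longrightarrow> x \<in> N \<Longrightarrow>
      g [r L, r M, r N] x - h [s L, s M, s N] x = k M N x - k L N x + k L M x"
  shows "cech_cohomologous X 2 I U g J V h"
  unfolding cech_cohomologous_def
proof (intro exI conjI)
  let ?k = "\<lambda>is. k (is ! 0) (is ! 1)"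
  show "open_cover X \<V> id" by fact
  show "\<forall>N\<in>\<V>. r N \<in> I \<and> N \<subseteq> U (r N) \<and> s N \<in> J \<and> N \<subseteq> V (s N)" using assms(2) by blast
  have "cech_cochain X (Suc 0) \<V> id ?k"
    using assms(3) by (simp add: cech_cochain_1)
  then show "if (2::nat) = 0 then ?k = (\<lambda>_ _. 0) else cech_cochain X (2 - 1) \<V> id ?k"
    by simp
  have eq: "Suc 2 = 3" by simp
  show "\<forall>is. set is \<subseteq> \<V> \<and> length is = Suc 2 \<longrightarrow> (\<forall>x\<in>cover_inter id is.
      g (map r is) x - h (map s is) x = cech_coboundary ?k is x)"
    unfolding eq all_lists_length_3
    using assms(4) by (simp add: cech_coboundary_simps)
qed

lemma cech_cohomologous_2E:
  assumes "cech_cohomologous X 2 I U g J V h"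
  obtains \<V> r s k where "open_cover X \<V> id"
    "\<And>N. N \<in> \<V> \<Longrightarrow> r N \<in> I \<and> N \<subseteq> U (r N) \<and> s N \<in> J \<and> N \<subseteq> V (s N)"
    "\<And>M N. M \<in> \<V> \<Longrightarrow> N \<in> \<V> \<Longrightarrow> continuous_map (subtopology X (M \<inter> N)) euclidean (k M N)"
    "\<And>L M N x. L \<in> \<V> \<Longrightarrow> M \<in> \<V> \<Longrightarrow> N \<in> \<V> \<Longrightarrow> x \<in> L \<Longrightarrow> x \<in> M \<Longrightarrow> x \<in> N \<Longrightarrow>
      g [r L, r M, r N] x - h [s L, s M, s N] x = k M N x - k L N x + k L M x"
proof -
  have e: "Suc 2 = 3" "2 - 1 = Suc 0" "(2::nat) \<noteq> 0" by simp_all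
  obtain \<V> r s k where 1: "open_cover X \<V> id"
    "\<forall>N\<in>\<V>. r N \<in> I \<and> N \<subseteq> U (r N) \<and> s N \<in> J \<and> N \<subseteq> V (s N)"
    "cech_cochain X (Suc 0) \<V> id k"
    "\<forall>is. set is \<subseteq> \<V> \<and> length is = 3 \<longrightarrow> (\<forall>x\<in>cover_inter id is.
      g (map r is) x - h (map s is) x = cech_coboundary k is x)"
    using assms unfolding cech_cohomologous_def
    by (simp only: e if_False) (elim exE conjE, rule that)
  show thesis
  proof (rule that [where k = "\<lambda>M N. k [M, N]"])
    show "open_cover X \<V> id" by fact
    show "r N \<in> I \<and> N \<subseteq> U (r N) \<and> s N \<in> J \<and> N \<subseteq> V (s N)" if "N \<in> \<V>" for N
      using 1(2) that by blast
    show "continuous_map (subtopology X (M \<inter> N)) euclidean (k [M, N])" if "M \<in> \<V>" "N \<in> \<V>" for M N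
      using 1(3) that unfolding cech_cochain_1 by simp
    show "g [r L, r M, r N] x - h [s L, s M, s N] x = k [M, N] x - k [L, N] x + k [L, M] x"
      if "L \<in> \<V>" "M \<in> \<V>" "N \<in> \<V>" "x \<in> L" "x \<in> M" "x \<in> N" for L M N x
      using 1(4) that unfolding all_lists_length_3 by (simp add: cech_coboundary_simps)
  qed
qed

text \<open>Two lifts of the same \<open>f\<close> differ on a common refinement by
  \<open>i \<circ> k\<close> with \<open>k\<close> continuous, and a change of lifts alters the
  difference cochain by a coboundary. This makes \<open>delta0\<close> well defined and also permits
  comparing cochains on unrelated covers.\<close>

lemma difference_cochains_cohomologous:
  assumes ce: "central_extension i p"
    and U: "open_cover X I U" "local_lifts p X f I U s" "difference_cochain i I U s g"
    and V: "open_cover X J V" "local_lifts p X f J V t" "difference_cochain i J V t h"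
  shows "cech_cohomologous X 1 I U g J V h"
proof -
  have i: "additive_hom i" "inj i" and p: "additive_hom p"
    using ce by (auto simp: central_extension_def)
  obtain \<N> a b where N: "open_cover X \<N> id"
    and ab: "\<And>N. N \<in> \<N> \<Longrightarrow> a N \<in> I \<and> N \<subseteq> U (a N) \<and> b N \<in> J \<and> N \<subseteq> V (b N)"
    by (rule open_cover_inter_image [OF U(1) V(1)]) (rule that)
  define k where "k N x = inv_into UNIV i (- t (b N) x + s (a N) x)" for N x
  have k: "s (a N) x = t (b N) x + i (k N x)" if "N \<in> \<N>" "x \<in> N" for N x
  proof -
    have "p (- t (b N) x + s (a N) x) = 0"
      using U(2) V(2) ab [OF that(1)] that(2) unfolding local_lifts_def
      by (simp add: additive_hom_simps [OF p] subset_eq)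
    then show ?thesis
      unfolding k_def by (simp add: central_extension_kernelD [OF ce] add.assoc [symmetric])
  qed
  show ?thesis
  \<comment> \<open>The sign: \<open>g - h\<close> comes out as \<open>k M - k N\<close>, whereas
    the coboundary of \<open>k\<close> is \<open>k N - k M\<close>.\<close>
  proof (rule cech_cohomologous_1I [OF N ab, where k = "\<lambda>N x. - k N x"])
    show "continuous_map (subtopology X N) euclidean (\<lambda>x. - k N x)" if N: "N \<in> \<N>" for N
    proof (rule continuous_map_group_uminus, rule central_extension_continuous_kernel [OF ce])
      have "continuous_map (subtopology X (U (a N))) euclidean (s (a N))"
        "continuous_map (subtopology X (V (b N))) euclidean (t (b N))"
        using U(2) V(2) ab [OF N] unfolding local_lifts_def by blast+
      then have "continuous_map (subtopology X N) euclidean (s (a N))"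
        "continuous_map (subtopology X N) euclidean (t (b N))"
        using ab [OF N] continuous_map_subtopology_mono by metis+
      then show "continuous_map (subtopology X N) euclidean (\<lambda>x. - t (b N) x + s (a N) x)"
        by (intro continuous_map_group_intros)
      fix x assume "x \<in> topspace (subtopology X N)"
      then show "- t (b N) x + s (a N) x = i (k N x)"
        using k [OF N] by (simp add: add.assoc [symmetric])
    qed
    fix M N x assume MN: "M \<in> \<N>" "N \<in> \<N>" and x: "x \<in> M" "x \<in> N"
    have xs: "x \<in> U (a M) \<inter> U (a N)" "x \<in> V (b M) \<inter> V (b N)" using ab MN x by blast+
    have "s (a M) x = s (a N) x + i (g [a M, a N] x)" "t (b M) x = t (b N) x + i (h [b M, b N] x)"
      using U(3) V(3) ab MN xs unfolding difference_cochain_def by blast+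
    then have "t (b N) x + (i (h [b M, b N] x) + i (k M x)) = t (b N) x + (i (k N x) + i (g [a M, a N] x))"
      using k [OF MN(1) x(1)] k [OF MN(2) x(2)] by (simp add: add.assoc)
    then have "i (h [b M, b N] x + k M x) = i (k N x + g [a M, a N] x)"
      by (simp add: additive_hom_simps [OF i(1)])
    then have "h [b M, b N] x + k M x = k N x + g [a M, a N] x" by (rule injD [OF i(2)])
    then show "g [a M, a N] x - h [b M, b N] x = - k N x - - k M x"
      by (simp add: algebra_simps)
  qed
qed

section \<open>The connecting map\<close>

lemma connecting_dataD:
  assumes "connecting_data j q X I U g gt a"
  shows "\<And>b c. b \<in> I \<Longrightarrow> c \<in> I \<Longrightarrow> continuous_map (subtopology X (U b \<inter> U c)) euclidean (gt [b, c])"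
    and "\<And>b c x. b \<in> I \<Longrightarrow> c \<in> I \<Longrightarrow> x \<in> U b \<Longrightarrow> x \<in> U c \<Longrightarrow> q (gt [b, c] x) = g [b, c] x"
    and "\<And>b c d x. b \<in> I \<Longrightarrow> c \<in> I \<Longrightarrow> d \<in> I \<Longrightarrow> x \<in> U b \<Longrightarrow> x \<in> U c \<Longrightarrow> x \<in> U d \<Longrightarrow>
      j (a [b, c, d] x) = gt [c, d] x - gt [b, d] x + gt [b, c] x"
  using assms unfolding connecting_data_def One_nat_def cech_cochain_1 by simp_all

text \<open>\<open>j\<close> is additive and injective, so the identity may be checked after
  applying \<open>j\<close>, where it says that the coboundary of a coboundary vanishes.\<close>

lemma connecting_cocycle:
  assumes KG: "K_Gamma_1_group j q" and oc: "open_cover X I U"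
    and d: "connecting_data j q X I U g gt a"
  shows "cech_cocycle X 2 I U a"
  unfolding cech_cocycle_2 cech_cochain_2
proof (intro conjI ballI oc)
  have j: "additive_hom j" "inj j" using KG by (auto simp: K_Gamma_1_group_def)
  note d1 = connecting_dataD(1) [OF d] and d3 = connecting_dataD(3) [OF d]
  show "continuous_map (subtopology X (U b \<inter> U c \<inter> U e)) euclidean (a [b, c, e])"
    if I: "b \<in> I" "c \<in> I" "e \<in> I" for b c e
  proof (rule K_Gamma_1_continuous_kernel [OF KG])
    have "continuous_map (subtopology X (U b \<inter> U c \<inter> U e)) euclidean (gt [c, e])"
      "continuous_map (subtopology X (U b \<inter> U c \<inter> U e)) euclidean (gt [b, e])"
      "continuous_map (subtopology X (U b \<inter> U c \<inter> U e)) euclidean (gt [b, c])"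
      by (rule continuous_map_subtopology_mono [OF d1 [OF I(2,3)]], blast,
          rule continuous_map_subtopology_mono [OF d1 [OF I(1,3)]], blast,
          rule continuous_map_subtopology_mono [OF d1 [OF I(1,2)]], blast)
    then show "continuous_map (subtopology X (U b \<inter> U c \<inter> U e)) euclidean
        (\<lambda>x. gt [c, e] x - gt [b, e] x + gt [b, c] x)"
      by (intro continuous_map_group_intros)
    show "gt [c, e] x - gt [b, e] x + gt [b, c] x = j (a [b, c, e] x)"
      if "x \<in> topspace (subtopology X (U b \<inter> U c \<inter> U e))" for x
      using d3 [OF I, of x] that by simp
  qed
  fix b c e h x assume I: "b \<in> I" "c \<in> I" "e \<in> I" "h \<in> I" and "x \<in> U b \<inter> U c \<inter> U e \<inter> U h"
  then have x: "x \<in> U b" "x \<in> U c" "x \<in> U e" "x \<in> U h" by auto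
  have "j (a [c, e, h] x - a [b, e, h] x + a [b, c, h] x - a [b, c, e] x) = j 0"
    unfolding additive_hom_simps [OF j(1)] d3 [OF I(2,3,4) x(2,3,4)] d3 [OF I(1,3,4) x(1,3,4)]
      d3 [OF I(1,2,4) x(1,2,4)] d3 [OF I(1,2,3) x(1,2,3)] by simp
  then show "a [c, e, h] x - a [b, e, h] x + a [b, c, h] x - a [b, c, e] x = 0"
    by (rule injD [OF j(2)])
qed

lemma connecting_data_exists:
  assumes KG: "K_Gamma_1_group j q" and g: "cech_cocycle X 1 I U g" and gt: "cech_cochain X 1 I U gt"
    and lift: "\<And>b c x. b \<in> I \<Longrightarrow> c \<in> I \<Longrightarrow> x \<in> U b \<Longrightarrow> x \<in> U c \<Longrightarrow> q (gt [b, c] x) = g [b, c] x"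
  obtains a where "connecting_data j q X I U g gt a"
proof
  let ?d = "\<lambda>b c d x. gt [c, d] x - gt [b, d] x + gt [b, c] x"
  show "connecting_data j q X I U g gt (\<lambda>is x. inv_into UNIV j (?d (is ! 0) (is ! 1) (is ! 2) x))"
    unfolding connecting_data_def
  proof (intro conjI ballI gt)
    fix b c x assume "b \<in> I" "c \<in> I" "x \<in> U b \<inter> U c"
    then show "q (gt [b, c] x) = g [b, c] x" by (intro lift) auto
  next
    fix b c d x assume I: "b \<in> I" "c \<in> I" "d \<in> I" and "x \<in> U b \<inter> U c \<inter> U d"
    then have x: "x \<in> U b" "x \<in> U c" "x \<in> U d" by auto
    have q: "additive_hom q" using KG by (simp add: K_Gamma_1_group_def)
    have "g [c, d] x - g [b, d] x + g [b, c] x = 0"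
      using g I x unfolding One_nat_def cech_cocycle_1 by blast
    then have "q (?d b c d x) = 0"
      by (simp add: additive_hom_simps [OF q] lift I x)
    then show "j (inv_into UNIV j (?d ([b, c, d] ! 0) ([b, c, d] ! 1) ([b, c, d] ! 2) x)) = ?d b c d x"
      using K_Gamma_1_kernelD [OF KG] by simp
  qed
qed

text \<open>The 0-cochain \<open>k\<close> joining \<open>g\<close> to \<open>h\<close> lifts
  through \<open>q\<close> only locally, whence the second refinement \<open>\<N>\<close> with lifts
  \<open>F\<close>. The defect \<open>D\<close> of \<open>gt - ht\<close> against the coboundary of
  \<open>F\<close> is killed by \<open>q\<close>, so it comes from a 1-cochain
  \<open>\<beta>\<close> with values in \<open>\<Gamma>\<close>; applying the coboundary once more
  removes \<open>F\<close>. With \<open>h = g\<close> this also contains the independence of the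
  chosen lift.\<close>

lemma connecting_cohomologous:
  assumes KG: "K_Gamma_1_group j q"
    and d: "connecting_data j q X I U g gt a" and e: "connecting_data j q X J V h ht b"
    and gh: "cech_cohomologous X 1 I U g J V h"
  shows "cech_cohomologous X 2 I U a J V b"
proof -
  have j: "additive_hom j" "inj j" and q: "additive_hom q" using KG by (auto simp: K_Gamma_1_group_def)
  obtain \<V> r s k where \<V>: "open_cover X \<V> id"
    and rs: "\<And>N. N \<in> \<V> \<Longrightarrow> r N \<in> I \<and> N \<subseteq> U (r N) \<and> s N \<in> J \<and> N \<subseteq> V (s N)"
    and k: "\<And>N. N \<in> \<V> \<Longrightarrow> continuous_map (subtopology X N) euclidean (k N)"
    and ghk: "\<And>M N x. M \<in> \<V> \<Longrightarrow> N \<in> \<V> \<Longrightarrow> x \<in> M \<Longrightarrow> x \<in> N \<Longrightarrow>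
      g [r M, r N] x - h [s M, s N] x = k N x - k M x"
    by (rule cech_cohomologous_1E [OF gh]) (rule that)
  define L where "L M N F \<longleftrightarrow> N \<in> \<V> \<and> M \<subseteq> N \<and> continuous_map (subtopology X M) euclidean F \<and>
    (\<forall>x\<in>M. q (F x) = k N x)" for M N F
  define \<N> where "\<N> = {M. openin X M \<and> (\<exists>N F. L M N F)}"
  have "\<exists>M\<in>\<N>. x \<in> M" if x: "x \<in> topspace X" for x
  proof -
    obtain N where N: "N \<in> \<V>" "x \<in> N" "openin X N"
      using \<V> x unfolding open_cover_def by auto
    have "x \<in> topspace (subtopology X N)" using x N by simp
    then obtain M F where M: "openin (subtopology X N) M" "x \<in> M"
      "continuous_map (subtopology (subtopology X N) M) euclidean F" "\<And>y. y \<in> M \<Longrightarrow> q (F y) = k N y"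
      by (rule local_sections_lift [OF K_Gamma_1_local_sections [OF KG] k [OF N(1)]]) (rule that)
    have MN: "M \<subseteq> N" using openin_subset [OF M(1)] by simp
    have "subtopology (subtopology X N) M = subtopology X M"
      using MN by (simp add: subtopology_subtopology inf.absorb2)
    then have "L M N F" using N M MN by (simp add: L_def)
    moreover have "openin X M" using M(1) N(3) openin_trans_full by blast
    ultimately show ?thesis using M(2) by (auto simp: \<N>_def)
  qed
  then have "\<Union>\<N> = topspace X" by (auto simp: \<N>_def dest: openin_subset)
  then have \<N>: "open_cover X \<N> id" by (simp add: open_cover_def \<N>_def)
  have "\<forall>M\<in>\<N>. \<exists>N F. L M N F" by (simp add: \<N>_def)
  then obtain v F where vF: "\<And>M. M \<in> \<N> \<Longrightarrow> L M (v M) (F M)" by metis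
  have v: "v M \<in> \<V>" "M \<subseteq> v M" and Fc: "continuous_map (subtopology X M) euclidean (F M)"
    and qF: "\<And>x. x \<in> M \<Longrightarrow> q (F M x) = k (v M) x" if "M \<in> \<N>" for M
    using vF [OF that] by (simp_all add: L_def)
  define R where "R = r \<circ> v"
  define S where "S = s \<circ> v"
  have RS: "R M \<in> I \<and> M \<subseteq> U (R M) \<and> S M \<in> J \<and> M \<subseteq> V (S M)" if "M \<in> \<N>" for M
    using rs [OF v(1) [OF that]] v(2) [OF that] by (auto simp: R_def S_def)
  define D where "D M N x = gt [R M, R N] x - ht [S M, S N] x - (F N x - F M x)" for M N x
  define \<beta> where "\<beta> M N x = inv_into UNIV j (D M N x)" for M N x
  have x_in: "x \<in> U (R M)" "x \<in> V (S M)" "R M \<in> I" "S M \<in> J" if "M \<in> \<N>" "x \<in> M" for M x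
    using RS [OF that(1)] that(2) by auto
  have j\<beta>: "j (\<beta> M N x) = D M N x" if MN: "M \<in> \<N>" "N \<in> \<N>" and x: "x \<in> M" "x \<in> N" for M N x
    unfolding \<beta>_def
  proof (rule K_Gamma_1_kernelD [OF KG])
    note xM = x_in [OF MN(1) x(1)] and xN = x_in [OF MN(2) x(2)]
    have "g [R M, R N] x - h [S M, S N] x = k (v N) x - k (v M) x"
      unfolding R_def S_def comp_def
      by (rule ghk) (use v [OF MN(1)] v [OF MN(2)] x in auto)
    then show "q (D M N x) = 0"
      unfolding D_def additive_hom_simps [OF q] connecting_dataD(2) [OF d xM(3) xN(3) xM(1) xN(1)]
        connecting_dataD(2) [OF e xM(4) xN(4) xM(2) xN(2)] qF [OF MN(1) x(1)] qF [OF MN(2) x(2)]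
      by simp
  qed
  show ?thesis
  proof (rule cech_cohomologous_2I [OF \<N> RS, where k = \<beta>])
    fix M N assume MN: "M \<in> \<N>" "N \<in> \<N>"
    note RM = RS [OF MN(1)] and RN = RS [OF MN(2)]
    show "continuous_map (subtopology X (M \<inter> N)) euclidean (\<beta> M N)"
    proof (rule K_Gamma_1_continuous_kernel [OF KG])
      have "continuous_map (subtopology X (M \<inter> N)) euclidean (gt [R M, R N])"
        by (rule continuous_map_subtopology_mono [OF connecting_dataD(1) [OF d]]) (use RM RN in auto)
      moreover have "continuous_map (subtopology X (M \<inter> N)) euclidean (ht [S M, S N])"
        by (rule continuous_map_subtopology_mono [OF connecting_dataD(1) [OF e]]) (use RM RN in auto)
      moreover have "continuous_map (subtopology X (M \<inter> N)) euclidean (F M)"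
        "continuous_map (subtopology X (M \<inter> N)) euclidean (F N)"
        by (rule continuous_map_subtopology_mono [OF Fc [OF MN(1)]], blast,
            rule continuous_map_subtopology_mono [OF Fc [OF MN(2)]], blast)
      ultimately show "continuous_map (subtopology X (M \<inter> N)) euclidean (D M N)"
        unfolding D_def [abs_def] by (intro continuous_map_group_intros)
      show "D M N x = j (\<beta> M N x)" if "x \<in> topspace (subtopology X (M \<inter> N))" for x
        using j\<beta> [OF MN, of x] that by simp
    qed
  next
    fix L M N x assume LMN: "L \<in> \<N>" "M \<in> \<N>" "N \<in> \<N>" and x: "x \<in> L" "x \<in> M" "x \<in> N"
    note xL = x_in [OF LMN(1) x(1)] and xM = x_in [OF LMN(2) x(2)] and xN = x_in [OF LMN(3) x(3)]
    have "j (a [R L, R M, R N] x - b [S L, S M, S N] x) = j (\<beta> M N x - \<beta> L N x + \<beta> L M x)"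
      unfolding additive_hom_simps [OF j(1)] j\<beta> [OF LMN(2,3) x(2,3)] j\<beta> [OF LMN(1,3) x(1,3)]
        j\<beta> [OF LMN(1,2) x(1,2)] connecting_dataD(3) [OF d xL(3) xM(3) xN(3) xL(1) xM(1) xN(1)]
        connecting_dataD(3) [OF e xL(4) xM(4) xN(4) xL(2) xM(2) xN(2)] D_def
      by (simp add: algebra_simps)
    then show "a [R L, R M, R N] x - b [S L, S M, S N] x = \<beta> M N x - \<beta> L N x + \<beta> L M x"
      by (rule injD [OF j(2)])
  qed
qed

lemma open_cover_of_local_property:
  assumes "\<And>x. x \<in> topspace X \<Longrightarrow> \<exists>N. openin X N \<and> x \<in> N \<and> P N"
  shows "open_cover X {N. openin X N \<and> P N} id"
  unfolding open_cover_def
proof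
  show "(\<Union>N\<in>{N. openin X N \<and> P N}. id N) = topspace X"
    using assms by (auto dest: openin_subset)
qed simp

text \<open>\<open>f\<close> lifts through \<open>p\<close> on the sets of some cover, but the
  resulting cocycle lifts through \<open>q\<close> only locally inside the double intersections.
  Paracompactness gives a single refinement all of whose double intersections carry lifts, as the
  definition of the connecting map demands.\<close>

lemma liftable_cover_exists:
  fixes i :: "'z::topological_ab_group_add \<Rightarrow> 'e::topological_group_add"
    and p :: "'e \<Rightarrow> 'k::topological_group_add"
    and q :: "'w::topological_ab_group_add \<Rightarrow> 'z"
    and j :: "'g::{topological_ab_group_add,discrete_topology} \<Rightarrow> 'w"
  assumes X: "paracompact_space X" "Hausdorff_space X"
    and ce: "central_extension i p" and KG: "K_Gamma_1_group j q"
    and f: "continuous_map X euclidean f"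
  obtains \<N> s g gt a where "open_cover X \<N> id" "local_lifts p X f \<N> id s"
    "difference_cochain i \<N> id s g" "connecting_data j q X \<N> id g gt a"
proof -
  define P where "P U F \<longleftrightarrow> continuous_map (subtopology X U) euclidean F \<and> (\<forall>x\<in>U. p (F x) = f x)" for U F
  define \<U> where "\<U> = {U. openin X U \<and> (\<exists>F. P U F)}"
  have \<U>: "open_cover X \<U> id"
    unfolding \<U>_def
  proof (rule open_cover_of_local_property)
    fix x assume "x \<in> topspace X"
    then obtain N F where "openin X N" "x \<in> N" "continuous_map (subtopology X N) euclidean F"
      "\<And>y. y \<in> N \<Longrightarrow> p (F y) = f y"
      by (rule local_sections_lift [OF central_extension_local_sections [OF ce] f]) (rule that)
    then show "\<exists>N. openin X N \<and> x \<in> N \<and> (\<exists>F. P N F)"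
      unfolding P_def by blast
  qed
  have "\<forall>U\<in>\<U>. \<exists>F. P U F" by (simp add: \<U>_def)
  then obtain s0 where s0: "\<And>U. U \<in> \<U> \<Longrightarrow> P U (s0 U)" by metis
  have l0: "local_lifts p X f \<U> id s0"
    using s0 by (simp add: local_lifts_def P_def)
  obtain g0 where g0: "difference_cochain i \<U> id s0 g0"
    by (rule difference_cochain_exists [OF ce l0]) (rule that)
  have c0: "cech_cocycle X 1 \<U> id g0" by (rule difference_cocycle [OF ce \<U> l0 g0])
  define Q where "Q U V N \<longleftrightarrow> (\<exists>F. continuous_map (subtopology X N) euclidean F \<and> (\<forall>x\<in>N. q (F x) = g0 [U, V] x))" for U V N
  obtain \<N> r where \<N>: "open_cover X \<N> id" and r: "\<And>N. N \<in> \<N> \<Longrightarrow> r N \<in> \<U> \<and> N \<subseteq> r N"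
    and Q: "\<And>M N. M \<in> \<N> \<Longrightarrow> N \<in> \<N> \<Longrightarrow> M \<inter> N \<noteq> {} \<Longrightarrow> Q (r M) (r N) (M \<inter> N)"
  proof (rule paracompact_pair_refinement [OF X \<U>, where Q = Q])
    fix U V x assume UV: "U \<in> \<U>" "V \<in> \<U>" and x: "x \<in> U" "x \<in> V"
    have "continuous_map (subtopology X (U \<inter> V)) euclidean (g0 [U, V])"
      using c0 UV unfolding One_nat_def cech_cocycle_1 cech_cochain_1 by simp
    moreover have oUV: "openin X (U \<inter> V)" using UV by (simp add: \<U>_def openin_Int)
    moreover have "x \<in> topspace (subtopology X (U \<inter> V))"
      using x openin_subset [OF oUV] by auto
    ultimately obtain M F where M: "openin (subtopology X (U \<inter> V)) M" "x \<in> M"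
      "continuous_map (subtopology (subtopology X (U \<inter> V)) M) euclidean F" "\<And>y. y \<in> M \<Longrightarrow> q (F y) = g0 [U, V] y"
      using local_sections_lift [OF K_Gamma_1_local_sections [OF KG]] by metis
    have "M \<subseteq> U \<inter> V" using openin_subset [OF M(1)] by simp
    then have "subtopology (subtopology X (U \<inter> V)) M = subtopology X M"
      by (simp add: subtopology_subtopology inf.absorb2)
    then have "Q U V M" using M unfolding Q_def by metis
    moreover have "openin X M" using M(1) oUV openin_trans_full by blast
    ultimately show "\<exists>N. openin X N \<and> x \<in> N \<and> Q U V N" using M(2) by blast
  next
    fix U V N N' assume "Q U V N" "N' \<subseteq> N"
    then show "Q U V N'"
      unfolding Q_def using continuous_map_subtopology_mono by (metis subset_iff)
  qed (rule that)
  define g where "g is = g0 (map r is)" for "is"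
  have g: "cech_cocycle X 1 \<N> id g"
    unfolding g_def using r by (intro cech_cocycle_refine [OF c0 \<N>]) simp
  have "\<exists>F. continuous_map (subtopology X (M \<inter> N)) euclidean F \<and> (\<forall>x\<in>M \<inter> N. q (F x) = g [M, N] x)"
    if "M \<in> \<N>" "N \<in> \<N>" for M N
  \<comment> \<open>\<open>paracompact_pair_refinement\<close> speaks of nonempty intersections
    only; over an empty one any function is a lift.\<close>
  proof (cases "M \<inter> N = {}")
    case True
    then show ?thesis by (simp add: continuous_map_on_empty)
  next
    case False
    then show ?thesis using Q [OF that] by (simp add: Q_def g_def)
  qed
  then obtain G where G: "\<And>M N. M \<in> \<N> \<Longrightarrow> N \<in> \<N> \<Longrightarrow>
      continuous_map (subtopology X (M \<inter> N)) euclidean (G M N) \<and> (\<forall>x\<in>M \<inter> N. q (G M N x) = g [M, N] x)"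
    by metis
  have gt: "cech_cochain X 1 \<N> id (\<lambda>is. G (is ! 0) (is ! 1))"
    unfolding One_nat_def cech_cochain_1 using G by simp
  obtain a where a: "connecting_data j q X \<N> id g (\<lambda>is. G (is ! 0) (is ! 1)) a"
  proof (rule connecting_data_exists [OF KG g gt])
    show "q (G ([b, c] ! 0) ([b, c] ! 1) x) = g [b, c] x"
      if "b \<in> \<N>" "c \<in> \<N>" "x \<in> id b" "x \<in> id c" for b c x
      using G [OF that(1,2)] that(3,4) by simp
  qed (rule that)
  have "local_lifts p X f \<N> id (s0 \<circ> r)"
    unfolding local_lifts_def
  proof (intro ballI conjI)
    fix N assume N: "N \<in> \<N>"
    note rN = r [OF N]
    have "continuous_map (subtopology X (r N)) euclidean (s0 (r N))"
      using s0 rN by (simp add: P_def)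
    then show "continuous_map (subtopology X (id N)) euclidean ((s0 \<circ> r) N)"
      using rN by (simp add: continuous_map_subtopology_mono)
    show "p ((s0 \<circ> r) N x) = f x" if "x \<in> id N" for x
      using s0 rN that by (auto simp: P_def)
  qed
  moreover have "difference_cochain i \<N> id (s0 \<circ> r) g"
    unfolding difference_cochain_def
  proof (intro ballI)
    fix M N x assume MN: "M \<in> \<N>" "N \<in> \<N>" "x \<in> id M \<inter> id N"
    then have "x \<in> id (r M) \<inter> id (r N)" using r by auto
    then have "s0 (r M) x = s0 (r N) x + i (g0 [r M, r N] x)"
      using g0 r MN(1,2) unfolding difference_cochain_def by blast
    then show "(s0 \<circ> r) M x = (s0 \<circ> r) N x + i (g [M, N] x)" by (simp add: g_def)
  qed
  ultimately show thesis using \<N> a by (intro that)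
qed

text \<open>Sections of the pulled-back bundle are the maps \<open>x \<mapsto> (x, s x)\<close> with
  \<open>s\<close> a local lift of \<open>f\<close>, so a bundle cocycle is the same thing as a
  difference cochain. Uniqueness of the description is then
  \<open>difference_cochains_cohomologous\<close>.\<close>

lemma delta0_eq:
  assumes ce: "central_extension i p" and oc: "open_cover X \<U> id"
    and s: "local_lifts p X f \<U> id s" and g: "difference_cochain i \<U> id s g"
  shows "delta0 X i p f = cech_class X 1 \<U> id g"
  unfolding delta0_def bundle_class_def
proof (rule the_equality)
  let ?P = "subtopology (prod_topology X euclidean) {(x, y). f x = p y}"
  have c: "cech_cocycle X 1 \<U> id g" by (rule difference_cocycle [OF ce oc s g])
  have s': "continuous_map (subtopology X U) ?P (\<lambda>x. (x, s U x))" if "U \<in> \<U>" for U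
    using s that unfolding continuous_map_in_subtopology local_lifts_def
    by (auto simp: continuous_map_paired continuous_map_from_subtopology)
  show "\<exists>\<V> t h. open_cover X \<V> id \<and>
        (\<forall>U\<in>\<V>. continuous_map (subtopology X U) ?P (t U) \<and> (\<forall>x\<in>U. fst (t U x) = x)) \<and>
        cech_cochain X 1 \<V> id h \<and>
        (\<forall>U\<in>\<V>. \<forall>V\<in>\<V>. \<forall>x\<in>U \<inter> V. t U x = (case t V x of (x, y) \<Rightarrow> \<lambda>z. (x, y + i z)) (h [U, V] x)) \<and>
        cech_class X 1 \<U> id g = cech_class X 1 \<V> id h"
  proof (intro exI [of _ \<U>] exI [of _ "\<lambda>U x. (x, s U x)"] exI [of _ g] conjI)
    show "\<forall>U\<in>\<U>. continuous_map (subtopology X U) ?P (\<lambda>x. (x, s U x)) \<and> (\<forall>x\<in>U. fst (x, s U x) = x)"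
      using s' by simp
    show "cech_cochain X 1 \<U> id g" using c unfolding cech_cocycle_def by blast
    show "\<forall>U\<in>\<U>. \<forall>V\<in>\<U>. \<forall>x\<in>U \<inter> V. (x, s U x) = (case (x, s V x) of (x, y) \<Rightarrow> \<lambda>z. (x, y + i z)) (g [U, V] x)"
      using g unfolding difference_cochain_def id_apply prod.case prod.inject by blast
    show "open_cover X \<U> id" by fact
  qed simp
  fix d
  assume "\<exists>\<U> s g. open_cover X \<U> id \<and>
        (\<forall>U\<in>\<U>. continuous_map (subtopology X U) ?P (s U) \<and> (\<forall>x\<in>U. fst (s U x) = x)) \<and>
        cech_cochain X 1 \<U> id g \<and>
        (\<forall>U\<in>\<U>. \<forall>V\<in>\<U>. \<forall>x\<in>U \<inter> V. s U x = (case s V x of (x, y) \<Rightarrow> \<lambda>z. (x, y + i z)) (g [U, V] x)) \<and>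
        d = cech_class X 1 \<U> id g"
  then obtain \<V> t h where R: "open_cover X \<V> id \<and>
        (\<forall>U\<in>\<V>. continuous_map (subtopology X U) ?P (t U) \<and> (\<forall>x\<in>U. fst (t U x) = x)) \<and>
        cech_cochain X 1 \<V> id h \<and>
        (\<forall>U\<in>\<V>. \<forall>V\<in>\<V>. \<forall>x\<in>U \<inter> V. t U x = (case t V x of (x, y) \<Rightarrow> \<lambda>z. (x, y + i z)) (h [U, V] x)) \<and>
        d = cech_class X 1 \<V> id h"
    by (elim exE)
  then have V: "open_cover X \<V> id" and d: "d = cech_class X 1 \<V> id h" by blast+
  have t: "continuous_map (subtopology X U) ?P (t U)" "x \<in> U \<Longrightarrow> fst (t U x) = x" if "U \<in> \<V>" for U x
    using R that by blast+
  have h: "t U x = (case t V x of (x, y) \<Rightarrow> \<lambda>z. (x, y + i z)) (h [U, V] x)"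
    if "U \<in> \<V>" "V \<in> \<V>" "x \<in> U \<inter> V" for U V x
    using R that by blast
  have lt: "local_lifts p X f \<V> id (\<lambda>U x. snd (t U x))"
    unfolding local_lifts_def
  proof (intro ballI conjI)
    fix U assume U: "U \<in> \<V>"
    note tU = t(1) [OF U, unfolded continuous_map_in_subtopology]
    show "continuous_map (subtopology X (id U)) euclidean (\<lambda>x. snd (t U x))"
      using continuous_map_compose [OF conjunct1 [OF tU] continuous_map_snd] by (simp add: comp_def)
    fix x assume x: "x \<in> id U"
    have "U \<subseteq> topspace X" using V U unfolding open_cover_def by auto
    then have "x \<in> topspace (subtopology X U)" using x by auto
    then have "t U x \<in> {(x, y). f x = p y}" by (rule funcset_mem [OF conjunct2 [OF tU]])
    then show "p (snd (t U x)) = f x" using t(2) [OF U, of x] x by (cases "t U x") simp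
  qed
  have dt: "difference_cochain i \<V> id (\<lambda>U x. snd (t U x)) h"
    unfolding difference_cochain_def
  proof (intro ballI)
    fix U V x assume UV: "U \<in> \<V>" "V \<in> \<V>" and x: "x \<in> id U \<inter> id V"
    show "snd (t U x) = snd (t V x) + i (h [U, V] x)"
      by (subst h [OF UV x [unfolded id_apply]]) (simp add: case_prod_beta)
  qed
  show "d = cech_class X 1 \<U> id g"
    unfolding d
    by (rule cech_class_eq [OF difference_cochains_cohomologous [OF ce V lt dt oc s g]
          difference_cocycle [OF ce V lt dt] c]) simp
qed

text \<open>Independence of the representative, of its cover and of its lift is a single application
  of \<open>connecting_cohomologous\<close>.\<close>

lemma iota1_eq:
  assumes KG: "K_Gamma_1_group j q" and g: "cech_cocycle X 1 \<U> id g"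
    and d: "connecting_data j q X \<U> id g gt a"
  shows "iota1 X j q (cech_class X 1 \<U> id g) = cech_class X 2 \<U> id a"
  unfolding iota1_def cech_connecting_def
proof (rule the_equality)
  have e: "Suc 1 = 2" "1 + 2 = (3::nat)" by simp_all
  have iff: "(cech_cochain X 1 \<U> id gt \<and>
        (\<forall>is. set is \<subseteq> \<U> \<and> length is = Suc 1 \<longrightarrow> (\<forall>x\<in>cover_inter id is. q (gt is x) = g is x)) \<and>
        cech_cochain X (Suc 1) \<U> id a \<and>
        (\<forall>is. set is \<subseteq> \<U> \<and> length is = 1 + 2 \<longrightarrow>
           (\<forall>x\<in>cover_inter id is. j (a is x) = cech_coboundary gt is x))) \<longleftrightarrow>
     connecting_data j q X \<U> id g gt a \<and> cech_cochain X 2 \<U> id a" for \<U> g gt a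
    unfolding e all_lists_length_2 all_lists_length_3 connecting_data_def
    by (simp add: cech_coboundary_simps Int_assoc) blast
  have oc: "open_cover X \<U> id" using g by (simp add: cech_cocycle_def)
  have a: "cech_cocycle X 2 \<U> id a" by (rule connecting_cocycle [OF KG oc d])
  let ?R = "\<lambda>d \<V> h ht b. (\<V>, h) \<in> cech_class X 1 \<U> id g \<and> cech_cochain X 1 \<V> id ht \<and>
        (\<forall>is. set is \<subseteq> \<V> \<and> length is = Suc 1 \<longrightarrow> (\<forall>x\<in>cover_inter id is. q (ht is x) = h is x)) \<and>
        cech_cochain X (Suc 1) \<V> id b \<and>
        (\<forall>is. set is \<subseteq> \<V> \<and> length is = 1 + 2 \<longrightarrow>
           (\<forall>x\<in>cover_inter id is. j (b is x) = cech_coboundary ht is x)) \<and>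
        d = cech_class X (Suc 1) \<V> id b"
  have "(\<U>, g) \<in> cech_class X 1 \<U> id g"
    using g cech_cohomologous_refine [OF oc, of 1 id \<U> id g] unfolding cech_class_def by simp
  moreover have "connecting_data j q X \<U> id g gt a \<and> cech_cochain X 2 \<U> id a"
    using a d by (simp add: cech_cocycle_def)
  ultimately have "?R (cech_class X 2 \<U> id a) \<U> g gt a"
    unfolding iff [symmetric] e by blast
  then show "\<exists>\<V> h ht b. ?R (cech_class X 2 \<U> id a) \<V> h ht b" by blast
  fix c assume "\<exists>\<V> h ht b. ?R c \<V> h ht b"
  then obtain \<V> h ht b where R: "?R c \<V> h ht b" by (elim exE)
  then have b: "connecting_data j q X \<V> id h ht b" using iff [of \<V> ht h b] by blast
  have h: "cech_cocycle X 1 \<V> id h" "cech_cohomologous X 1 \<U> id g \<V> id h"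
    using R unfolding cech_class_def by blast+
  have oc': "open_cover X \<V> id" using h(1) by (simp add: cech_cocycle_def)
  have "cech_class X 2 \<U> id a = cech_class X 2 \<V> id b"
    by (rule cech_class_eq [OF connecting_cohomologous [OF KG d b h(2)] a connecting_cocycle [OF KG oc' b]]) simp
  then show "c = cech_class X 2 \<U> id a" using R unfolding e by metis
qed

section \<open>Pullback of cocycles and of their classes\<close>

lemma cech_cocycle_pullback:
  assumes \<sigma>: "continuous_map Y X \<sigma>" and g: "cech_cocycle X n I U g"
  shows "cech_cocycle Y n I (\<lambda>a. topspace Y \<inter> \<sigma> -` U a) (\<lambda>is. g is \<circ> \<sigma>)"
  unfolding cech_cocycle_def
proof (intro conjI allI impI ballI)
  let ?U = "\<lambda>a. topspace Y \<inter> \<sigma> -` U a"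
  have oc: "open_cover X I U" using g by (simp add: cech_cocycle_def)
  have "openin Y (?U a)" if "a \<in> I" for a
  proof -
    have "openin Y {y \<in> topspace Y. \<sigma> y \<in> U a}"
      using oc that by (intro openin_continuous_map_preimage [OF \<sigma>]) (simp add: open_cover_def)
    moreover have "{y \<in> topspace Y. \<sigma> y \<in> U a} = ?U a" by auto
    ultimately show ?thesis by simp
  qed
  moreover have "\<sigma> y \<in> (\<Union>a\<in>I. U a)" if "y \<in> topspace Y" for y
    using oc continuous_map_image_subset_topspace [OF \<sigma>] that unfolding open_cover_def by auto
  ultimately show "open_cover Y I ?U" unfolding open_cover_def by auto
  show "cech_cochain Y n I ?U (\<lambda>is. g is \<circ> \<sigma>)"
    unfolding cech_cochain_def
  proof (intro allI impI)
    fix "is" assume "is": "set is \<subseteq> I \<and> length is = Suc n"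
    have "continuous_map (subtopology Y (cover_inter ?U is)) (subtopology X (cover_inter U is)) \<sigma>"
      using continuous_map_from_subtopology [OF \<sigma>]
      by (auto simp: continuous_map_in_subtopology cover_inter_def)
    moreover have "continuous_map (subtopology X (cover_inter U is)) euclidean (g is)"
      using g "is" unfolding cech_cocycle_def cech_cochain_def by blast
    ultimately show "continuous_map (subtopology Y (cover_inter ?U is)) euclidean (g is \<circ> \<sigma>)"
      by (rule continuous_map_compose)
  qed
  fix "is" y assume "is": "set is \<subseteq> I \<and> length is = n + 2" and y: "y \<in> cover_inter ?U is"
  have "\<sigma> y \<in> cover_inter U is" using y by (auto simp: cover_inter_def split: if_splits)
  then have "cech_coboundary g is (\<sigma> y) = 0"
    using g "is" unfolding cech_cocycle_def by blast
  then show "cech_coboundary (\<lambda>is. g is \<circ> \<sigma>) is y = 0"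
    by (simp add: cech_coboundary_def cong: if_cong)
qed

lemma cech_cohomologous_2_pullback:
  assumes \<sigma>: "continuous_map Y X \<sigma>" and gh: "cech_cohomologous X 2 I U g J V h"
  shows "cech_cohomologous Y 2 I (\<lambda>a. topspace Y \<inter> \<sigma> -` U a) (\<lambda>is. g is \<circ> \<sigma>)
    J (\<lambda>a. topspace Y \<inter> \<sigma> -` V a) (\<lambda>is. h is \<circ> \<sigma>)"
proof -
  obtain \<V> r s k where \<V>: "open_cover X \<V> id"
    and rs: "\<And>N. N \<in> \<V> \<Longrightarrow> r N \<in> I \<and> N \<subseteq> U (r N) \<and> s N \<in> J \<and> N \<subseteq> V (s N)"
    and k: "\<And>M N. M \<in> \<V> \<Longrightarrow> N \<in> \<V> \<Longrightarrow> continuous_map (subtopology X (M \<inter> N)) euclidean (k M N)"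
    and ghk: "\<And>L M N x. L \<in> \<V> \<Longrightarrow> M \<in> \<V> \<Longrightarrow> N \<in> \<V> \<Longrightarrow> x \<in> L \<Longrightarrow> x \<in> M \<Longrightarrow> x \<in> N \<Longrightarrow>
      g [r L, r M, r N] x - h [s L, s M, s N] x = k M N x - k L N x + k L M x"
    by (rule cech_cohomologous_2E [OF gh]) (rule that)
  let ?pre = "\<lambda>N. topspace Y \<inter> \<sigma> -` N"
  \<comment> \<open>Different members of \<open>\<V>\<close> may have the same preimage, hence a
    choice.\<close>
  define v where "v = inv_into \<V> ?pre"
  have v: "v N \<in> \<V>" "N = ?pre (v N)" if "N \<in> ?pre ` \<V>" for N
    using that by (simp_all add: v_def inv_into_into f_inv_into_f [where f = ?pre])
  have "open_cover Y \<V> ?pre"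
  proof -
    \<comment> \<open>Only the cover statement is wanted; it is read off from the pullback of the
      zero cocycle.\<close>
    have "cech_cocycle X 1 \<V> id (\<lambda>_ _. 0 :: 'd)"
      using \<V> by (simp add: cech_cocycle_def cech_cochain_def cech_coboundary_zero)
    from cech_cocycle_pullback [OF \<sigma> this] show ?thesis by (simp add: cech_cocycle_def)
  qed
  then have oc: "open_cover Y (?pre ` \<V>) id" by (rule open_cover_image)
  show ?thesis
  proof (rule cech_cohomologous_2I [OF oc, where r = "r \<circ> v" and s = "s \<circ> v" and k = "\<lambda>M N. k (v M) (v N) \<circ> \<sigma>"])
    fix N assume N: "N \<in> ?pre ` \<V>"
    show "(r \<circ> v) N \<in> I \<and> N \<subseteq> ?pre (U ((r \<circ> v) N)) \<and> (s \<circ> v) N \<in> J \<and> N \<subseteq> ?pre (V ((s \<circ> v) N))"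
      using rs [OF v(1) [OF N]] v(2) [OF N] by auto
  next
    fix M N assume M: "M \<in> ?pre ` \<V>" and N: "N \<in> ?pre ` \<V>"
    have "continuous_map (subtopology Y (M \<inter> N)) (subtopology X (v M \<inter> v N)) \<sigma>"
      unfolding continuous_map_in_subtopology
      using continuous_map_from_subtopology [OF \<sigma>] v(2) [OF M] v(2) [OF N] by auto
    then show "continuous_map (subtopology Y (M \<inter> N)) euclidean (k (v M) (v N) \<circ> \<sigma>)"
      by (rule continuous_map_compose) (rule k [OF v(1) [OF M] v(1) [OF N]])
  next
    fix L M N x assume LMN: "L \<in> ?pre ` \<V>" "M \<in> ?pre ` \<V>" "N \<in> ?pre ` \<V>" and x: "x \<in> L" "x \<in> M" "x \<in> N"
    have "\<sigma> x \<in> v L" "\<sigma> x \<in> v M" "\<sigma> x \<in> v N"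
      using x v(2) [OF LMN(1)] v(2) [OF LMN(2)] v(2) [OF LMN(3)] by auto
    from ghk [OF v(1) [OF LMN(1)] v(1) [OF LMN(2)] v(1) [OF LMN(3)] this]
    show "(g [(r \<circ> v) L, (r \<circ> v) M, (r \<circ> v) N] \<circ> \<sigma>) x - (h [(s \<circ> v) L, (s \<circ> v) M, (s \<circ> v) N] \<circ> \<sigma>) x =
        (k (v M) (v N) \<circ> \<sigma>) x - (k (v L) (v N) \<circ> \<sigma>) x + (k (v L) (v M) \<circ> \<sigma>) x"
      by simp
  qed
qed

lemma cech_pullback_eq:
  assumes \<sigma>: "continuous_map Y X \<sigma>" and g: "cech_cocycle X 2 I U g"
  shows "cech_pullback Y \<sigma> 2 (cech_class X 2 I U g) =
    cech_class Y 2 I (\<lambda>a. topspace Y \<inter> \<sigma> -` U a) (\<lambda>is. g is \<circ> \<sigma>)"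
  unfolding cech_pullback_def
proof (rule the_equality)
  have *: "cech_class Y 2 \<V> (\<lambda>V. topspace Y \<inter> \<sigma> -` V) (\<lambda>is. h is \<circ> \<sigma>) =
      cech_class Y 2 I (\<lambda>a. topspace Y \<inter> \<sigma> -` U a) (\<lambda>is. g is \<circ> \<sigma>)"
    if "(\<V>, h) \<in> cech_class X 2 I U g" for \<V> h
  proof -
    have h: "cech_cocycle X 2 \<V> id h" "cech_cohomologous X 2 I U g \<V> id h"
      using that unfolding cech_class_def by blast+
    have n: "(2::nat) = 1 \<or> (2::nat) = 2" by simp
    show ?thesis
      using cech_class_eq [OF cech_cohomologous_2_pullback [OF \<sigma> h(2)] cech_cocycle_pullback [OF \<sigma> g]
          cech_cocycle_pullback [OF \<sigma> h(1)] n] by simp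
  qed
  obtain \<V> h where h: "(\<V>, h) \<in> cech_class X 2 I U g"
    using cech_class_rep [OF g] by blast
  then show "\<exists>\<V> h. (\<V>, h) \<in> cech_class X 2 I U g \<and>
      cech_class Y 2 I (\<lambda>a. topspace Y \<inter> \<sigma> -` U a) (\<lambda>is. g is \<circ> \<sigma>) =
      cech_class Y 2 \<V> (\<lambda>V. topspace Y \<inter> \<sigma> -` V) (\<lambda>is. h is \<circ> \<sigma>)"
    using * [OF h] by (intro exI [of _ \<V>] exI [of _ h]) simp
  fix d assume "\<exists>\<V> h. (\<V>, h) \<in> cech_class X 2 I U g \<and>
      d = cech_class Y 2 \<V> (\<lambda>V. topspace Y \<inter> \<sigma> -` V) (\<lambda>is. h is \<circ> \<sigma>)"
  then show "d = cech_class Y 2 I (\<lambda>a. topspace Y \<inter> \<sigma> -` U a) (\<lambda>is. g is \<circ> \<sigma>)"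
    using * by (elim exE conjE) simp
qed

section \<open>Discrete bundles over contractible spaces\<close>

lemma continuous_on_discrete_constant:
  fixes f :: "'a::topological_space \<Rightarrow> 'g::discrete_topology"
  assumes "connected S" "continuous_on S f" "x \<in> S" "y \<in> S"
  shows "f x = f y"
proof (rule ccontr)
  assume ne: "f x \<noteq> f y"
  have "connected (f ` S)" using assms(2,1) by (rule connected_continuous_image)
  then have "{f x} \<inter> f ` S = {} \<or> - {f x} \<inter> f ` S = {}"
    by (rule connectedD) (auto simp: open_discrete)
  moreover have "f x \<in> {f x} \<inter> f ` S" "f y \<in> - {f x} \<inter> f ` S" using ne assms(3,4) by auto
  ultimately show False by blast
qed

lemma continuous_on_locally_constant:
  fixes f :: "'a::topological_space \<Rightarrow> 'b::topological_space"
  assumes "\<And>x. x \<in> S \<Longrightarrow> \<exists>N. openin (top_of_set S) N \<and> x \<in> N \<and> (\<forall>y\<in>N. f y = f x)"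
  shows "continuous_on S f"
proof -
  have "continuous_map (top_of_set S) euclidean f"
    by (rule continuous_map_locally_constant) (use assms in simp)
  then show ?thesis by simp
qed

lemma openin_level_set:
  fixes f :: "'a::topological_space \<Rightarrow> 'g::discrete_topology"
  assumes "continuous_on S f" "openin (top_of_set Y) S"
  shows "openin (top_of_set Y) {x \<in> S. f x = v}"
proof -
  have "openin (top_of_set S) (S \<inter> f -` {v})"
    using assms(1) by (rule continuous_openin_preimage_gen) (simp add: open_discrete)
  moreover have "S \<inter> f -` {v} = {x \<in> S. f x = v}" by auto
  ultimately show ?thesis using assms(2) openin_trans by metis
qed

lemma eventually_nhds_openin:
  assumes "openin (top_of_set S) W" "t \<in> W"
  shows "\<forall>\<^sub>F \<tau> in nhds t. \<tau> \<in> S \<longrightarrow> \<tau> \<in> W"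
proof -
  obtain O' where "open O'" "W = S \<inter> O'" using assms(1) by (auto simp: openin_open)
  then show ?thesis using assms(2) unfolding eventually_nhds by blast
qed

text \<open>The cocycle describes a principal bundle with discrete structure group; its section over \<open>y\<close> is
  transported along the path from \<open>e\<close> to \<open>y\<close> that the contraction provides.\<close>

lemma discrete_cocycle_trivial:
  fixes Y :: "'y::topological_space set" and H :: "real \<times> 'y \<Rightarrow> 'y"
    and c :: "'i \<Rightarrow> 'i \<Rightarrow> 'y \<Rightarrow> 'g::{topological_ab_group_add,discrete_topology}"
  assumes H: "continuous_on ({0..1} \<times> Y) H"
    and HY: "\<And>t y. t \<in> {0..1} \<Longrightarrow> y \<in> Y \<Longrightarrow> H (t, y) \<in> Y"
    and H0: "\<And>y. y \<in> Y \<Longrightarrow> H (0, y) = e" and H1: "\<And>y. y \<in> Y \<Longrightarrow> H (1, y) = y"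
    and V: "\<And>k. k \<in> I \<Longrightarrow> openin (top_of_set Y) (V k)" and cov: "Y \<subseteq> (\<Union>k\<in>I. V k)"
    and c: "\<And>k l. k \<in> I \<Longrightarrow> l \<in> I \<Longrightarrow> continuous_on (V k \<inter> V l) (c k l)"
    and coc: "\<And>k l m x. k \<in> I \<Longrightarrow> l \<in> I \<Longrightarrow> m \<in> I \<Longrightarrow> x \<in> V k \<Longrightarrow> x \<in> V l \<Longrightarrow> x \<in> V m \<Longrightarrow>
      c k l x + c l m x = c k m x"
  obtains s where "\<And>k. k \<in> I \<Longrightarrow> continuous_on (V k) (s k)"
    "\<And>k l x. k \<in> I \<Longrightarrow> l \<in> I \<Longrightarrow> x \<in> V k \<Longrightarrow> x \<in> V l \<Longrightarrow> s l x - s k x = c k l x"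
proof -
  have "\<forall>x\<in>Y. \<exists>k\<in>I. x \<in> V k" using cov by auto
  then obtain v where v: "\<And>x. x \<in> Y \<Longrightarrow> v x \<in> I \<and> x \<in> V (v x)" by metis
  have VY: "x \<in> Y" if "k \<in> I" "x \<in> V k" for k x
    using openin_subset [OF V [OF that(1)]] that(2) by auto
  \<comment> \<open>\<open>\<phi> t\<close> is the fibre coordinate in the chart
    \<open>v (H (t, y))\<close>, which may jump with \<open>t\<close> since \<open>v\<close> is an
    arbitrary choice. \<open>\<Phi>\<close> expresses it in the fixed chart \<open>k\<close>, where
    local constancy makes sense.\<close>
  define \<Phi> where "\<Phi> y \<phi> k t = \<phi> t + c (v (H (t, y))) k (H (t, y))" for y :: 'y and \<phi> :: "real \<Rightarrow> 'g" and k t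
  have \<Phi>: "\<Phi> y \<phi> l t = \<Phi> y \<phi> k t + c k l (H (t, y))"
    if "k \<in> I" "l \<in> I" "H (t, y) \<in> V k" "H (t, y) \<in> V l" for y \<phi> k l t
    using coc [of "v (H (t, y))" k l "H (t, y)"] v [OF VY [OF that(1,3)]] that by (simp add: \<Phi>_def add.assoc)
  define D where "D k l z = {x \<in> V k \<inter> V l. c k l x = c k l z}" for k l z
  have D: "openin (top_of_set Y) (D k l z)" if "k \<in> I" "l \<in> I" for k l z
    unfolding D_def by (intro openin_level_set c openin_Int V that)
  have cH: "continuous_on {0..1} (\<lambda>t. H (t, y))" if "y \<in> Y" for y
    by (rule continuous_on_compose2 [OF H]) (use that in \<open>auto intro!: continuous_intros\<close>)
  have cH': "continuous_on Y (\<lambda>y. H (t, y))" if "t \<in> {0..1}" for t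
    by (rule continuous_on_compose2 [OF H]) (use that in \<open>auto intro!: continuous_intros\<close>)
  have PRE: "\<forall>\<^sub>F \<tau> in nhds t. \<tau> \<in> {0..1} \<longrightarrow> H (\<tau>, y) \<in> W"
    if W: "openin (top_of_set Y) W" "y \<in> Y" "t \<in> {0..1}" "H (t, y) \<in> W" for W y t
  proof -
    have "openin (top_of_set {0..1}) ({0..1} \<inter> (\<lambda>t. H (t, y)) -` W)"
      using cH [OF W(2)] HY W by (intro continuous_openin_preimage [of _ _ Y]) auto
    from eventually_nhds_openin [OF this, of t] show ?thesis
      using W by (auto elim: eventually_mono)
  qed
  \<comment> \<open>The third condition on \<open>A\<close> says that it is an interval, so that
    \<open>CONST\<close> applies between any two of its points.\<close>
  have TUBE: "\<exists>k A N. k \<in> I \<and> openin (top_of_set {0..1}) A \<and> t \<in> A \<and>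
      (\<forall>a\<in>A. \<forall>b\<in>A. {a..b} \<subseteq> A) \<and> openin (top_of_set Y) N \<and> y \<in> N \<and> (\<forall>a\<in>A. \<forall>z\<in>N. H (a, z) \<in> V k)"
    if t: "t \<in> {0..1}" and y: "y \<in> Y" for t y
  proof -
    define k where "k = v (H (t, y))"
    have k: "k \<in> I" "H (t, y) \<in> V k" using v [OF HY [OF t y]] by (auto simp: k_def)
    have "openin (top_of_set ({0..1} \<times> Y)) (({0..1} \<times> Y) \<inter> H -` V k)"
      using H HY V [OF k(1)] by (intro continuous_openin_preimage [of _ _ Y]) auto
    then have "openin (prod_topology (top_of_set {0..1}) (top_of_set Y)) (({0..1} \<times> Y) \<inter> H -` V k)"
      by simp
    moreover have "(t, y) \<in> ({0..1} \<times> Y) \<inter> H -` V k" using t y k by auto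
    ultimately obtain A0 N where A0: "openin (top_of_set {0..1}) A0" "openin (top_of_set Y) N" "t \<in> A0" "y \<in> N"
        "A0 \<times> N \<subseteq> ({0..1} \<times> Y) \<inter> H -` V k"
      unfolding openin_prod_topology_alt by metis
    obtain \<epsilon> where \<epsilon>: "\<epsilon> > 0" "ball t \<epsilon> \<inter> {0..1} \<subseteq> A0"
      using A0(1,3) unfolding openin_contains_ball by blast
    define A where "A = ball t \<epsilon> \<inter> {0..1}"
    show ?thesis
    proof (intro exI conjI ballI)
      show "openin (top_of_set {0..1}) A"
        unfolding A_def by (subst inf_commute) (simp add: openin_open_Int)
      show "t \<in> A" using t \<epsilon> by (simp add: A_def)
      show "{a..b} \<subseteq> A" if "a \<in> A" "b \<in> A" for a b
        using that by (auto simp: A_def dist_real_def)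
      show "H (a, z) \<in> V k" if "a \<in> A" "z \<in> N" for a z
      proof -
        have "(a, z) \<in> A0 \<times> N" using \<epsilon>(2) that by (auto simp: A_def)
        then show ?thesis using A0(5) by blast
      qed
    qed (use A0(2,4) k(1) in simp_all)
  qed
  \<comment> \<open>\<open>\<phi>\<close> is parallel along \<open>t \<mapsto> H (t, y)\<close> up
    to time \<open>T\<close>: its coordinate in each chart is locally constant.\<close>
  define sec where "sec y T \<phi> \<longleftrightarrow> (\<forall>t\<in>{0..T}. \<forall>k\<in>I. H (t, y) \<in> V k \<longrightarrow>
      (\<forall>\<^sub>F \<tau> in nhds t. \<tau> \<in> {0..T} \<longrightarrow> \<Phi> y \<phi> k \<tau> = \<Phi> y \<phi> k t))" for y T \<phi>
  have CONST: "\<Phi> y \<phi> k b = \<Phi> y \<phi> k a"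
    if "sec y T \<phi>" "k \<in> I" "0 \<le> a" "a \<le> b" "b \<le> T" and HV: "\<And>\<tau>. \<tau> \<in> {a..b} \<Longrightarrow> H (\<tau>, y) \<in> V k" for y T \<phi> k a b
  proof -
    have "\<Phi> y \<phi> k constant_on {a..b}"
    proof (rule locally_constant_imp_constant)
      fix \<tau> assume \<tau>: "\<tau> \<in> {a..b}"
      then have "\<forall>\<^sub>F t in nhds \<tau>. t \<in> {0..T} \<longrightarrow> \<Phi> y \<phi> k t = \<Phi> y \<phi> k \<tau>"
        using that(1-5) HV [OF \<tau>] unfolding sec_def by auto
      then obtain O' where O': "open O'" "\<tau> \<in> O'" "\<And>t. t \<in> O' \<Longrightarrow> t \<in> {0..T} \<Longrightarrow> \<Phi> y \<phi> k t = \<Phi> y \<phi> k \<tau>"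
        unfolding eventually_nhds by blast
      have "\<forall>t\<in>{a..b} \<inter> O'. \<Phi> y \<phi> k t = \<Phi> y \<phi> k \<tau>"
        using O'(3) that(3,5) by auto
      then show "\<exists>S. openin (top_of_set {a..b}) S \<and> \<tau> \<in> S \<and> (\<forall>t\<in>S. \<Phi> y \<phi> k t = \<Phi> y \<phi> k \<tau>)"
        using O'(1,2) \<tau> openin_open_Int by blast
    qed simp
    then show ?thesis using that(4) unfolding constant_on_def by auto
  qed
  have EXIST: "\<exists>\<phi>. sec y 1 \<phi> \<and> \<phi> 0 = 0" if y: "y \<in> Y" for y
  proof (rule connected_induction_simple [of "{0..1::real}" 0 1 "\<lambda>T. \<exists>\<phi>. sec y T \<phi> \<and> \<phi> 0 = 0"])
    show "\<exists>\<phi>. sec y 0 \<phi> \<and> \<phi> 0 = 0"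
      by (rule exI [of _ "\<lambda>_. 0"]) (simp add: sec_def)
    fix t0 :: real assume t0: "t0 \<in> {0..1}"
    obtain i A N where i: "i \<in> I" and A: "openin (top_of_set {0..1}) A" "t0 \<in> A"
      and ivl: "\<And>a b. a \<in> A \<Longrightarrow> b \<in> A \<Longrightarrow> {a..b} \<subseteq> A" and N: "y \<in> N" "\<And>a z. a \<in> A \<Longrightarrow> z \<in> N \<Longrightarrow> H (a, z) \<in> V i"
      using TUBE [OF t0 y] by (elim exE conjE) (rule that; (assumption | (drule (1) bspec, drule (1) bspec, assumption)))
    have A01: "A \<subseteq> {0..1}" using openin_subset [OF A(1)] by simp
    have step: "\<exists>\<phi>. sec y b \<phi> \<and> \<phi> 0 = 0" if a: "a \<in> A" and b: "b \<in> A" and ex: "\<exists>\<phi>. sec y a \<phi> \<and> \<phi> 0 = 0" for a b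
    proof -
      obtain \<phi> where \<phi>: "sec y a \<phi>" "\<phi> 0 = 0" using ex by blast
      have ab: "0 \<le> a" "a \<le> 1" "0 \<le> b" "b \<le> 1" using a b A01 by auto
      show ?thesis
      proof (cases "b \<le> a")
        case True
        have "sec y b \<phi>"
          unfolding sec_def
        proof (intro ballI impI)
          fix t k assume t: "t \<in> {0..b}" and k: "k \<in> I" "H (t, y) \<in> V k"
          have "t \<in> {0..a}" using t True by auto
          then have "\<forall>\<^sub>F \<tau> in nhds t. \<tau> \<in> {0..a} \<longrightarrow> \<Phi> y \<phi> k \<tau> = \<Phi> y \<phi> k t"
            using \<phi>(1) k unfolding sec_def by blast
          then show "\<forall>\<^sub>F \<tau> in nhds t. \<tau> \<in> {0..b} \<longrightarrow> \<Phi> y \<phi> k \<tau> = \<Phi> y \<phi> k t"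
            by (rule eventually_mono) (use True in auto)
        qed
        then show ?thesis using \<phi>(2) by blast
      next
        case False
        \<comment> \<open>Past \<open>a\<close> the transport continues by keeping the coordinate in
          the chart \<open>i\<close> constant; subtracting the transition function converts it to
          the chart \<open>v (H (\<tau>, y))\<close>.\<close>
        define \<psi> where "\<psi> \<tau> = (if \<tau> \<le> a then \<phi> \<tau> else \<Phi> y \<phi> i a - c (v (H (\<tau>, y))) i (H (\<tau>, y)))" for \<tau>
        have \<psi>i: "\<Phi> y \<psi> i \<tau> = \<Phi> y \<phi> i a" if \<tau>: "\<tau> \<in> A" for \<tau>
        proof (cases "\<tau> \<le> a")
          case True
          have "\<Phi> y \<phi> i a = \<Phi> y \<phi> i \<tau>"
          proof (rule CONST [OF \<phi>(1) i _ True order_refl])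
            show "0 \<le> \<tau>" using \<tau> A01 by auto
            show "H (\<sigma>, y) \<in> V i" if "\<sigma> \<in> {\<tau>..a}" for \<sigma>
              using N ivl [OF \<tau> a] that by blast
          qed
          then show ?thesis using True by (simp add: \<Phi>_def \<psi>_def)
        qed (simp add: \<Phi>_def \<psi>_def)
        have "sec y b \<psi>"
          unfolding sec_def
        proof (intro ballI impI)
          fix t k assume t: "t \<in> {0..b}" and k: "k \<in> I" "H (t, y) \<in> V k"
          have t01: "t \<in> {0..1}" using t ab by auto
          show "\<forall>\<^sub>F \<tau> in nhds t. \<tau> \<in> {0..b} \<longrightarrow> \<Phi> y \<psi> k \<tau> = \<Phi> y \<psi> k t"
          proof (cases "t < a")
            case True
            have *: "\<Phi> y \<psi> k \<tau> = \<Phi> y \<phi> k \<tau>" if "\<tau> < a" for \<tau>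
              using that by (simp add: \<Phi>_def \<psi>_def)
            have 1: "\<forall>\<^sub>F \<tau> in nhds t. \<tau> < a"
              using True unfolding eventually_nhds by (intro exI [of _ "{..<a}"]) auto
            have "t \<in> {0..a}" using t True by auto
            then have 2: "\<forall>\<^sub>F \<tau> in nhds t. \<tau> \<in> {0..a} \<longrightarrow> \<Phi> y \<phi> k \<tau> = \<Phi> y \<phi> k t"
              using \<phi>(1) k unfolding sec_def by blast
            show ?thesis
              using 1 2 by eventually_elim (use * True in auto)
          next
            case False
            then have "t \<in> {a..b}" using t by auto
            then have tA: "t \<in> A" using ivl [OF a b] by blast
            have HD: "H (t, y) \<in> D i k (H (t, y))" using N tA k by (simp add: D_def)
            have 1: "\<forall>\<^sub>F \<tau> in nhds t. \<tau> \<in> {0..1} \<longrightarrow> H (\<tau>, y) \<in> D i k (H (t, y))"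
              by (rule PRE [OF D [OF i k(1)] y t01 HD])
            have 2: "\<forall>\<^sub>F \<tau> in nhds t. \<tau> \<in> {0..1} \<longrightarrow> \<tau> \<in> A"
              by (rule eventually_nhds_openin [OF A(1) tA])
            have D': "\<Phi> y \<psi> k \<tau> = \<Phi> y \<phi> i a + c i k (H (t, y))" if "\<tau> \<in> A" "H (\<tau>, y) \<in> D i k (H (t, y))" for \<tau>
              using \<Phi> [OF i k(1), of \<tau> y \<psi>] that \<psi>i [OF that(1)] by (simp add: D_def)
            show ?thesis
              using 1 2
            proof eventually_elim
              case (elim \<tau>)
              show ?case
              proof
                assume "\<tau> \<in> {0..b}"
                then have "\<tau> \<in> {0..1}" using ab by auto
                then show "\<Phi> y \<psi> k \<tau> = \<Phi> y \<psi> k t"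
                  using elim D' [of \<tau>] D' [OF tA HD] by simp
              qed
            qed
          qed
        qed
        moreover have "\<psi> 0 = 0" using \<phi>(2) ab by (simp add: \<psi>_def)
        ultimately show ?thesis by blast
      qed
    qed
    show "\<exists>S. openin (top_of_set {0..1}) S \<and> t0 \<in> S \<and>
        (\<forall>a\<in>S. \<forall>b\<in>S. (\<exists>\<phi>. sec y a \<phi> \<and> \<phi> 0 = 0) \<longrightarrow> (\<exists>\<phi>. sec y b \<phi> \<and> \<phi> 0 = 0))"
    proof (rule exI [of _ A], intro conjI ballI impI)
      show "\<exists>\<phi>. sec y b \<phi> \<and> \<phi> 0 = 0" if "a \<in> A" "b \<in> A" "\<exists>\<phi>. sec y a \<phi> \<and> \<phi> 0 = 0" for a b
        using that by (rule step)
    qed (rule A)+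
  qed simp_all
  then obtain \<phi> where \<phi>: "\<And>y. y \<in> Y \<Longrightarrow> sec y 1 (\<phi> y) \<and> \<phi> y 0 = 0" by metis
  define s where "s k y = \<phi> y 1 + c (v y) k y" for k y
  \<comment> \<open>Local constancy in \<open>y\<close> is again an induction over time. At time
    \<open>0\<close> all paths start at \<open>e\<close> with coordinate \<open>0\<close>; the step
    compares \<open>y\<close> with \<open>y0\<close> in a chart that contains
    \<open>H (a, z)\<close> for all \<open>a\<close> and \<open>z\<close> of a tube.\<close>
  have LOC: "\<forall>k\<in>I. H (1, y0) \<in> V k \<longrightarrow> (\<exists>N. openin (top_of_set Y) N \<and> y0 \<in> N \<and>
      (\<forall>y\<in>N. H (1, y) \<in> V k \<and> \<Phi> y (\<phi> y) k 1 = \<Phi> y0 (\<phi> y0) k 1))" if y0: "y0 \<in> Y" for y0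
  proof (rule connected_induction_simple [of "{0..1::real}" 0 1 "\<lambda>t. \<forall>k\<in>I. H (t, y0) \<in> V k \<longrightarrow>
      (\<exists>N. openin (top_of_set Y) N \<and> y0 \<in> N \<and> (\<forall>y\<in>N. H (t, y) \<in> V k \<and> \<Phi> y (\<phi> y) k t = \<Phi> y0 (\<phi> y0) k t))"])
    show "\<forall>k\<in>I. H (0, y0) \<in> V k \<longrightarrow> (\<exists>N. openin (top_of_set Y) N \<and> y0 \<in> N \<and>
        (\<forall>y\<in>N. H (0, y) \<in> V k \<and> \<Phi> y (\<phi> y) k 0 = \<Phi> y0 (\<phi> y0) k 0))"
    proof (intro ballI impI exI [of _ Y] conjI y0)
      fix k y assume "k \<in> I" "H (0, y0) \<in> V k" "y \<in> Y"
      then show "H (0, y) \<in> V k" "\<Phi> y (\<phi> y) k 0 = \<Phi> y0 (\<phi> y0) k 0"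
        using \<phi> y0 H0 by (simp_all add: \<Phi>_def)
    qed simp
    fix t0 :: real assume t0: "t0 \<in> {0..1}"
    obtain i A N where i: "i \<in> I" and A: "openin (top_of_set {0..1}) A" "t0 \<in> A"
      and ivl: "\<And>a b. a \<in> A \<Longrightarrow> b \<in> A \<Longrightarrow> {a..b} \<subseteq> A"
      and N: "openin (top_of_set Y) N" "y0 \<in> N" "\<And>a z. a \<in> A \<Longrightarrow> z \<in> N \<Longrightarrow> H (a, z) \<in> V i"
      using TUBE [OF t0 y0] by (elim exE conjE) (rule that; (assumption | (drule (1) bspec, drule (1) bspec, assumption)))
    have A01: "A \<subseteq> {0..1}" using openin_subset [OF A(1)] by simp
    have NY: "N \<subseteq> Y" using openin_subset [OF N(1)] by simp
    have const: "\<Phi> y (\<phi> y) i b = \<Phi> y (\<phi> y) i a" if ab: "a \<in> A" "b \<in> A" and y: "y \<in> N" for a b y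
    proof -
      have le: "\<Phi> y (\<phi> y) i b = \<Phi> y (\<phi> y) i a" if "a \<in> A" "b \<in> A" "a \<le> b" for a b
      proof (rule CONST [of y 1 "\<phi> y" i a b])
        show "sec y 1 (\<phi> y)" using \<phi> y NY by blast
        show "0 \<le> a" "b \<le> 1" using that A01 by auto
        show "H (\<tau>, y) \<in> V i" if "\<tau> \<in> {a..b}" for \<tau>
          using N(3) [OF _ y] ivl [OF \<open>a \<in> A\<close> \<open>b \<in> A\<close>] that by blast
      qed (use i that in auto)
      show ?thesis
        using le [OF ab] le [OF ab(2,1)] by (cases "a \<le> b") auto
    qed
    have step: "\<exists>M. openin (top_of_set Y) M \<and> y0 \<in> M \<and> (\<forall>y\<in>M. H (b, y) \<in> V k \<and> \<Phi> y (\<phi> y) k b = \<Phi> y0 (\<phi> y0) k b)"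
      if a: "a \<in> A" and b: "b \<in> A" and ex: "\<forall>k\<in>I. H (a, y0) \<in> V k \<longrightarrow> (\<exists>N. openin (top_of_set Y) N \<and> y0 \<in> N \<and>
        (\<forall>y\<in>N. H (a, y) \<in> V k \<and> \<Phi> y (\<phi> y) k a = \<Phi> y0 (\<phi> y0) k a))"
        and k: "k \<in> I" "H (b, y0) \<in> V k" for a b k
    proof -
      obtain N1 where N1: "openin (top_of_set Y) N1" "y0 \<in> N1" "\<And>y. y \<in> N1 \<Longrightarrow> \<Phi> y (\<phi> y) i a = \<Phi> y0 (\<phi> y0) i a"
        using ex i N(3) [OF a N(2)] by meson
      have b01: "b \<in> {0..1}" using b A01 by blast
      define N2 where "N2 = Y \<inter> (\<lambda>y. H (b, y)) -` D i k (H (b, y0))"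
      have N2: "openin (top_of_set Y) N2"
        unfolding N2_def
        using HY b01 by (intro continuous_openin_preimage [OF cH' [OF b01] _ D [OF i k(1)]]) auto
      have HD: "y0 \<in> N2" using y0 N(3) [OF b N(2)] k by (simp add: N2_def D_def)
      have "H (b, y) \<in> V k \<and> \<Phi> y (\<phi> y) k b = \<Phi> y0 (\<phi> y0) k b" if y: "y \<in> N \<inter> N1 \<inter> N2" for y
      proof -
        have Hy: "H (b, y) \<in> V i" "H (b, y) \<in> V k" "c i k (H (b, y)) = c i k (H (b, y0))"
          using y by (auto simp: N2_def D_def)
        have "\<Phi> y (\<phi> y) k b = \<Phi> y (\<phi> y) i b + c i k (H (b, y))"
          by (rule \<Phi> [OF i k(1) Hy(1,2)])
        also have "\<Phi> y (\<phi> y) i b = \<Phi> y (\<phi> y) i a" using const [OF a b] y by blast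
        also have "\<dots> = \<Phi> y0 (\<phi> y0) i a" using N1(3) y by blast
        also have "\<dots> = \<Phi> y0 (\<phi> y0) i b" using const [OF a b N(2)] by simp
        also have "\<Phi> y0 (\<phi> y0) i b + c i k (H (b, y)) = \<Phi> y0 (\<phi> y0) k b"
          unfolding Hy(3) by (rule \<Phi> [OF i k(1) N(3) [OF b N(2)] k(2), symmetric])
        finally show ?thesis using Hy(2) by blast
      qed
      moreover have "openin (top_of_set Y) (N \<inter> N1 \<inter> N2)" by (intro openin_Int N N1 N2)
      ultimately show ?thesis using N(2) N1(2) HD by blast
    qed
    show "\<exists>S. openin (top_of_set {0..1}) S \<and> t0 \<in> S \<and>
        (\<forall>a\<in>S. \<forall>b\<in>S. (\<forall>k\<in>I. H (a, y0) \<in> V k \<longrightarrow> (\<exists>N. openin (top_of_set Y) N \<and> y0 \<in> N \<and>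
           (\<forall>y\<in>N. H (a, y) \<in> V k \<and> \<Phi> y (\<phi> y) k a = \<Phi> y0 (\<phi> y0) k a))) \<longrightarrow>
         (\<forall>k\<in>I. H (b, y0) \<in> V k \<longrightarrow> (\<exists>N. openin (top_of_set Y) N \<and> y0 \<in> N \<and>
           (\<forall>y\<in>N. H (b, y) \<in> V k \<and> \<Phi> y (\<phi> y) k b = \<Phi> y0 (\<phi> y0) k b))))"
      by (rule exI [of _ A], intro conjI ballI impI; (rule A)?) (rule step; assumption)
  qed simp_all
  show thesis
  proof (rule that [of s])
    show "continuous_on (V k) (s k)" if k: "k \<in> I" for k
    proof (rule continuous_on_locally_constant)
      fix y0 assume y0: "y0 \<in> V k"
      have y0Y: "y0 \<in> Y" by (rule VY [OF k y0])
      then obtain N where N: "openin (top_of_set Y) N" "y0 \<in> N"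
        "\<And>y. y \<in> N \<Longrightarrow> \<Phi> y (\<phi> y) k 1 = \<Phi> y0 (\<phi> y0) k 1"
        using LOC [OF y0Y] k y0 H1 [OF y0Y] by metis
      have NY: "N \<subseteq> Y" using openin_subset [OF N(1)] by simp
      have \<Phi>s: "\<Phi> y (\<phi> y) k 1 = s k y" if "y \<in> Y" for y
        using H1 [OF that] by (simp add: \<Phi>_def s_def)
      have eq: "s k y = s k y0" if "y \<in> N" for y
        using N(3) [OF that] \<Phi>s [OF y0Y] \<Phi>s [of y] NY that by auto
      show "\<exists>N. openin (top_of_set (V k)) N \<and> y0 \<in> N \<and> (\<forall>y\<in>N. s k y = s k y0)"
      proof (intro exI conjI ballI)
        show "openin (top_of_set (V k)) (V k \<inter> N)"
          using openin_subtopology_Int2 [OF N(1), of "V k"] openin_subset [OF V [OF k]]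
          by (simp add: subtopology_subtopology inf.absorb2)
        show "y0 \<in> V k \<inter> N" using y0 N(2) by blast
        show "s k y = s k y0" if "y \<in> V k \<inter> N" for y
          using eq that by blast
      qed
    qed
    fix k l x assume kl: "k \<in> I" "l \<in> I" and x: "x \<in> V k" "x \<in> V l"
    have vx: "v x \<in> I" "x \<in> V (v x)" using v [OF VY [OF kl(1) x(1)]] by auto
    show "s l x - s k x = c k l x"
      using coc [OF vx(1) kl vx(2) x] by (simp add: s_def algebra_simps)
  qed
qed

section \<open>Second cohomology of the sphere\<close>

lemma simplex_boundary_iff:
  "x \<in> simplex_boundary n \<longleftrightarrow> x \<in> standard_simplex n \<and> (\<exists>k\<le>n. x k = 0)"
  by (auto simp: simplex_boundary_def simplex_face_def)

lemma sphere_cover_iff: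
  "x \<in> sphere_cover m \<longleftrightarrow> x \<in> simplex_boundary 3 \<and> 0 < x m"
proof (cases "x \<in> simplex_boundary 3")
  case True
  then have "x \<in> standard_simplex 3" by (simp add: simplex_boundary_iff)
  moreover from this have "0 \<le> x m" by (simp add: standard_simplex_def)
  ultimately show ?thesis using True by (auto simp: sphere_cover_def simplex_face_def)
qed (simp add: sphere_cover_def)

lemma standard_simplex_3:
  "x \<in> standard_simplex 3 \<longleftrightarrow> (\<forall>i. 0 \<le> x i \<and> x i \<le> 1) \<and> (\<forall>i>3. x i = 0) \<and> x 0 + x 1 + x 2 + x 3 = 1"
  by (simp add: standard_simplex_def eval_nat_numeral)

lemma continuous_on_coordinate: "continuous_on S (\<lambda>x::nat \<Rightarrow> real. x i)"
  by (rule continuous_on_subset [OF continuous_on_product_coordinates]) simp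

lemma le_3_iff: "(m::nat) \<le> 3 \<longleftrightarrow> m = 0 \<or> m = 1 \<or> m = 2 \<or> m = 3"
  by auto

lemma atMost_3: "{..3::nat} = {0, 1, 2, 3}"
  by auto

lemma open_cover_sphere: "open_cover (top_of_set (simplex_boundary 3)) {..3} sphere_cover"
  unfolding open_cover_def
proof (intro conjI ballI)
  fix m
  have "openin (top_of_set (simplex_boundary 3)) (simplex_boundary 3 \<inter> (\<lambda>x. x m) -` {0<..})"
    by (rule continuous_openin_preimage_gen [OF continuous_on_coordinate]) simp
  moreover have "simplex_boundary 3 \<inter> (\<lambda>x. x m) -` {0<..} = sphere_cover m"
    by (auto simp: sphere_cover_iff)
  ultimately show "openin (top_of_set (simplex_boundary 3)) (sphere_cover m)" by simp
next
  have "\<exists>m\<in>{..3}. 0 < x m" if "x \<in> simplex_boundary 3" for x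
  proof (rule ccontr)
    assume "\<not> ?thesis"
    then have "x 0 \<le> 0" "x 1 \<le> 0" "x 2 \<le> 0" "x 3 \<le> 0" by (auto simp: not_less)
    then show False using that by (simp add: simplex_boundary_iff standard_simplex_3)
  qed
  then show "(\<Union>m\<in>{..3}. sphere_cover m) = topspace (top_of_set (simplex_boundary 3))"
    by (auto simp: sphere_cover_iff)
qed

section \<open>Segments in the stars and in their intersections\<close>

lemma simplex_boundary_segment:
  assumes "x \<in> standard_simplex n" "y \<in> standard_simplex n" "0 \<le> u" "u \<le> 1" "k \<le> n" "x k = 0" "y k = 0"
  shows "(\<lambda>i. (1 - u) * x i + u * y i) \<in> simplex_boundary n"
  using convex_standard_simplex [OF assms(1-4)] assms(5-7) by (auto simp: simplex_boundary_iff)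

lemma vertex_simplex: "m \<le> n \<Longrightarrow> vertex m \<in> standard_simplex n"
  by (simp add: vertex_def [abs_def])

lemma continuous_on_segment:
  "continuous_on S (\<lambda>tx. \<lambda>i. (1 - fst tx) * (z::nat \<Rightarrow> real) i + fst tx * snd tx i)"
  by (intro continuous_on_coordinatewise_then_product continuous_intros
      continuous_on_compose2 [OF continuous_on_coordinate continuous_on_snd [OF continuous_on_id]]) auto

text \<open>The set is star-shaped about the midpoint \<open>z\<close> of the vertices
  \<open>m\<close> and \<open>n\<close>: a face through one of its points is opposite to neither
  vertex, so it contains \<open>z\<close> and the whole segment.\<close>

lemma connected_sphere_cover_2:
  assumes "m \<le> 3" "n \<le> 3"
  shows "connected (sphere_cover m \<inter> sphere_cover n)"
proof -
  define z :: "nat \<Rightarrow> real" where "z i = (1 - 1/2) * vertex m i + 1/2 * vertex n i" for i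
  have z: "z \<in> standard_simplex 3"
    unfolding z_def [abs_def] by (rule convex_standard_simplex) (simp_all add: vertex_simplex assms)
  have zk: "z k = 0 \<longleftrightarrow> k \<noteq> m \<and> k \<noteq> n" for k
    by (auto simp: z_def vertex_def)
  have "0 \<le> z k" for k using z by (simp add: standard_simplex_def)
  then have zpos: "0 < z m" "0 < z n" using zk by (auto simp: less_le)
  let ?S = "sphere_cover m \<inter> sphere_cover n"
  have seg: "(\<lambda>i. (1 - t) * z i + t * x i) \<in> ?S" if x: "x \<in> ?S" and t: "t \<in> {0..1}" for x t
  proof -
    have "x \<in> sphere_cover m" "x \<in> sphere_cover n" using x by blast+
    then have xb: "x \<in> standard_simplex 3" "0 < x m" "0 < x n" and ex: "\<exists>k\<le>3. x k = 0"
      unfolding sphere_cover_iff simplex_boundary_iff by blast+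
    obtain k where k: "k \<le> 3" "x k = 0" using ex by blast
    have "k \<noteq> m" "k \<noteq> n" using k(2) xb(2,3) by auto
    then have "z k = 0" unfolding zk by blast
    then have "(\<lambda>i. (1 - t) * z i + t * x i) \<in> simplex_boundary 3"
      using t by (intro simplex_boundary_segment [OF z xb(1) _ _ k(1) _ k(2)]) auto
    moreover have "0 < (1 - t) * z l + t * x l" if "0 < z l" "0 < x l" for l
    proof (cases "t = 0")
      case False
      then have "0 < t * x l" "0 \<le> (1 - t) * z l" using t that by auto
      then show ?thesis by linarith
    qed (use that in simp)
    ultimately show ?thesis using xb zpos by (simp add: sphere_cover_iff)
  qed
  have "connected_component ?S z x" if x: "x \<in> ?S" for x
    unfolding connected_component_def
  proof (intro exI conjI)
    let ?T = "(\<lambda>tx i. (1 - fst tx) * z i + fst tx * snd tx i) ` ({0..1} \<times> {x})"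
    show "connected ?T"
      by (intro connected_continuous_image continuous_on_segment connected_Times) auto
    show "?T \<subseteq> ?S" using seg [OF x] by auto
    show "z \<in> ?T" by (rule image_eqI [of _ _ "(0, x)"]) auto
    show "x \<in> ?T" by (rule image_eqI [of _ _ "(1, x)"]) auto
  qed
  then show ?thesis
    unfolding connected_iff_connected_component
    by (meson connected_component_sym connected_component_trans)
qed

text \<open>Straight contraction to the vertex \<open>m\<close>, in the form that
  \<open>discrete_cocycle_trivial\<close> takes. It stays on the sphere, because a face through a
  point with \<open>0 < x m\<close> contains that vertex.\<close>

lemma sphere_cover_contraction:
  assumes m: "m \<le> 3"
  defines "H \<equiv> \<lambda>tx i. (1 - fst tx) * vertex m i + fst tx * snd tx i"
  shows "continuous_on ({0..1} \<times> sphere_cover m) H"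
    and "\<And>t x. t \<in> {0..1} \<Longrightarrow> x \<in> sphere_cover m \<Longrightarrow> H (t, x) \<in> sphere_cover m"
    and "\<And>x. H (0, x) = vertex m" and "\<And>x. H (1, x) = x"
proof -
  show "continuous_on ({0..1} \<times> sphere_cover m) H"
    unfolding H_def by (rule continuous_on_segment)
  show "H (0, x) = vertex m" "H (1, x) = x" for x by (simp_all add: H_def)
  fix t x assume t: "t \<in> {0..1::real}" and x: "x \<in> sphere_cover m"
  have xb: "x \<in> standard_simplex 3" "0 < x m" and "\<exists>k\<le>3. x k = 0"
    using x by (auto simp: sphere_cover_iff simplex_boundary_iff)
  then obtain k where k: "k \<le> 3" "x k = 0" by blast
  then have "vertex m k = 0" using xb by (auto simp: vertex_def)
  then have "(\<lambda>i. (1 - t) * vertex m i + t * x i) \<in> simplex_boundary 3"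
    using t by (intro simplex_boundary_segment [OF vertex_simplex [OF m] xb(1) _ _ k(1) _ k(2)]) auto
  moreover have "0 < (1 - t) * vertex m m + t * x m"
  proof (cases "t = 0")
    case False
    then have "0 < t * x m" using t xb by auto
    then show ?thesis using t by (simp add: vertex_def)
  qed (simp add: vertex_def)
  ultimately show "H (t, x) \<in> sphere_cover m" by (simp add: H_def sphere_cover_iff)
qed

lemma cech_cocycle_2D:
  assumes "cech_cocycle X 2 I U g" "i \<in> I" "j \<in> I" "k \<in> I" "l \<in> I" "x \<in> U i" "x \<in> U j" "x \<in> U k" "x \<in> U l"
  shows "g [j, k, l] x - g [i, k, l] x + g [i, j, l] x - g [i, j, k] x = 0"
  using assms unfolding cech_cocycle_2 by simp

lemma cech_cocycle_2_continuous:
  assumes "cech_cocycle X 2 I U g" "i \<in> I" "j \<in> I" "k \<in> I"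
  shows "continuous_map (subtopology X (U i \<inter> U j \<inter> U k)) euclidean (g [i, j, k])"
  using assms unfolding cech_cocycle_2 cech_cochain_2 by simp

text \<open>Leray's argument: the open stars have trivial first cohomology and connected double
  intersections, so a coboundary on a refinement is the coboundary of a cochain of constants \<open>\<tau> m n\<close>
  on the cover by stars.\<close>

lemma sphere_cover_leray:
  fixes a :: "nat list \<Rightarrow> (nat \<Rightarrow> real) \<Rightarrow> 'g::{topological_ab_group_add,discrete_topology}"
  assumes a: "cech_cocycle (top_of_set (simplex_boundary 3)) 2 {..3} sphere_cover a"
    and \<V>: "open_cover (top_of_set (simplex_boundary 3)) \<V> id"
    and r: "\<And>N. N \<in> \<V> \<Longrightarrow> r N \<in> {..3} \<and> N \<subseteq> sphere_cover (r N)"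
    and \<kappa>: "\<And>M N. M \<in> \<V> \<Longrightarrow> N \<in> \<V> \<Longrightarrow> continuous_on (M \<inter> N) (\<kappa> M N)"
    and a\<kappa>: "\<And>L M N x. L \<in> \<V> \<Longrightarrow> M \<in> \<V> \<Longrightarrow> N \<in> \<V> \<Longrightarrow> x \<in> L \<Longrightarrow> x \<in> M \<Longrightarrow> x \<in> N \<Longrightarrow>
      a [r L, r M, r N] x = \<kappa> M N x - \<kappa> L N x + \<kappa> L M x"
  obtains \<tau> where "\<And>m n l x. m \<le> 3 \<Longrightarrow> n \<le> 3 \<Longrightarrow> l \<le> 3 \<Longrightarrow> x \<in> sphere_cover m \<Longrightarrow> x \<in> sphere_cover n \<Longrightarrow>
      x \<in> sphere_cover l \<Longrightarrow> a [m, n, l] x = \<tau> n l - \<tau> m l + \<tau> m n"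
proof -
  let ?S = "simplex_boundary 3"
  let ?\<Lambda> = sphere_cover
  have \<Lambda>S: "?\<Lambda> m \<subseteq> ?S" for m by (auto simp: sphere_cover_def)
  have oN: "openin (top_of_set ?S) N" if "N \<in> \<V>" for N using \<V> that by (simp add: open_cover_def)
  have co: "a [j, k, l] x - a [i, k, l] x + a [i, j, l] x - a [i, j, k] x = 0"
    if "i \<le> 3" "j \<le> 3" "k \<le> 3" "l \<le> 3" "x \<in> ?\<Lambda> i" "x \<in> ?\<Lambda> j" "x \<in> ?\<Lambda> k" "x \<in> ?\<Lambda> l" for i j k l x
    using that by (intro cech_cocycle_2D [OF a]) auto
  have ca: "continuous_on (?\<Lambda> i \<inter> ?\<Lambda> j \<inter> ?\<Lambda> k) (a [i, j, k])" if "i \<le> 3" "j \<le> 3" "k \<le> 3" for i j k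
  proof -
    have "?S \<inter> (?\<Lambda> i \<inter> ?\<Lambda> j \<inter> ?\<Lambda> k) = ?\<Lambda> i \<inter> ?\<Lambda> j \<inter> ?\<Lambda> k" using \<Lambda>S by blast
    then show ?thesis
      using cech_cocycle_2_continuous [OF a, of i j k] that by (simp add: subtopology_subtopology)
  qed
  have r3: "r N \<le> 3" and r\<Lambda>: "\<And>x. x \<in> N \<Longrightarrow> x \<in> ?\<Lambda> (r N)" if "N \<in> \<V>" for N using r [OF that] by auto
  \<comment> \<open>With \<open>m\<close> as an extra index, the cocycle identity of
    \<open>a\<close> shows that subtracting \<open>a [m, r M, r N]\<close> turns
    \<open>\<kappa>\<close> into a 1-cocycle on the star of \<open>m\<close>. It has a primitive
    \<open>\<sigma> m\<close> because the star is contractible.\<close>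
  define c where "c m M N x = \<kappa> M N x - a [m, r M, r N] x" for m M N x
  have "\<exists>s. (\<forall>N\<in>\<V>. continuous_on (N \<inter> ?\<Lambda> m) (s N)) \<and>
      (\<forall>M\<in>\<V>. \<forall>N\<in>\<V>. \<forall>x. x \<in> M \<inter> ?\<Lambda> m \<longrightarrow> x \<in> N \<inter> ?\<Lambda> m \<longrightarrow> s N x - s M x = c m M N x)"
    if m: "m \<le> 3" for m
  proof -
    obtain s where "\<And>N. N \<in> \<V> \<Longrightarrow> continuous_on (N \<inter> ?\<Lambda> m) (s N)"
      "\<And>M N x. M \<in> \<V> \<Longrightarrow> N \<in> \<V> \<Longrightarrow> x \<in> M \<inter> ?\<Lambda> m \<Longrightarrow> x \<in> N \<inter> ?\<Lambda> m \<Longrightarrow> s N x - s M x = c m M N x"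
    proof (rule discrete_cocycle_trivial [OF sphere_cover_contraction [OF m], where V = "\<lambda>N. N \<inter> ?\<Lambda> m" and I = \<V> and c = "c m"])
      show "openin (top_of_set (?\<Lambda> m)) (N \<inter> ?\<Lambda> m)" if "N \<in> \<V>" for N
        using openin_subtopology_Int [OF oN [OF that], of "?\<Lambda> m"] \<Lambda>S [of m]
        by (simp add: subtopology_subtopology inf.absorb2)
      show "?\<Lambda> m \<subseteq> (\<Union>N\<in>\<V>. N \<inter> ?\<Lambda> m)"
        using \<V> \<Lambda>S [of m] by (auto simp: open_cover_def)
      show "continuous_on ((M \<inter> ?\<Lambda> m) \<inter> (N \<inter> ?\<Lambda> m)) (c m M N)" if MN: "M \<in> \<V>" "N \<in> \<V>" for M N
        unfolding c_def
      proof (intro continuous_on_diff)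
        show "continuous_on ((M \<inter> ?\<Lambda> m) \<inter> (N \<inter> ?\<Lambda> m)) (\<kappa> M N)"
          by (rule continuous_on_subset [OF \<kappa> [OF MN]]) blast
        show "continuous_on ((M \<inter> ?\<Lambda> m) \<inter> (N \<inter> ?\<Lambda> m)) (a [m, r M, r N])"
          by (rule continuous_on_subset [OF ca [OF m r3 [OF MN(1)] r3 [OF MN(2)]]])
            (use r\<Lambda> [OF MN(1)] r\<Lambda> [OF MN(2)] in blast)
      qed
      show "c m L M x + c m M N x = c m L N x"
        if LMN: "L \<in> \<V>" "M \<in> \<V>" "N \<in> \<V>" and x: "x \<in> L \<inter> ?\<Lambda> m" "x \<in> M \<inter> ?\<Lambda> m" "x \<in> N \<inter> ?\<Lambda> m" for L M N x
      proof -
        have x': "x \<in> L" "x \<in> M" "x \<in> N" "x \<in> ?\<Lambda> m" using x by auto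
        have "a [r L, r M, r N] x - a [m, r M, r N] x + a [m, r L, r N] x - a [m, r L, r M] x = 0"
          by (rule co [OF m r3 [OF LMN(1)] r3 [OF LMN(2)] r3 [OF LMN(3)] x'(4) r\<Lambda> [OF LMN(1) x'(1)]
                r\<Lambda> [OF LMN(2) x'(2)] r\<Lambda> [OF LMN(3) x'(3)]])
        then show ?thesis
          using a\<kappa> [OF LMN x'(1-3)] by (simp add: c_def algebra_simps)
      qed
    qed (rule that | assumption)+
    then show ?thesis by (intro exI [of _ s]) simp
  qed
  then obtain \<sigma> where \<sigma>: "\<And>m. m \<le> 3 \<Longrightarrow> (\<forall>N\<in>\<V>. continuous_on (N \<inter> ?\<Lambda> m) (\<sigma> m N)) \<and>
      (\<forall>M\<in>\<V>. \<forall>N\<in>\<V>. \<forall>x. x \<in> M \<inter> ?\<Lambda> m \<longrightarrow> x \<in> N \<inter> ?\<Lambda> m \<longrightarrow> \<sigma> m N x - \<sigma> m M x = c m M N x)"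
    by metis
  \<comment> \<open>The primitives of two stars differ by \<open>- a [m, n, r N]\<close> up to a
    function that is independent of \<open>N\<close>. That function is locally constant on a
    connected set, and its value is \<open>\<tau> m n\<close>.\<close>
  define T where "T m n N x = \<sigma> m N x - \<sigma> n N x + a [m, n, r N] x" for m n N x
  have T_eq: "T m n M x = T m n N x"
    if mn: "m \<le> 3" "n \<le> 3" and MN: "M \<in> \<V>" "N \<in> \<V>" and x: "x \<in> M" "x \<in> N" "x \<in> ?\<Lambda> m" "x \<in> ?\<Lambda> n" for m n M N x
  proof -
    have "\<sigma> m N x - \<sigma> m M x = c m M N x" "\<sigma> n N x - \<sigma> n M x = c n M N x"
      using \<sigma> [OF mn(1)] \<sigma> [OF mn(2)] MN x by blast+
    then have 1: "\<sigma> m N x = c m M N x + \<sigma> m M x" "\<sigma> n N x = c n M N x + \<sigma> n M x"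
      by (simp_all add: diff_eq_eq)
    have "a [n, r M, r N] x - a [m, r M, r N] x + a [m, n, r N] x - a [m, n, r M] x = 0"
      by (rule co [OF mn r3 [OF MN(1)] r3 [OF MN(2)] x(3,4) r\<Lambda> [OF MN(1) x(1)] r\<Lambda> [OF MN(2) x(2)]])
    then have 2: "a [m, n, r N] x = a [m, n, r M] x - a [n, r M, r N] x + a [m, r M, r N] x"
      by (simp add: algebra_simps)
    show ?thesis unfolding T_def 1 2 c_def by simp
  qed
  have "\<forall>x\<in>?S. \<exists>N\<in>\<V>. x \<in> N" using \<V> by (auto simp: open_cover_def)
  then obtain w where w: "\<And>x. x \<in> ?S \<Longrightarrow> w x \<in> \<V> \<and> x \<in> w x" by metis
  have w\<Lambda>: "w x \<in> \<V>" "x \<in> w x" if "x \<in> ?\<Lambda> m" for x m using w \<Lambda>S that by blast+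
  have cT: "continuous_on (?\<Lambda> m \<inter> ?\<Lambda> n) (\<lambda>x. T m n (w x) x)" if mn: "m \<le> 3" "n \<le> 3" for m n
  proof (rule continuous_on_locally_constant)
    fix x0 assume x0: "x0 \<in> ?\<Lambda> m \<inter> ?\<Lambda> n"
    define N where "N = w x0"
    have N: "N \<in> \<V>" "x0 \<in> N" using w\<Lambda> x0 by (auto simp: N_def)
    let ?D = "?\<Lambda> m \<inter> ?\<Lambda> n"
    have "continuous_on (N \<inter> ?D) (T m n N)"
      unfolding T_def
    proof (intro continuous_on_add continuous_on_diff)
      show "continuous_on (N \<inter> ?D) (\<sigma> m N)" "continuous_on (N \<inter> ?D) (\<sigma> n N)"
        using \<sigma> [OF mn(1)] \<sigma> [OF mn(2)] N(1) by (auto intro: continuous_on_subset)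
      show "continuous_on (N \<inter> ?D) (a [m, n, r N])"
        by (rule continuous_on_subset [OF ca [OF mn r3 [OF N(1)]]]) (use r\<Lambda> [OF N(1)] in blast)
    qed
    moreover have "openin (top_of_set ?D) (N \<inter> ?D)"
    proof -
      have "?S \<inter> ?D = ?D" using \<Lambda>S by blast
      then show ?thesis
        using openin_subtopology_Int [OF oN [OF N(1)], of ?D] by (simp add: subtopology_subtopology)
    qed
    ultimately have "openin (top_of_set ?D) {x \<in> N \<inter> ?D. T m n N x = T m n N x0}"
      by (rule openin_level_set)
    moreover have "T m n (w x) x = T m n (w x0) x0" if "x \<in> {x \<in> N \<inter> ?D. T m n N x = T m n N x0}" for x
    proof -
      have x: "x \<in> N" "x \<in> ?\<Lambda> m" "x \<in> ?\<Lambda> n" "T m n N x = T m n N x0" using that by auto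
      have "T m n (w x) x = T m n N x"
        using w\<Lambda> [OF x(2)] by (intro T_eq [OF mn _ N(1) _ x(1-3)])
      then show ?thesis using x(4) by (simp add: N_def)
    qed
    ultimately show "\<exists>M. openin (top_of_set ?D) M \<and> x0 \<in> M \<and> (\<forall>x\<in>M. T m n (w x) x = T m n (w x0) x0)"
      using x0 N(2) by (intro exI [of _ "{x \<in> N \<inter> ?D. T m n N x = T m n N x0}"] conjI ballI) blast+
  qed
  define \<tau> where "\<tau> m n = (let x = (SOME x. x \<in> ?\<Lambda> m \<inter> ?\<Lambda> n) in T m n (w x) x)" for m n
  have \<tau>: "T m n (w x) x = \<tau> m n" if mn: "m \<le> 3" "n \<le> 3" and x: "x \<in> ?\<Lambda> m" "x \<in> ?\<Lambda> n" for m n x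
  proof -
    have "(SOME x. x \<in> ?\<Lambda> m \<inter> ?\<Lambda> n) \<in> ?\<Lambda> m \<inter> ?\<Lambda> n" by (rule someI [of _ x]) (use x in blast)
    moreover have "x \<in> ?\<Lambda> m \<inter> ?\<Lambda> n" using x by blast
    ultimately show ?thesis
      unfolding \<tau>_def Let_def
      using continuous_on_discrete_constant [OF connected_sphere_cover_2 [OF mn] cT [OF mn]] by blast
  qed
  show thesis
  proof (rule that)
    fix m n l x assume mnl: "m \<le> 3" "n \<le> 3" "l \<le> 3" and x: "x \<in> ?\<Lambda> m" "x \<in> ?\<Lambda> n" "x \<in> ?\<Lambda> l"
    define N where "N = w x"
    have N: "N \<in> \<V>" "x \<in> N" using w\<Lambda> [OF x(1)] by (auto simp: N_def)
    have "a [n, l, r N] x - a [m, l, r N] x + a [m, n, r N] x - a [m, n, l] x = 0"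
      by (rule co [OF mnl r3 [OF N(1)] x r\<Lambda> [OF N]])
    then have 1: "a [m, n, l] x = a [n, l, r N] x - a [m, l, r N] x + a [m, n, r N] x"
      by (simp add: algebra_simps)
    have 2: "\<tau> n l = T n l N x" "\<tau> m l = T m l N x" "\<tau> m n = T m n N x"
      using \<tau> [OF mnl(2,3) x(2,3)] \<tau> [OF mnl(1,3) x(1,3)] \<tau> [OF mnl(1,2) x(1,2)] by (simp_all add: N_def)
    show "a [m, n, l] x = \<tau> n l - \<tau> m l + \<tau> m n"
      unfolding 1 2 T_def by simp
  qed
qed

text \<open>The witness is the barycentre of the face opposite to \<open>j\<close>. Triple
  intersections are thus nonempty, so a cochain determines its values
  \<open>\<gamma> j\<close>.\<close>

lemma sphere_face_barycentre:
  assumes "j \<le> 3"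
  shows "\<exists>x. \<forall>k\<le>3. k \<noteq> j \<longrightarrow> x \<in> sphere_cover k"
proof -
  define x :: "nat \<Rightarrow> real" where "x i = (if i \<le> 3 \<and> i \<noteq> j then 1/3 else 0)" for i
  have "x \<in> standard_simplex 3"
    using assms unfolding standard_simplex_3 le_3_iff by (auto simp: x_def)
  then have "x \<in> simplex_boundary 3" using assms by (auto simp: simplex_boundary_iff x_def)
  then show ?thesis by (intro exI [of _ x]) (simp add: sphere_cover_iff x_def)
qed

lemma removeAll_upt_4:
  "removeAll 0 [0..<4] = [1, 2, 3::nat]" "removeAll 1 [0..<4] = [0, 2, 3::nat]"
  "removeAll 2 [0..<4] = [0, 1, 3::nat]" "removeAll 3 [0..<4] = [0, 1, 2::nat]"
  by (simp_all add: upt_rec numeral_eq_Suc)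

text \<open>The alternating sum over the four faces kills the coboundary of a cochain of constants,
  since each edge lies in two faces and enters with opposite signs. The work lies in showing that
  \<open>g - h\<close> is such a coboundary on the stars themselves, whereas the hypothesis compares
  pullbacks to a refinement along two different maps.\<close>

lemma S2_unique:
  fixes g h :: "nat list \<Rightarrow> (nat \<Rightarrow> real) \<Rightarrow> 'g::{topological_ab_group_add,discrete_topology}"
  assumes g: "cech_cocycle (top_of_set (simplex_boundary 3)) 2 {..3} sphere_cover g"
    and h: "cech_cocycle (top_of_set (simplex_boundary 3)) 2 {..3} sphere_cover h"
    and gh: "cech_cohomologous (top_of_set (simplex_boundary 3)) 2 {..3} sphere_cover g {..3} sphere_cover h"
    and \<gamma>: "\<forall>j\<le>3. \<forall>x\<in>cover_inter sphere_cover (removeAll j [0..<4]). g (removeAll j [0..<4]) x = \<gamma> j"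
    and \<delta>: "\<forall>j\<le>3. \<forall>x\<in>cover_inter sphere_cover (removeAll j [0..<4]). h (removeAll j [0..<4]) x = \<delta> j"
  shows "(\<Sum>j\<le>3. if even j then \<gamma> j else - \<gamma> j) = (\<Sum>j\<le>3. if even j then \<delta> j else - \<delta> j)"
proof -
  let ?X = "top_of_set (simplex_boundary 3)"
  obtain \<V> r s k where \<V>: "open_cover ?X \<V> id"
    and rs: "\<And>N. N \<in> \<V> \<Longrightarrow> r N \<in> {..3} \<and> N \<subseteq> sphere_cover (r N) \<and> s N \<in> {..3} \<and> N \<subseteq> sphere_cover (s N)"
    and k: "\<And>M N. M \<in> \<V> \<Longrightarrow> N \<in> \<V> \<Longrightarrow> continuous_map (subtopology ?X (M \<inter> N)) euclidean (k M N)"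
    and ghk: "\<And>L M N x. L \<in> \<V> \<Longrightarrow> M \<in> \<V> \<Longrightarrow> N \<in> \<V> \<Longrightarrow> x \<in> L \<Longrightarrow> x \<in> M \<Longrightarrow> x \<in> N \<Longrightarrow>
      g [r L, r M, r N] x - h [s L, s M, s N] x = k M N x - k L N x + k L M x"
    by (rule cech_cohomologous_2E [OF gh]) (rule that)
  \<comment> \<open>The prism for \<open>h\<close> replaces \<open>s\<close> by \<open>r\<close>, so
    that \<open>g - h\<close> is pulled back along a single map, as
    \<open>sphere_cover_leray\<close> requires.\<close>
  obtain l where l: "cech_cochain ?X (2 - 1) \<V> id l"
    "\<And>is x. set is \<subseteq> \<V> \<Longrightarrow> length is = Suc 2 \<Longrightarrow> x \<in> cover_inter id is \<Longrightarrow>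
      h (map r is) x - h (map s is) x = cech_coboundary l is x"
    by (rule cech_cocycle_prism [OF h, of \<V> r s]) (use rs in auto)
  have hl: "h [r L, r M, r N] x - h [s L, s M, s N] x = l [M, N] x - l [L, N] x + l [L, M] x"
    if "L \<in> \<V>" "M \<in> \<V>" "N \<in> \<V>" "x \<in> L" "x \<in> M" "x \<in> N" for L M N x
    using l(2) [of "[L, M, N]" x] that by (simp add: cech_coboundary_simps)
  define a where "a is x = g is x - h is x" for "is" x
  define \<kappa> where "\<kappa> M N x = k M N x - l [M, N] x" for M N x
  have a: "cech_cocycle ?X 2 {..3} sphere_cover a"
    using g h unfolding cech_cocycle_def a_def [abs_def] cech_coboundary_diff cech_cochain_def
    by (auto intro!: continuous_map_group_diff)
  obtain \<tau> where \<tau>: "\<And>m n l x. m \<le> 3 \<Longrightarrow> n \<le> 3 \<Longrightarrow> l \<le> 3 \<Longrightarrow> x \<in> sphere_cover m \<Longrightarrow> x \<in> sphere_cover n \<Longrightarrow>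
      x \<in> sphere_cover l \<Longrightarrow> a [m, n, l] x = \<tau> n l - \<tau> m l + \<tau> m n"
  proof (rule sphere_cover_leray [OF a \<V>, of r \<kappa>])
    show "r N \<in> {..3} \<and> N \<subseteq> sphere_cover (r N)" if "N \<in> \<V>" for N using rs [OF that] by blast
    show "continuous_on (M \<inter> N) (\<kappa> M N)" if MN: "M \<in> \<V>" "N \<in> \<V>" for M N
    proof -
      have "simplex_boundary 3 \<inter> (M \<inter> N) = M \<inter> N"
        using rs [OF MN(1)] by (auto simp: sphere_cover_def)
      moreover have "continuous_map (subtopology ?X (M \<inter> N)) euclidean (l [M, N])"
        using l(1) MN by (simp add: cech_cochain_1)
      ultimately show ?thesis
        using k [OF MN] unfolding \<kappa>_def
        by (auto intro!: continuous_on_diff simp: subtopology_subtopology)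
    qed
    show "a [r L, r M, r N] x = \<kappa> M N x - \<kappa> L N x + \<kappa> L M x"
      if "L \<in> \<V>" "M \<in> \<V>" "N \<in> \<V>" "x \<in> L" "x \<in> M" "x \<in> N" for L M N x
    proof -
      have "a [r L, r M, r N] x = (g [r L, r M, r N] x - h [s L, s M, s N] x) -
          (h [r L, r M, r N] x - h [s L, s M, s N] x)" by (simp add: a_def)
      then show ?thesis unfolding ghk [OF that] hl [OF that] \<kappa>_def by (simp add: algebra_simps)
    qed
  qed (rule that)
  have \<gamma>\<delta>: "\<gamma> j - \<delta> j = \<tau> n l - \<tau> m l + \<tau> m n"
    if j: "j \<le> 3" and mnl: "removeAll j [0..<4] = [m, n, l]" for j m n l
  proof -
    obtain x where x: "\<And>k. k \<le> 3 \<Longrightarrow> k \<noteq> j \<Longrightarrow> x \<in> sphere_cover k"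
      using sphere_face_barycentre [OF j] by blast
    have set: "k \<le> 3 \<and> k \<noteq> j" if "k \<in> set [m, n, l]" for k
      using that unfolding mnl [symmetric] by auto
    have le: "m \<le> 3" "n \<le> 3" "l \<le> 3" using set by simp_all
    have xs: "x \<in> sphere_cover m" "x \<in> sphere_cover n" "x \<in> sphere_cover l"
      by (rule x; use set in simp)+
    then have "x \<in> cover_inter sphere_cover (removeAll j [0..<4])" unfolding mnl by simp
    then have "g (removeAll j [0..<4]) x = \<gamma> j" "h (removeAll j [0..<4]) x = \<delta> j"
      using \<gamma> \<delta> j by blast+
    then have "g [m, n, l] x = \<gamma> j" "h [m, n, l] x = \<delta> j"
      unfolding mnl .
    then show ?thesis using \<tau> [OF le xs] by (simp add: a_def)
  qed
  have "\<gamma> 0 - \<delta> 0 = \<tau> 2 3 - \<tau> 1 3 + \<tau> 1 2" "\<gamma> 1 - \<delta> 1 = \<tau> 2 3 - \<tau> 0 3 + \<tau> 0 2"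
    "\<gamma> 2 - \<delta> 2 = \<tau> 1 3 - \<tau> 0 3 + \<tau> 0 1" "\<gamma> 3 - \<delta> 3 = \<tau> 1 2 - \<tau> 0 2 + \<tau> 0 1"
    by (rule \<gamma>\<delta> [OF _ removeAll_upt_4(1)] \<gamma>\<delta> [OF _ removeAll_upt_4(2)]
        \<gamma>\<delta> [OF _ removeAll_upt_4(3)] \<gamma>\<delta> [OF _ removeAll_upt_4(4)]; simp)+
  then have "(\<gamma> 0 - \<delta> 0) - (\<gamma> 1 - \<delta> 1) + (\<gamma> 2 - \<delta> 2) - (\<gamma> 3 - \<delta> 3) = 0"
    by (simp only:) (simp add: algebra_simps)
  then show ?thesis by (simp add: atMost_3 algebra_simps)
qed

lemma S2_eq:
  fixes g :: "nat list \<Rightarrow> (nat \<Rightarrow> real) \<Rightarrow> 'g::{topological_ab_group_add,discrete_topology}"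
  assumes g: "cech_cocycle (top_of_set (simplex_boundary 3)) 2 {..3} sphere_cover g"
    and anti: "totally_antisymmetric g"
    and \<gamma>: "\<forall>j\<le>3. \<forall>x\<in>cover_inter sphere_cover (removeAll j [0..<4]). g (removeAll j [0..<4]) x = \<gamma> j"
  shows "S2 (cech_class (top_of_set (simplex_boundary 3)) 2 {..3} sphere_cover g) =
    (\<Sum>j\<le>3. if even j then \<gamma> j else - \<gamma> j)"
  unfolding S2_def
proof (rule the_equality)
  let ?X = "top_of_set (simplex_boundary 3)"
  show "\<exists>h \<delta>. cech_cocycle ?X 2 {..3} sphere_cover h \<and> totally_antisymmetric h \<and>
      (\<forall>j\<le>3. \<forall>x\<in>cover_inter sphere_cover (removeAll j [0..<4]). h (removeAll j [0..<4]) x = \<delta> j) \<and>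
      cech_class ?X 2 {..3} sphere_cover g = cech_class ?X 2 {..3} sphere_cover h \<and>
      (\<Sum>j\<le>3. if even j then \<gamma> j else - \<gamma> j) = (\<Sum>j\<le>3. if even j then \<delta> j else - \<delta> j)"
    by (rule exI [of _ g], rule exI [of _ \<gamma>]) (intro conjI g anti \<gamma> refl)
  fix t
  assume "\<exists>h \<delta>. cech_cocycle ?X 2 {..3} sphere_cover h \<and> totally_antisymmetric h \<and>
      (\<forall>j\<le>3. \<forall>x\<in>cover_inter sphere_cover (removeAll j [0..<4]). h (removeAll j [0..<4]) x = \<delta> j) \<and>
      cech_class ?X 2 {..3} sphere_cover g = cech_class ?X 2 {..3} sphere_cover h \<and>
      t = (\<Sum>j\<le>3. if even j then \<delta> j else - \<delta> j)"
  then obtain h \<delta> where h: "cech_cocycle ?X 2 {..3} sphere_cover h"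
      and \<delta>: "\<forall>j\<le>3. \<forall>x\<in>cover_inter sphere_cover (removeAll j [0..<4]). h (removeAll j [0..<4]) x = \<delta> j"
      and eq: "cech_class ?X 2 {..3} sphere_cover g = cech_class ?X 2 {..3} sphere_cover h"
      and t: "t = (\<Sum>j\<le>3. if even j then \<delta> j else - \<delta> j)"
    by (elim exE conjE) (rule that)
  have "cech_cohomologous ?X 2 {..3} sphere_cover g {..3} sphere_cover h"
    by (rule cech_class_eq_imp_cohomologous [OF eq g]) simp
  from S2_unique [OF g h this \<gamma> \<delta>] show "t = (\<Sum>j\<le>3. if even j then \<gamma> j else - \<gamma> j)"
    unfolding t by (rule sym)
qed

section \<open>Maps on the boundaries of simplices\<close>

lemma compact_standard_simplex: "compact (standard_simplex n)"
  using compactin_standard_simplex [of n] by (simp add: euclidean_product_topology)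

lemma closed_coordinate_eq: "closed {x::nat \<Rightarrow> real. x k = c}"
  by (rule closed_Collect_eq) (auto intro: continuous_on_coordinate)

lemma compact_simplex_boundary: "compact (simplex_boundary n)"
proof -
  have "simplex_boundary n = (\<Union>k\<le>n. standard_simplex n \<inter> {x. x k = 0})"
    by (auto simp: simplex_boundary_def simplex_face_def)
  moreover have "compact (\<Union>k\<le>n. standard_simplex n \<inter> {x. x k = 0})"
    by (intro compact_UN compact_Int_closed compact_standard_simplex closed_coordinate_eq) simp
  ultimately show ?thesis by metis
qed

lemma standard_simplex_2:
  "x \<in> standard_simplex 2 \<longleftrightarrow> (\<forall>i. 0 \<le> x i \<and> x i \<le> 1) \<and> (\<forall>i>2. x i = 0) \<and> x 0 + x 1 + x 2 = 1"
  by (simp add: standard_simplex_def eval_nat_numeral)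

lemma le_2_iff: "(m::nat) \<le> 2 \<longleftrightarrow> m = 0 \<or> m = 1 \<or> m = 2"
  and less_3_iff: "(m::nat) < 3 \<longleftrightarrow> m = 0 \<or> m = 1 \<or> m = 2"
  by auto

lemma simplex_boundary_2_subset: "simplex_boundary 2 \<subseteq> standard_simplex 2"
  by (auto simp: simplex_boundary_iff)

lemma simplex_boundary_2_face:
  assumes "x \<in> simplex_boundary 2"
  shows "\<exists>k<3. x \<in> simplex_face 3 k"
proof -
  obtain k where "k \<le> 2" "x k = 0" "x \<in> standard_simplex 2"
    using assms unfolding simplex_boundary_iff by blast
  moreover have "standard_simplex 2 \<subseteq> standard_simplex 3" by (rule standard_simplex_mono) simp
  ultimately show ?thesis by (intro exI [of _ k]) (auto simp: simplex_face_def)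
qed

section \<open>The base point, and deforming sphere maps to vanish on three faces\<close>

lemma vertex_0_boundary: "0 < n \<Longrightarrow> vertex 0 \<in> simplex_boundary n"
  unfolding simplex_boundary_iff by (intro conjI vertex_simplex exI [of _ 1]) (auto simp: vertex_def)

text \<open>The point moves in the direction \<open>(-1, -1, -1, 3)\<close>, which keeps the
  coordinate sum, until one of the first three coordinates vanishes. On the sphere this is a
  retraction onto the union of the three faces at \<open>e_3\<close>.\<close>

definition sphere_retraction :: "(nat \<Rightarrow> real) \<Rightarrow> nat \<Rightarrow> real" where
  "sphere_retraction x i =
     (let m = min (x 0) (min (x 1) (x 2)) in
      if i < 3 then x i - m else if i = 3 then x 3 + 3 * m else 0)"

lemma sphere_retraction_simplex:
  assumes "x \<in> simplex_boundary 3"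
  shows "sphere_retraction x \<in> standard_simplex 3" "\<exists>k<3. sphere_retraction x k = 0"
proof -
  define m where "m = min (x 0) (min (x 1) (x 2))"
  have x: "\<And>i. 0 \<le> x i" "x 0 + x 1 + x 2 + x 3 = 1"
    using assms by (auto simp: simplex_boundary_iff standard_simplex_3)
  have m: "0 \<le> m" "m \<le> x 0" "m \<le> x 1" "m \<le> x 2" using x(1) by (auto simp: m_def)
  have r: "sphere_retraction x i = (if i < 3 then x i - m else if i = 3 then x 3 + 3 * m else 0)" for i
    by (simp add: sphere_retraction_def m_def Let_def)
  have mi: "m \<le> x i" if "i < 3" for i using that m by (auto simp: less_3_iff)
  have nonneg: "0 \<le> sphere_retraction x i" for i using mi [of i] m(1) x(1) by (auto simp: r)
  have sum: "sphere_retraction x 0 + sphere_retraction x 1 + sphere_retraction x 2 + sphere_retraction x 3 = 1"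
    using x(2) by (simp add: r)
  have "sphere_retraction x i \<le> 1" for i
  proof (cases "i \<le> 3")
    case True
    then show ?thesis using sum nonneg [of 0] nonneg [of 1] nonneg [of 2] nonneg [of 3]
      unfolding le_3_iff by (elim disjE) simp_all
  qed (simp add: r)
  then show "sphere_retraction x \<in> standard_simplex 3"
    unfolding standard_simplex_3 using nonneg sum by (simp add: r)
  have "m = x 0 \<or> m = x 1 \<or> m = x 2" by (auto simp: m_def min_def)
  then show "\<exists>k<3. sphere_retraction x k = 0"
  proof (elim disjE)
    assume "m = x 0" then show ?thesis by (intro exI [of _ 0]) (simp add: r)
  next
    assume "m = x 1" then show ?thesis by (intro exI [of _ 1]) (simp add: r)
  next
    assume "m = x 2" then show ?thesis by (intro exI [of _ 2]) (simp add: r)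
  qed
qed

lemma sphere_retraction_fixed:
  assumes "x \<in> simplex_boundary 3" "k < 3" "x k = 0"
  shows "sphere_retraction x = x"
proof -
  have "x \<in> standard_simplex 3" using assms(1) by (simp add: simplex_boundary_iff)
  then have x: "0 \<le> x 0" "0 \<le> x 1" "0 \<le> x 2" "\<And>i. i > 3 \<Longrightarrow> x i = 0" by (auto simp: standard_simplex_3)
  then have "min (x 0) (min (x 1) (x 2)) = 0"
    using assms(2,3) by (auto simp: less_3_iff)
  then show ?thesis using x(4) by (auto simp: sphere_retraction_def fun_eq_iff)
qed

lemma continuous_on_sphere_retraction: "continuous_on S sphere_retraction"
proof (rule continuous_on_coordinatewise_then_product)
  fix i
  have "continuous_on S (\<lambda>x. if i < 3 then x i - min (x 0) (min (x 1) (x 2))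
      else if i = 3 then x 3 + 3 * min (x 0) (min (x 1) (x 2)) else 0)"
    by (cases "i < 3"; cases "i = 3") (auto intro!: continuous_intros continuous_on_coordinate)
  then show "continuous_on S (\<lambda>x. sphere_retraction x i)"
    unfolding sphere_retraction_def Let_def .
qed

text \<open>The group structure does the work of homotopy extension. From \<open>\<phi>\<close> one
  subtracts \<open>\<phi>\<close> composed with the retraction, contracted towards
  \<open>e_3\<close> within the three faces: at time \<open>0\<close> the subtracted map is
  constant, at time \<open>1\<close> it equals \<open>\<phi>\<close> on these faces.\<close>

lemma sphere_map_deform:
  fixes \<phi> :: "(nat \<Rightarrow> real) \<Rightarrow> 'k::topological_group_add"
  assumes \<phi>: "continuous_on (simplex_boundary 3) \<phi>" and \<phi>0: "\<phi> (vertex 0) = 0"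
  obtains \<sigma> where
    "homotopic_with (\<lambda>h. h (vertex 0) = 0) (top_of_set (simplex_boundary 3)) euclidean \<phi> \<sigma>"
    "\<And>j x. j < 3 \<Longrightarrow> x \<in> simplex_face 3 j \<Longrightarrow> \<sigma> x = 0"
proof -
  define C where "C tx i = (1 - fst tx) * vertex 3 i + fst tx * snd tx i" for tx :: "real \<times> (nat \<Rightarrow> real)" and i :: nat
  define R where "R t x = C (t, sphere_retraction x)" for t :: real and x :: "nat \<Rightarrow> real"
  let ?S = "simplex_boundary 3"
  have v0: "vertex 0 \<in> ?S" by (rule vertex_0_boundary) simp
  have RS: "R t x \<in> ?S" if t: "t \<in> {0..1}" and x: "x \<in> ?S" for t x
  proof -
    obtain k where k: "k < 3" "sphere_retraction x k = 0"
      using sphere_retraction_simplex(2) [OF x] by blast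
    then have "vertex 3 k = 0" by (simp add: vertex_def)
    then have "(\<lambda>i. (1 - t) * vertex 3 i + t * sphere_retraction x i) \<in> ?S"
      using t x k by (intro simplex_boundary_segment [OF vertex_simplex sphere_retraction_simplex(1) _ _ _ _ k(2)]) auto
    then show ?thesis by (simp add: R_def C_def [abs_def])
  qed
  have cR: "continuous_on ({0..1} \<times> ?S) (\<lambda>tx. R (fst tx) (snd tx))"
    unfolding R_def
  proof (rule continuous_on_compose2 [of UNIV C])
    show "continuous_on UNIV C" unfolding C_def [abs_def] by (rule continuous_on_segment)
    show "continuous_on ({0..1} \<times> ?S) (\<lambda>tx. (fst tx, sphere_retraction (snd tx)))"
      by (intro continuous_intros continuous_on_compose2 [OF continuous_on_sphere_retraction [of UNIV]]) auto
  qed simp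
  have cR0: "continuous_on ({0..1} \<times> ?S) (\<lambda>tx. R (fst tx) (vertex 0))"
    by (rule continuous_on_compose2 [OF cR, where f = "\<lambda>tx. (fst tx, vertex 0)", unfolded fst_conv snd_conv])
      (use v0 in \<open>auto intro!: continuous_intros\<close>)
  \<comment> \<open>The last summand corrects the base point: it cancels the second one at
    \<open>vertex 0\<close>, and at time \<open>0\<close> everywhere.\<close>
  define H where "H tx = \<phi> (snd tx) - \<phi> (R (fst tx) (snd tx)) + \<phi> (R (fst tx) (vertex 0))" for tx
  have R1: "R 1 x = sphere_retraction x" for x by (simp add: R_def C_def [abs_def])
  have R0: "R 0 x = vertex 3" for x by (simp add: R_def C_def [abs_def])
  have cH: "continuous_on ({0..1} \<times> ?S) H"
    unfolding H_def
  proof (intro continuous_on_add continuous_on_diff)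
    show "continuous_on ({0..1} \<times> ?S) (\<lambda>tx. \<phi> (snd tx))"
      by (rule continuous_on_compose2 [OF \<phi> continuous_on_snd [OF continuous_on_id]]) auto
    show "continuous_on ({0..1} \<times> ?S) (\<lambda>tx. \<phi> (R (fst tx) (snd tx)))"
      by (rule continuous_on_compose2 [OF \<phi> cR]) (use RS in auto)
    show "continuous_on ({0..1} \<times> ?S) (\<lambda>tx. \<phi> (R (fst tx) (vertex 0)))"
      by (rule continuous_on_compose2 [OF \<phi> cR0]) (use RS v0 in auto)
  qed
  have fix0: "sphere_retraction (vertex 0) = vertex 0"
    by (rule sphere_retraction_fixed [OF v0, of 1]) (simp_all add: vertex_def)
  show thesis
  proof (rule that)
    show "homotopic_with (\<lambda>h. h (vertex 0) = 0) (top_of_set ?S) euclidean \<phi> (\<lambda>x. H (1, x))"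
      unfolding homotopic_with_def
    proof (intro exI conjI allI ballI)
      show "continuous_map (prod_topology (top_of_set {0..1}) (top_of_set ?S)) euclidean H" using cH by simp
      show "H (0, x) = \<phi> x" for x by (simp add: H_def R0)
      show "H (t, vertex 0) = 0" for t by (simp add: H_def \<phi>0)
    qed simp
    fix j x assume j: "j < 3" and x: "x \<in> simplex_face 3 j"
    then have "x \<in> ?S" "x j = 0" by (auto simp: simplex_boundary_def simplex_face_def)
    then have "sphere_retraction x = x" using sphere_retraction_fixed j by blast
    then show "H (1, x) = 0" by (simp add: H_def R1 fix0 \<phi>0)
  qed
qed

section \<open>Parametrising the boundary of the triangle\<close>

lemma triangle_loop_edges:
  assumes "x \<in> standard_simplex 2"
  shows "x 2 = 0 \<Longrightarrow> triangle_loop (x 1 / 2) = x"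
    and "x 0 = 0 \<Longrightarrow> triangle_loop (1 / 2 + x 2 / 4) = x"
    and "x 1 = 0 \<Longrightarrow> triangle_loop (3 / 4 + x 0 / 4) = x"
proof -
  have x: "\<And>i. 0 \<le> x i" "\<And>i. x i \<le> 1" "\<And>i. i > 2 \<Longrightarrow> x i = 0" "x 0 + x 1 + x 2 = 1"
    using assms by (auto simp: standard_simplex_2)
  have eqI: "y = x" if "y 0 = x 0" "y 1 = x 1" "y 2 = x 2" "\<And>i. i > 2 \<Longrightarrow> y i = 0" for y
  proof
    fix i show "y i = x i"
      using that x(3) [of i] le_2_iff [of i] by (cases "i \<le> 2") auto
  qed
  \<comment> \<open>\<open>+++\<close> associates to the right, so the three edges occupy the
    parameters from \<open>0\<close> to \<open>1/2\<close>, from \<open>1/2\<close> to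
    \<open>3/4\<close> and from \<open>3/4\<close> to \<open>1\<close>. On each edge the parameter
    is the barycentric coordinate of the end vertex.\<close>
  show "triangle_loop (x 1 / 2) = x" if "x 2 = 0"
    by (rule eqI) (use x(2) [of 1] x(4) that in \<open>simp_all add: triangle_loop_def joinpaths_def edge_path_def vertex_def\<close>)
  show "triangle_loop (1 / 2 + x 2 / 4) = x" if "x 0 = 0"
  proof (cases "x 2 = 0")
    case True
    show ?thesis
      by (rule eqI) (use True x(4) that in \<open>simp_all add: triangle_loop_def joinpaths_def edge_path_def vertex_def\<close>)
  next
    case False
    then have "0 < x 2" using x(1) [of 2] by simp
    then show ?thesis
      by (intro eqI) (use x(2) [of 2] x(4) that in \<open>simp_all add: triangle_loop_def joinpaths_def edge_path_def vertex_def field_simps\<close>)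
  qed
  show "triangle_loop (3 / 4 + x 0 / 4) = x" if "x 1 = 0"
  proof (cases "x 0 = 0")
    case True
    show ?thesis
      by (rule eqI) (use True x(4) that in \<open>simp_all add: triangle_loop_def joinpaths_def edge_path_def vertex_def\<close>)
  next
    case False
    then have "0 < x 0" using x(1) [of 0] by simp
    then show ?thesis
      by (intro eqI) (use x(2) [of 0] x(4) that in \<open>simp_all add: triangle_loop_def joinpaths_def edge_path_def vertex_def field_simps\<close>)
  qed
qed

lemma edge_path_ends [simp]:
  "pathstart (edge_path a b) = vertex a" "pathfinish (edge_path a b) = vertex b"
  by (simp_all add: pathstart_def pathfinish_def edge_path_def fun_eq_iff)

lemma path_edge_path: "path (edge_path a b)"
  unfolding path_def edge_path_def
  by (intro continuous_on_coordinatewise_then_product continuous_intros)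

lemma edge_path_boundary:
  assumes "a \<le> 2" "b \<le> 2" "t \<in> {0..1}"
  shows "edge_path a b t \<in> simplex_boundary 2"
proof -
  define k :: nat where "k = (if a \<noteq> 0 \<and> b \<noteq> 0 then 0 else if a \<noteq> 1 \<and> b \<noteq> 1 then 1 else 2)"
  have k: "k \<le> 2" "k \<noteq> a" "k \<noteq> b" unfolding k_def by (auto split: if_splits)
  have v: "vertex a k = 0" "vertex b k = 0" using k(2,3) by (simp_all add: vertex_def)
  have t: "0 \<le> t" "t \<le> 1" using assms(3) by simp_all
  show ?thesis
    unfolding edge_path_def
    by (rule simplex_boundary_segment [OF vertex_simplex [OF assms(1)] vertex_simplex [OF assms(2)] t k(1) v])
qed

lemma path_triangle_loop: "path triangle_loop"
  unfolding triangle_loop_def by (intro path_join_imp path_edge_path) simp_all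

lemma triangle_loop_ends: "triangle_loop 0 = vertex 0" "triangle_loop 1 = vertex 0"
  by (simp_all add: triangle_loop_def joinpaths_def edge_path_def fun_eq_iff)

lemma triangle_loop_boundary:
  assumes "t \<in> {0..1}"
  shows "triangle_loop t \<in> simplex_boundary 2"
proof -
  have e: "path_image (edge_path a b) \<subseteq> simplex_boundary 2" if "a \<le> 2" "b \<le> 2" for a b
    unfolding path_image_def by (rule image_subsetI) (rule edge_path_boundary [OF that])
  have "path_image (edge_path 0 1) \<subseteq> simplex_boundary 2" "path_image (edge_path 1 2) \<subseteq> simplex_boundary 2"
    "path_image (edge_path 2 0) \<subseteq> simplex_boundary 2"
    by (rule e; simp)+
  then have "path_image triangle_loop \<subseteq> simplex_boundary 2"
    unfolding triangle_loop_def by (intro subset_path_image_join)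
  moreover have "triangle_loop t \<in> path_image triangle_loop"
    unfolding path_image_def using assms by (rule imageI)
  ultimately show ?thesis by blast
qed

lemma edge_parameter_bounds:
  assumes "y \<in> standard_simplex 2"
  shows "y 1 / 2 \<in> {0..1}" "1 / 2 + y 2 / 4 \<in> {0..1}" "3 / 4 + y 0 / 4 \<in> {0..1}"
proof -
  have "0 \<le> y i \<and> y i \<le> 1" for i
    using assms by (simp add: standard_simplex_2)
  from this [of 0] this [of 1] this [of 2]
  show "y 1 / 2 \<in> {0..1}" "1 / 2 + y 2 / 4 \<in> {0..1}" "3 / 4 + y 0 / 4 \<in> {0..1}"
    unfolding atLeastAtMost_iff by linarith+
qed

lemma continuous_on_simplex_2_path:
  fixes g :: "real \<Rightarrow> 'w::topological_space"
  assumes "path g" "S \<subseteq> standard_simplex 2"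
  shows "continuous_on S (\<lambda>y. g (y 1 / 2))" "continuous_on S (\<lambda>y. g (1 / 2 + y 2 / 4))"
    "continuous_on S (\<lambda>y. g (3 / 4 + y 0 / 4))"
proof -
  have g: "continuous_on {0..1} g" using assms(1) by (simp add: path_def)
  note b = edge_parameter_bounds [OF subsetD [OF assms(2)]]
  show "continuous_on S (\<lambda>y. g (y 1 / 2))" "continuous_on S (\<lambda>y. g (1 / 2 + y 2 / 4))"
    "continuous_on S (\<lambda>y. g (3 / 4 + y 0 / 4))"
    by (rule continuous_on_compose2 [OF g] continuous_intros continuous_on_coordinate image_subsetI b |
        assumption | simp)+
qed

lemma continuous_on_If_coordinates:
  fixes S :: "(nat \<Rightarrow> real) set"
  assumes "continuous_on {y \<in> S. y a = 0} f" "continuous_on {y \<in> S. P y} g" "closed {y. P y}"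
    and "\<And>y. y \<in> S \<Longrightarrow> y a = 0 \<or> P y" and "\<And>y. y \<in> S \<Longrightarrow> y a = 0 \<Longrightarrow> P y \<Longrightarrow> f y = g y"
  shows "continuous_on S (\<lambda>y. if y a = 0 then f y else g y)"
proof -
  have S: "S = {y \<in> S. y a = 0} \<union> {y \<in> S. P y}" using assms(4) by blast
  have cl: "closedin (top_of_set S) {y \<in> S. Q y}" if "closed {y. Q y}" for Q
  proof -
    have "{y \<in> S. Q y} = S \<inter> {y. Q y}" by blast
    then show ?thesis using closedin_closed_Int [OF that, of S] by simp
  qed
  have "continuous_on ({y \<in> S. y a = 0} \<union> {y \<in> S. P y}) (\<lambda>y. if y a = 0 then f y else g y)"
  proof (rule continuous_on_cases_local [OF _ _ assms(1,2)])
    show "closedin (top_of_set ({y \<in> S. y a = 0} \<union> {y \<in> S. P y})) {y \<in> S. y a = 0}"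
      unfolding S [symmetric] by (rule cl [OF closed_coordinate_eq])
    show "closedin (top_of_set ({y \<in> S. y a = 0} \<union> {y \<in> S. P y})) {y \<in> S. P y}"
      unfolding S [symmetric] by (rule cl [OF assms(3)])
  qed (use assms(5) in blast)
  then show ?thesis unfolding S [symmetric] .
qed

section \<open>The local model over the sphere\<close>

text \<open>Lifts of a loop \<open>l\<close> to the stars of the vertices of the triangle, in terms of a lift \<open>g\<close> of the
  path \<open>l \<circ> triangle_loop\<close> with end point \<open>w\<close>; the jump is at \<open>e\<^sub>0\<close>.\<close>

definition star_lift :: "(real \<Rightarrow> 'w::ab_group_add) \<Rightarrow> 'w \<Rightarrow> nat \<Rightarrow> (nat \<Rightarrow> real) \<Rightarrow> 'w" where
  "star_lift g w i y =
     (if i = 0 then if y 2 = 0 then g (y 1 / 2) else g (3 / 4 + y 0 / 4) - w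
      else if i = 1 then if y 2 = 0 then g (y 1 / 2) else g (1 / 2 + y 2 / 4)
      else if y 0 = 0 then g (1 / 2 + y 2 / 4) else g (3 / 4 + y 0 / 4))"

lemma simplex_boundary_2D:
  assumes "y \<in> simplex_boundary 2"
  shows "y \<in> standard_simplex 2" "y 0 + y 1 + y 2 = 1" "y 0 = 0 \<or> y 1 = 0 \<or> y 2 = 0"
proof -
  show y: "y \<in> standard_simplex 2" using assms by (simp add: simplex_boundary_iff)
  then show "y 0 + y 1 + y 2 = 1" unfolding standard_simplex_2 by blast
  obtain k where "k \<le> 2" "y k = 0" using assms unfolding simplex_boundary_iff by blast
  then show "y 0 = 0 \<or> y 1 = 0 \<or> y 2 = 0" unfolding le_2_iff by auto
qed

text \<open>Inside one star the two branches meet only at its vertex. At \<open>e_1\<close> both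
  give \<open>g (1/2)\<close>, at \<open>e_2\<close> both give \<open>g (3/4)\<close>; at
  \<open>e_0\<close> they are \<open>g 0\<close> and \<open>g 1 - w\<close>, which the subtraction
  of \<open>w\<close> makes equal.\<close>

lemma continuous_on_star_lift:
  fixes g :: "real \<Rightarrow> 'w::topological_ab_group_add"
  assumes g: "path g" "g 0 = 0" "g 1 = w" and i: "i < 3"
  shows "continuous_on {y \<in> simplex_boundary 2. 0 < y i} (star_lift g w i)"
proof -
  have sub: "{y \<in> {y \<in> simplex_boundary 2. 0 < y i}. P y} \<subseteq> standard_simplex 2" for P i
    using simplex_boundary_2_subset by blast
  note c = continuous_on_simplex_2_path [OF g(1) sub]
  consider "i = 0" | "i = 1" | "i = 2" using i unfolding less_3_iff by blast
  then show ?thesis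
  proof cases
    case 1
    have "continuous_on {y \<in> simplex_boundary 2. 0 < y 0} (\<lambda>y. if y 2 = 0 then g (y 1 / 2) else g (3 / 4 + y 0 / 4) - w)"
    proof (rule continuous_on_If_coordinates [where P = "\<lambda>y. y 1 = 0"])
      show "continuous_on {y \<in> {y \<in> simplex_boundary 2. 0 < y 0}. y 1 = 0} (\<lambda>y. g (3 / 4 + y 0 / 4) - w)"
        by (intro continuous_on_diff c continuous_on_const)
      fix y assume y: "y \<in> {y \<in> simplex_boundary 2. 0 < y 0}"
      then have yb: "y \<in> simplex_boundary 2" "0 < y 0" by simp_all
      show "y 2 = 0 \<or> y 1 = 0" using simplex_boundary_2D(3) [OF yb(1)] yb(2) by linarith
      show "g (y 1 / 2) = g (3 / 4 + y 0 / 4) - w" if "y 2 = 0" "y 1 = 0"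
      proof -
        have "y 0 = 1" using simplex_boundary_2D(2) [OF yb(1)] that by linarith
        then show ?thesis unfolding that using g(2,3) by simp
      qed
    qed (rule c closed_coordinate_eq)+
    then show ?thesis using 1 by (simp add: star_lift_def [abs_def])
  next
    case 2
    have "continuous_on {y \<in> simplex_boundary 2. 0 < y 1} (\<lambda>y. if y 2 = 0 then g (y 1 / 2) else g (1 / 2 + y 2 / 4))"
    proof (rule continuous_on_If_coordinates [where P = "\<lambda>y. y 0 = 0"])
      fix y assume y: "y \<in> {y \<in> simplex_boundary 2. 0 < y 1}"
      then have yb: "y \<in> simplex_boundary 2" "0 < y 1" by simp_all
      show "y 2 = 0 \<or> y 0 = 0" using simplex_boundary_2D(3) [OF yb(1)] yb(2) by linarith
      show "g (y 1 / 2) = g (1 / 2 + y 2 / 4)" if "y 2 = 0" "y 0 = 0"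
      proof -
        have "y 1 = 1" using simplex_boundary_2D(2) [OF yb(1)] that by linarith
        then show ?thesis unfolding that by simp
      qed
    qed (rule c closed_coordinate_eq)+
    then show ?thesis using 2 by (simp add: star_lift_def [abs_def])
  next
    case 3
    have "continuous_on {y \<in> simplex_boundary 2. 0 < y 2} (\<lambda>y. if y 0 = 0 then g (1 / 2 + y 2 / 4) else g (3 / 4 + y 0 / 4))"
    proof (rule continuous_on_If_coordinates [where P = "\<lambda>y. y 1 = 0"])
      fix y assume y: "y \<in> {y \<in> simplex_boundary 2. 0 < y 2}"
      then have yb: "y \<in> simplex_boundary 2" "0 < y 2" by simp_all
      show "y 0 = 0 \<or> y 1 = 0" using simplex_boundary_2D(3) [OF yb(1)] yb(2) by linarith
      show "g (1 / 2 + y 2 / 4) = g (3 / 4 + y 0 / 4)" if "y 0 = 0" "y 1 = 0"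
      proof -
        have "y 2 = 1" using simplex_boundary_2D(2) [OF yb(1)] that by linarith
        then show ?thesis unfolding that by simp
      qed
    qed (rule c closed_coordinate_eq)+
    then show ?thesis using 3 by (simp add: star_lift_def [abs_def])
  qed
qed

lemma edge_parameter_lift:
  assumes "\<And>t. t \<in> {0..1} \<Longrightarrow> q (g t) = l (triangle_loop t)" and y: "y \<in> standard_simplex 2"
  shows "y 2 = 0 \<Longrightarrow> q (g (y 1 / 2)) = l y" "y 0 = 0 \<Longrightarrow> q (g (1 / 2 + y 2 / 4)) = l y"
    "y 1 = 0 \<Longrightarrow> q (g (3 / 4 + y 0 / 4)) = l y"
  using triangle_loop_edges [OF y] by (simp_all only: assms(1) [OF edge_parameter_bounds(1) [OF y]]
      assms(1) [OF edge_parameter_bounds(2) [OF y]] assms(1) [OF edge_parameter_bounds(3) [OF y]])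

lemma star_lift_lifts:
  assumes q: "additive_hom q" and g: "\<And>t. t \<in> {0..1} \<Longrightarrow> q (g t) = l (triangle_loop t)"
    and w: "q w = 0" and y: "y \<in> simplex_boundary 2" "0 < y i" and i: "i < 3"
  shows "q (star_lift g w i y) = l y"
proof -
  note e = edge_parameter_lift [of q g l, OF g simplex_boundary_2D(1) [OF y(1)]]
  note z = simplex_boundary_2D(3) [OF y(1)]
  consider "i = 0" | "i = 1" | "i = 2" using i unfolding less_3_iff by blast
  then show ?thesis
  proof cases
    case 1
    then have "y 1 = 0 \<or> y 2 = 0" using z y(2) by auto
    then show ?thesis
      using 1 e(1,3) w by (cases "y 2 = 0") (auto simp: star_lift_def additive_hom_diff [OF q])
  next
    case 2
    then have "y 0 = 0 \<or> y 2 = 0" using z y(2) by auto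
    then show ?thesis using 2 e(1,2) by (cases "y 2 = 0") (auto simp: star_lift_def)
  next
    case 3
    then have "y 0 = 0 \<or> y 1 = 0" using z y(2) by auto
    then show ?thesis using 3 e(2,3) by (cases "y 0 = 0") (auto simp: star_lift_def)
  qed
qed

text \<open>A path lift that returns to \<open>0\<close> descends from the parameter interval to the
  triangle: its branches agree at all three vertices. It is applied to the difference of two loops
  with the same \<open>\<gamma>\<close>.\<close>

lemma closed_loop_lift:
  fixes g :: "real \<Rightarrow> 'w::topological_ab_group_add"
  assumes g: "path g" "g 0 = 0" "g 1 = 0"
    and lift: "\<And>t. t \<in> {0..1} \<Longrightarrow> q (g t) = l (triangle_loop t)"
  obtains F where "continuous_on (simplex_boundary 2) F" "\<And>y. y \<in> simplex_boundary 2 \<Longrightarrow> q (F y) = l y"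
    "F (vertex 0) = 0"
proof
  define F where "F y = (if y 2 = 0 then g (y 1 / 2) else if y 0 = 0 then g (1 / 2 + y 2 / 4) else g (3 / 4 + y 0 / 4))"
    for y :: "nat \<Rightarrow> real"
  have sub: "{y \<in> simplex_boundary 2. P y} \<subseteq> standard_simplex 2"
    "{y \<in> {y \<in> simplex_boundary 2. Q y}. P y} \<subseteq> standard_simplex 2" for P Q
    using simplex_boundary_2_subset by blast+
  note c = continuous_on_simplex_2_path [OF g(1) sub(1)] and c' = continuous_on_simplex_2_path [OF g(1) sub(2)]
  show "continuous_on (simplex_boundary 2) F"
    unfolding F_def [abs_def]
  proof (rule continuous_on_If_coordinates [where P = "\<lambda>y. y 0 = 0 \<or> y 1 = 0"])
    show "continuous_on {y \<in> simplex_boundary 2. y 0 = 0 \<or> y 1 = 0}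
        (\<lambda>y. if y 0 = 0 then g (1 / 2 + y 2 / 4) else g (3 / 4 + y 0 / 4))"
    proof (rule continuous_on_If_coordinates [where P = "\<lambda>y. y 1 = 0"])
      fix y assume y: "y \<in> {y \<in> simplex_boundary 2. y 0 = 0 \<or> y 1 = 0}"
      then show "y 0 = 0 \<or> y 1 = 0" by blast
      have yb: "y \<in> simplex_boundary 2" using y by blast
      show "g (1 / 2 + y 2 / 4) = g (3 / 4 + y 0 / 4)" if "y 0 = 0" "y 1 = 0"
      proof -
        have "y 2 = 1" using simplex_boundary_2D(2) [OF yb] that by linarith
        then show ?thesis unfolding that by simp
      qed
    qed (rule c' closed_coordinate_eq)+
    show "closed {y::nat \<Rightarrow> real. y 0 = 0 \<or> y 1 = 0}"
      by (intro closed_Collect_disj closed_coordinate_eq)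
    fix y :: "nat \<Rightarrow> real" assume yb: "y \<in> simplex_boundary 2"
    show "y 2 = 0 \<or> y 0 = 0 \<or> y 1 = 0" using simplex_boundary_2D(3) [OF yb] by blast
    show "g (y 1 / 2) = (if y 0 = 0 then g (1 / 2 + y 2 / 4) else g (3 / 4 + y 0 / 4))"
      if "y 2 = 0" "y 0 = 0 \<or> y 1 = 0"
    proof (cases "y 0 = 0")
      case True
      then have "y 1 = 1" using simplex_boundary_2D(2) [OF yb] that by linarith
      then show ?thesis unfolding True that(1) by simp
    next
      case False
      then have y1: "y 1 = 0" using that(2) by blast
      then have "y 0 = 1" using simplex_boundary_2D(2) [OF yb] that by linarith
      then show ?thesis unfolding y1 that(1) using g(2,3) by simp
    qed
  qed (rule c)
  show "q (F y) = l y" if y: "y \<in> simplex_boundary 2" for y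
  proof -
    note e = edge_parameter_lift [of q g l, OF lift simplex_boundary_2D(1) [OF y]]
    have z: "y 1 = 0" if "y 2 \<noteq> 0" "y 0 \<noteq> 0" using simplex_boundary_2D(3) [OF y] that by blast
    show ?thesis
    proof (cases "y 2 = 0")
      case True
      then show ?thesis using e(1) by (simp add: F_def)
    next
      case False
      then show ?thesis using e(2,3) z by (cases "y 0 = 0") (simp_all add: F_def)
    qed
  qed
  show "F (vertex 0) = 0" using g(2) by (simp add: F_def vertex_def)
qed

text \<open>Radial projection from \<open>e_3\<close> onto the plane of \<open>F_3\<close>, applied
  where \<open>x 3 < 1\<close>. On the three faces through \<open>e_3\<close> it is a retraction
  onto the boundary of \<open>F_3\<close> of the kind that occurs in the normalisation of the
  sign.\<close>

definition central_projection :: "(nat \<Rightarrow> real) \<Rightarrow> nat \<Rightarrow> real" where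
  "central_projection x i = (if i < 3 then x i / (1 - x 3) else 0)"

lemma central_projection_boundary:
  assumes x: "x \<in> simplex_boundary 3" "x 3 < 1" and k: "k < 3" "x k = 0"
  shows "central_projection x \<in> simplex_boundary 2"
proof -
  let ?c = "central_projection x"
  have xs: "\<And>i. 0 \<le> x i" "x 0 + x 1 + x 2 + x 3 = 1"
    using x by (auto simp: simplex_boundary_iff standard_simplex_3)
  have nonneg: "0 \<le> ?c i" for i using xs(1) x(2) by (simp add: central_projection_def)
  have "?c 0 + ?c 1 + ?c 2 = (x 0 + x 1 + x 2) / (1 - x 3)"
    by (simp add: central_projection_def add_divide_distrib)
  also have "\<dots> = 1" using xs(2) x(2) by (simp add: field_simps)
  finally have sum: "?c 0 + ?c 1 + ?c 2 = 1" .
  have "?c i \<le> 1" for i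
  proof (cases "i < 3")
    case True
    then show ?thesis using sum nonneg [of 0] nonneg [of 1] nonneg [of 2]
      unfolding less_3_iff by (elim disjE) simp_all
  qed (simp add: central_projection_def)
  then have "?c \<in> standard_simplex 2"
    unfolding standard_simplex_2 using nonneg sum by (simp add: central_projection_def)
  moreover have "?c k = 0" using k by (simp add: central_projection_def)
  ultimately show ?thesis
    unfolding simplex_boundary_iff using k(1) by (intro conjI exI [of _ k]) auto
qed

lemma central_projection_pos:
  "x 3 < 1 \<Longrightarrow> i < 3 \<Longrightarrow> 0 < central_projection x i \<longleftrightarrow> 0 < x i"
  by (simp add: central_projection_def zero_less_divide_iff)

lemma central_projection_fixed:
  assumes "x \<in> standard_simplex 3" "x 3 = 0"
  shows "central_projection x = x"
proof
  fix i show "central_projection x i = x i"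
  proof (cases "i < 3")
    case False
    then have "i = 3 \<or> i > 3" by auto
    then have "x i = 0" using assms by (auto simp: standard_simplex_3)
    then show ?thesis using False by (simp add: central_projection_def)
  qed (simp add: central_projection_def assms(2))
qed

lemma continuous_on_central_projection:
  assumes "\<And>x. x \<in> S \<Longrightarrow> x 3 < 1"
  shows "continuous_on S central_projection"
proof (rule continuous_on_coordinatewise_then_product)
  fix i
  show "continuous_on S (\<lambda>x. central_projection x i)"
  proof (cases "i < 3")
    case True
    have "continuous_on S (\<lambda>x. x i / (1 - x 3))"
      by (intro continuous_on_divide continuous_on_diff continuous_on_const continuous_on_coordinate)
        (use assms in force)
    then show ?thesis using True by (simp add: central_projection_def)
  qed (simp add: central_projection_def)
qed

text \<open>Antisymmetry is demanded on all lists of indices, so the six orderings of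
  \<open>0, 2, 3\<close> are listed with their signs and every other list gets \<open>0\<close>. The
  first set consists of the rotations, that is, of the even permutations.\<close>

definition rotation_sign :: "'g::ab_group_add \<Rightarrow> nat list \<Rightarrow> 'g" where
  "rotation_sign \<gamma> is =
     (if is \<in> {[0, 2, 3], [2, 3, 0], [3, 0, 2]} then \<gamma>
      else if is \<in> {[2, 0, 3], [0, 3, 2], [3, 2, 0]} then - \<gamma> else 0)"

lemma totally_antisymmetric_rotation_sign: "totally_antisymmetric (\<lambda>is x. rotation_sign \<gamma> is)"
  unfolding totally_antisymmetric_def
proof (intro conjI allI impI)
  show "rotation_sign \<gamma> is = 0" if "\<not> distinct is" for "is"
    using that by (auto simp: rotation_sign_def)
  show "rotation_sign \<gamma> (is @ a # b # js) = - rotation_sign \<gamma> (is @ b # a # js)" for "is" a b js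
  proof (cases "length (is @ a # b # js) = 3")
    case True
    then consider d where "is = []" "js = [d]" | d where "is = [d]" "js = []"
      by (cases "is"; cases js) auto
    then show ?thesis by cases (auto simp: rotation_sign_def)
  next
    case False
    then have "xs \<noteq> is @ a # b # js" "xs \<noteq> is @ b # a # js" if "length xs = 3" for xs
      using that by auto
    from this [of "[0, 2, 3]"] this [of "[2, 3, 0]"] this [of "[3, 0, 2]"]
      this [of "[2, 0, 3]"] this [of "[0, 3, 2]"] this [of "[3, 2, 0]"]
    have "rotation_sign \<gamma> (is @ a # b # js) = 0" "rotation_sign \<gamma> (is @ b # a # js) = 0"
      unfolding rotation_sign_def by auto
    then show ?thesis by simp
  qed
qed


lemma sphere_local_model:
  fixes i :: "'z::topological_ab_group_add \<Rightarrow> 'e::topological_group_add"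
    and p :: "'e \<Rightarrow> 'k::topological_group_add"
    and q :: "'w::topological_ab_group_add \<Rightarrow> 'z"
    and j :: "'g::{topological_ab_group_add,discrete_topology} \<Rightarrow> 'w"
  assumes ce: "central_extension i p" and KG: "K_Gamma_1_group j q"
    and \<sigma>: "\<And>k x. k < 3 \<Longrightarrow> x \<in> simplex_face 3 k \<Longrightarrow> \<sigma> x = 0"
    and \<tau>: "continuous_on (simplex_face 3 3) \<tau>" "\<And>x. x \<in> simplex_face 3 3 \<Longrightarrow> p (\<tau> x) = \<sigma> x"
    and \<tau>l: "\<And>x. x \<in> simplex_boundary 2 \<Longrightarrow> \<tau> x = i (l x)"
    and g: "path g" "g 0 = 0" "g 1 = j \<gamma>"
    and lift: "\<And>t. t \<in> {0..1} \<Longrightarrow> q (g t) = l (triangle_loop t)"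
  obtains s z zt a where
    "local_lifts p (top_of_set (simplex_boundary 3)) \<sigma> {..3} sphere_cover s"
    "difference_cochain i {..3} sphere_cover s z"
    "connecting_data j q (top_of_set (simplex_boundary 3)) {..3} sphere_cover z zt a"
    "S2 (cech_class (top_of_set (simplex_boundary 3)) 2 {..3} sphere_cover a) = - \<gamma>"
proof -
  let ?S = "simplex_boundary 3"
  let ?\<Lambda> = sphere_cover
  let ?\<rho> = central_projection
  have i: "additive_hom i" and p: "additive_hom p" and pi0: "p (i y) = 0" for y
    using ce by (auto simp: central_extension_def)
  have j: "additive_hom j" and q: "additive_hom q" and qj: "q (j y) = 0" for y
    using KG by (auto simp: K_Gamma_1_group_def)
  have \<Lambda>D: "x \<in> ?S" "0 < x m" if "x \<in> ?\<Lambda> m" for x m using that by (auto simp: sphere_cover_iff)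
  have bS: "simplex_boundary 2 \<subseteq> simplex_face 3 3"
    unfolding simplex_face_3_3 by (rule simplex_boundary_2_subset)
  have \<Omega>: "x 3 < 1" if x: "x \<in> ?\<Lambda> m" "m < 3" for x m
  proof -
    have "0 < x m" "x 0 + x 1 + x 2 + x 3 = 1" "\<And>k. 0 \<le> x k"
      using x(1) by (auto simp: sphere_cover_iff simplex_boundary_iff standard_simplex_3)
    from this(1,2) this(3) [of 0] this(3) [of 1] this(3) [of 2] x(2) show ?thesis
      unfolding less_3_iff by (elim disjE) auto
  qed
  have zero: "\<exists>k<3. x k = 0" if x3: "x \<in> ?\<Lambda> 3" for x
  proof -
    obtain k where "k \<le> 3" "x k = 0" using \<Lambda>D(1) [OF x3] unfolding simplex_boundary_iff by blast
    moreover from this have "k \<noteq> 3" using \<Lambda>D(2) [OF x3] by auto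
    ultimately show ?thesis by (intro exI [of _ k]) simp
  qed
  have face: "x \<in> simplex_face 3 k" if "x \<in> ?S" "x k = 0" for x k
    using that by (simp add: simplex_boundary_iff simplex_face_def)
  have \<rho>b: "?\<rho> x \<in> simplex_boundary 2" if "x \<in> ?\<Lambda> m" "m < 3" "x \<in> ?\<Lambda> 3" for x m
    using zero [OF that(3)] central_projection_boundary [OF \<Lambda>D(1) [OF that(1)] \<Omega> [OF that(1,2)]] by blast

  have \<rho>pos: "0 < ?\<rho> x m" if "x \<in> ?\<Lambda> m" "m < 3" for x m
    using central_projection_pos [of x m] \<Omega> [OF that] \<Lambda>D(2) [OF that(1)] that(2) by simp
  \<comment> \<open>Off \<open>F_3\<close> the value lies in the image of \<open>i\<close>, because
    \<open>\<tau>\<close> does so on the boundary of the triangle; this matches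
    \<open>\<sigma> = 0\<close> there.\<close>
  define u where "u x = (if x 3 = 0 then \<tau> x else \<tau> (?\<rho> x))" for x
  have cu: "continuous_on (?\<Lambda> m) u" if m: "m < 3" for m
    unfolding u_def
  proof (rule continuous_on_If_coordinates [where P = "\<lambda>x. x 0 = 0 \<or> x 1 = 0 \<or> x 2 = 0"])
    show "continuous_on {x \<in> ?\<Lambda> m. x 3 = 0} \<tau>"
      by (rule continuous_on_subset [OF \<tau>(1)]) (use face \<Lambda>D(1) in blast)
    show "continuous_on {x \<in> ?\<Lambda> m. x 0 = 0 \<or> x 1 = 0 \<or> x 2 = 0} (\<lambda>x. \<tau> (?\<rho> x))"
    proof (rule continuous_on_compose2 [OF \<tau>(1)])
      show "continuous_on {x \<in> ?\<Lambda> m. x 0 = 0 \<or> x 1 = 0 \<or> x 2 = 0} ?\<rho>"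
        by (rule continuous_on_central_projection) (use \<Omega> m in blast)
      show "?\<rho> ` {x \<in> ?\<Lambda> m. x 0 = 0 \<or> x 1 = 0 \<or> x 2 = 0} \<subseteq> simplex_face 3 3"
      proof (rule image_subsetI)
        fix x assume x: "x \<in> {x \<in> ?\<Lambda> m. x 0 = 0 \<or> x 1 = 0 \<or> x 2 = 0}"
        then have xm: "x \<in> ?\<Lambda> m" by blast
        have "\<exists>k<3. x k = 0" using x unfolding less_3_iff by blast
        then have "?\<rho> x \<in> simplex_boundary 2"
          using central_projection_boundary [OF \<Lambda>D(1) [OF xm] \<Omega> [OF xm m]] by blast
        then show "?\<rho> x \<in> simplex_face 3 3" using bS by blast
      qed
    qed
    show "closed {x::nat \<Rightarrow> real. x 0 = 0 \<or> x 1 = 0 \<or> x 2 = 0}"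
      by (intro closed_Collect_disj closed_coordinate_eq)
    fix x assume x: "x \<in> ?\<Lambda> m"
    show "x 3 = 0 \<or> x 0 = 0 \<or> x 1 = 0 \<or> x 2 = 0"
      using \<Lambda>D(1) [OF x] unfolding simplex_boundary_iff le_3_iff by blast
    show "\<tau> x = \<tau> (?\<rho> x)" if "x 3 = 0"
      using central_projection_fixed [of x] \<Lambda>D(1) [OF x] that by (simp add: simplex_boundary_iff)
  qed
  have u3: "u x = i (l (?\<rho> x))" if "x \<in> ?\<Lambda> m" "m < 3" "x \<in> ?\<Lambda> 3" for x m
    using \<tau>l [OF \<rho>b [OF that]] \<Lambda>D(2) [OF that(3)] by (simp add: u_def)
  have pu: "p (u x) = \<sigma> x" if x: "x \<in> ?\<Lambda> m" "m < 3" for x m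
  proof (cases "x 3 = 0")
    case True
    then show ?thesis using \<tau>(2) [OF face [OF \<Lambda>D(1) [OF x(1)]]] by (simp add: u_def)
  next
    case False
    then have x3: "x \<in> ?\<Lambda> 3"
      using \<Lambda>D(1) [OF x(1)] by (auto simp: sphere_cover_def simplex_face_def)
    then obtain k where "k < 3" "x k = 0" using zero by blast
    then have "\<sigma> x = 0" using \<sigma> face [OF \<Lambda>D(1) [OF x(1)]] by blast
    then show ?thesis using u3 [OF x x3] pi0 by simp
  qed

  \<comment> \<open>\<open>0\<close> lifts \<open>\<sigma>\<close> on the star of
    \<open>e_3\<close>: each of its points lies on a face through \<open>e_3\<close>, where
    \<open>\<sigma>\<close> vanishes.\<close>
  define s where "s m = (if m < (3::nat) then u else (\<lambda>_. 0))" for m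
  define z where "z is x = (if is ! 0 < 3 \<and> is ! 1 = 3 then l (?\<rho> x)
    else if is ! 0 = 3 \<and> is ! 1 < 3 then - l (?\<rho> x) else 0)" for "is" :: "nat list" and x
  define L where "L m x = star_lift g (j \<gamma>) m (?\<rho> x)" for m x
  \<comment> \<open>The lifts are antisymmetric in the two indices and \<open>0\<close> among the
    first three stars, so that \<open>a\<close> becomes totally antisymmetric, as \<open>S2\<close>
    demands.\<close>
  define zt where "zt is x = (if is ! 0 < 3 \<and> is ! 1 = 3 then L (is ! 0) x
    else if is ! 0 = 3 \<and> is ! 1 < 3 then - L (is ! 1) x else 0)" for "is" :: "nat list" and x
  define a :: "nat list \<Rightarrow> (nat \<Rightarrow> real) \<Rightarrow> 'g" where "a is x = rotation_sign \<gamma> is" for "is" x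

  have \<Lambda>sub: "?S \<inter> ?\<Lambda> m = ?\<Lambda> m" "?S \<inter> (?\<Lambda> m \<inter> ?\<Lambda> n) = ?\<Lambda> m \<inter> ?\<Lambda> n" for m n
    by (auto simp: sphere_cover_def)
  have 1: "local_lifts p (top_of_set ?S) \<sigma> {..3} ?\<Lambda> s"
    unfolding local_lifts_def
  proof (intro ballI conjI)
    fix m assume m: "m \<in> {..3::nat}"
    show "continuous_map (subtopology (top_of_set ?S) (?\<Lambda> m)) euclidean (s m)"
      using cu by (simp add: subtopology_subtopology \<Lambda>sub s_def)
    fix x assume x: "x \<in> ?\<Lambda> m"
    show "p (s m x) = \<sigma> x"
    proof (cases "m < 3")
      case True
      then show ?thesis using pu x by (simp add: s_def)
    next
      case False
      then have x3: "x \<in> ?\<Lambda> 3" using x m by simp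
      then obtain k where "k < 3" "x k = 0" using zero by blast
      then have "\<sigma> x = 0" using \<sigma> face [OF \<Lambda>D(1) [OF x]] by blast
      then show ?thesis using False by (simp add: s_def additive_hom_zero [OF p])
    qed
  qed
  have 2: "difference_cochain i {..3} ?\<Lambda> s z"
    unfolding difference_cochain_def
  proof (intro ballI)
    fix m n x assume mn: "m \<in> {..3::nat}" "n \<in> {..3::nat}" and x: "x \<in> ?\<Lambda> m \<inter> ?\<Lambda> n"
    consider "m < 3" "n < 3" | "m < 3" "n = 3" | "m = 3" "n < 3" | "m = 3" "n = 3"
      using mn by fastforce
    then show "s m x = s n x + i (z [m, n] x)"
      using u3 [of x m] u3 [of x n] x by cases (auto simp: s_def z_def additive_hom_simps [OF i])
  qed
  have Lc: "continuous_on (?\<Lambda> m \<inter> ?\<Lambda> 3) (L m)" if m: "m < 3" for m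
    unfolding L_def
  proof (rule continuous_on_compose2 [OF continuous_on_star_lift [OF g m]])
    show "continuous_on (?\<Lambda> m \<inter> ?\<Lambda> 3) ?\<rho>"
      by (rule continuous_on_central_projection) (use \<Omega> m in blast)
    show "?\<rho> ` (?\<Lambda> m \<inter> ?\<Lambda> 3) \<subseteq> {y \<in> simplex_boundary 2. 0 < y m}"
    proof (rule image_subsetI)
      fix x assume "x \<in> ?\<Lambda> m \<inter> ?\<Lambda> 3"
      then have x: "x \<in> ?\<Lambda> m" "x \<in> ?\<Lambda> 3" by auto
      show "?\<rho> x \<in> {y \<in> simplex_boundary 2. 0 < y m}"
        using \<rho>b [OF x(1) m x(2)] \<rho>pos [OF x(1) m] by simp
    qed
  qed
  have qL: "q (L m x) = l (?\<rho> x)" if "x \<in> ?\<Lambda> m" "m < 3" "x \<in> ?\<Lambda> 3" for m x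
    unfolding L_def
  proof (rule star_lift_lifts [of q g l "j \<gamma>" "?\<rho> x" m])
    show "q (g t) = l (triangle_loop t)" if "t \<in> {0..1}" for t using that by (rule lift)
  qed (rule q qj \<rho>b [OF that] \<rho>pos [OF that(1,2)] that(2))+
  \<comment> \<open>On a triple intersection with the star of \<open>e_3\<close> the projection lies
    on one edge of the triangle, so two lifts can be compared branch by branch.\<close>
  have E: "L 1 x = L 0 x" if "x \<in> ?\<Lambda> 0" "x \<in> ?\<Lambda> 1" "x \<in> ?\<Lambda> 3" for x
  proof -
    have "x 2 = 0" using zero [OF that(3)] \<Lambda>D(2) [OF that(1)] \<Lambda>D(2) [OF that(2)]
      unfolding less_3_iff by auto
    then have "?\<rho> x 2 = 0" by (simp add: central_projection_def)
    then show ?thesis by (simp add: L_def star_lift_def)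
  qed
  have E': "L 2 x = L 1 x" if "x \<in> ?\<Lambda> 1" "x \<in> ?\<Lambda> 2" "x \<in> ?\<Lambda> 3" for x
  proof -
    have "x 0 = 0" using zero [OF that(3)] \<Lambda>D(2) [OF that(1)] \<Lambda>D(2) [OF that(2)]
      unfolding less_3_iff by auto
    then have "?\<rho> x 0 = 0" by (simp add: central_projection_def)
    moreover have "0 < ?\<rho> x 2"
      by (rule \<rho>pos [OF that(2)]) simp
    ultimately show ?thesis by (simp add: L_def star_lift_def)
  qed
  \<comment> \<open>Over the edge from \<open>e_2\<close> to \<open>e_0\<close> the star of
    \<open>e_0\<close> uses the shifted branch; this is the only jump.\<close>
  have E'': "L 2 x = L 0 x + j \<gamma>" if "x \<in> ?\<Lambda> 0" "x \<in> ?\<Lambda> 2" "x \<in> ?\<Lambda> 3" for x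
  proof -
    have "0 < ?\<rho> x 0" "0 < ?\<rho> x 2"
      using \<rho>pos [OF that(1)] \<rho>pos [OF that(2)] by simp_all
    then show ?thesis by (simp add: L_def star_lift_def)
  qed
  have 3: "connecting_data j q (top_of_set ?S) {..3} ?\<Lambda> z zt a"
    unfolding connecting_data_def One_nat_def cech_cochain_1
  proof (intro conjI ballI)
    fix m n assume mn: "m \<in> {..3::nat}" "n \<in> {..3::nat}"
    have cases: "m < 3 \<and> n < 3 \<or> m < 3 \<and> n = 3 \<or> m = 3 \<and> n < 3 \<or> m = 3 \<and> n = 3"
      using mn by fastforce
    have "continuous_on (?\<Lambda> m \<inter> ?\<Lambda> n) (zt [m, n])"
      using cases
    proof (elim disjE conjE)
      assume mn: "m < 3" "n = 3"
      then have "zt [m, n] = L m" by (simp add: zt_def [abs_def])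
      then show ?thesis using Lc [OF mn(1)] mn(2) by simp
    next
      assume mn: "m = 3" "n < 3"
      then have "zt [m, n] = (\<lambda>x. - L n x)" by (simp add: zt_def [abs_def])
      then show ?thesis using continuous_on_minus [OF Lc [OF mn(2)]] mn(1) by (simp add: Int_commute)
    qed (simp_all add: zt_def [abs_def])
    then show "continuous_map (subtopology (top_of_set ?S) (?\<Lambda> m \<inter> ?\<Lambda> n)) euclidean (zt [m, n])"
      by (simp add: subtopology_subtopology \<Lambda>sub)
    fix x assume x: "x \<in> ?\<Lambda> m \<inter> ?\<Lambda> n"
    show "q (zt [m, n] x) = z [m, n] x"
      using cases qL [of x m] qL [of x n] x
      by (elim disjE conjE) (simp_all add: zt_def z_def additive_hom_simps [OF q])
  next
    fix b c d x assume bcd: "b \<in> {..3::nat}" "c \<in> {..3::nat}" "d \<in> {..3::nat}"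
      and x: "x \<in> ?\<Lambda> b \<inter> ?\<Lambda> c \<inter> ?\<Lambda> d"
    have "b = 0 \<or> b = 1 \<or> b = 2 \<or> b = 3" "c = 0 \<or> c = 1 \<or> c = 2 \<or> c = 3" "d = 0 \<or> d = 1 \<or> d = 2 \<or> d = 3"
      using bcd unfolding atMost_iff le_3_iff by blast+
    then show "j (a [b, c, d] x) = zt [c, d] x - zt [b, d] x + zt [b, c] x"
      using x E [of x] E' [of x] E'' [of x]
      by (elim disjE) (simp_all add: zt_def a_def rotation_sign_def additive_hom_simps [OF j] del: One_nat_def)
  qed
  \<comment> \<open>The increasing triple with value \<open>\<gamma>\<close> is the one that omits
    the index \<open>1\<close>.\<close>
  have "S2 (cech_class (top_of_set ?S) 2 {..3} ?\<Lambda> a) =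
      (\<Sum>k\<le>3::nat. if even k then (if k = 1 then \<gamma> else 0) else - (if k = 1 then \<gamma> else 0))"
  proof (rule S2_eq)
    show "cech_cocycle (top_of_set ?S) 2 {..3} ?\<Lambda> a"
      by (rule connecting_cocycle [OF KG open_cover_sphere 3])
    show "totally_antisymmetric a"
      unfolding a_def [abs_def] by (rule totally_antisymmetric_rotation_sign)
    show "\<forall>k\<le>3. \<forall>x\<in>cover_inter ?\<Lambda> (removeAll k [0..<4]). a (removeAll k [0..<4]) x = (if k = 1 then \<gamma> else 0)"
    proof (intro allI impI ballI)
      fix k x assume "k \<le> (3::nat)"
      then show "a (removeAll k [0..<4]) x = (if k = 1 then \<gamma> else 0)"
        unfolding le_3_iff
        by (elim disjE) (simp_all only: removeAll_upt_4 a_def, simp_all add: rotation_sign_def)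
    qed
  qed
  then have 4: "S2 (cech_class (top_of_set ?S) 2 {..3} ?\<Lambda> a) = - \<gamma>" by (simp add: atMost_3)
  show thesis by (rule that [OF 1 2 3 4])
qed

lemma S2_pullback_eq:
  fixes i :: "'z::topological_ab_group_add \<Rightarrow> 'e::topological_group_add"
    and p :: "'e \<Rightarrow> 'k::topological_group_add"
    and q :: "'w::topological_ab_group_add \<Rightarrow> 'z"
    and j :: "'g::{topological_ab_group_add,discrete_topology} \<Rightarrow> 'w"
  assumes ce: "central_extension i p" and KG: "K_Gamma_1_group j q"
    and \<N>: "open_cover X \<N> id" and s: "local_lifts p X f \<N> id s"
    and g: "difference_cochain i \<N> id s g" and a: "connecting_data j q X \<N> id g gt a"
    and \<sigma>: "continuous_map (top_of_set (simplex_boundary 3)) X \<sigma>"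
    and hom: "homotopic_with P (top_of_set (simplex_boundary 3)) euclidean (f \<circ> \<sigma>) \<sigma>'"
    and \<sigma>': "\<And>k x. k < 3 \<Longrightarrow> x \<in> simplex_face 3 k \<Longrightarrow> \<sigma>' x = 0"
    and \<tau>: "continuous_on (simplex_face 3 3) \<tau>" "\<And>x. x \<in> simplex_face 3 3 \<Longrightarrow> p (\<tau> x) = \<sigma>' x"
    and \<tau>l: "\<And>x. x \<in> simplex_boundary 2 \<Longrightarrow> \<tau> x = i (l x)"
    and G: "path G" "G 0 = 0" "G 1 = j \<gamma>"
    and lift: "\<And>t. t \<in> {0..1} \<Longrightarrow> q (G t) = l (triangle_loop t)"
  shows "S2 (cech_pullback (top_of_set (simplex_boundary 3)) \<sigma> 2 (cech_class X 2 \<N> id a)) = - \<gamma>"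
proof -
  let ?Y = "top_of_set (simplex_boundary 3)"
  let ?V = "\<lambda>N. topspace ?Y \<inter> \<sigma> -` id N"
  have p: "additive_hom p" and central: "i z + y = y + i z" for z y
    using ce unfolding central_extension_def by blast+
  obtain t z zt b where t: "local_lifts p ?Y \<sigma>' {..3} sphere_cover t"
    and z: "difference_cochain i {..3} sphere_cover t z"
    and b: "connecting_data j q ?Y {..3} sphere_cover z zt b"
    and S2b: "S2 (cech_class ?Y 2 {..3} sphere_cover b) = - \<gamma>"
  proof (rule sphere_local_model [OF ce KG, of \<sigma>' \<tau> l G \<gamma>])
    show "\<sigma>' x = 0" if "k < 3" "x \<in> simplex_face 3 k" for k x using that by (rule \<sigma>')
    show "p (\<tau> x) = \<sigma>' x" if "x \<in> simplex_face 3 3" for x using that by (rule \<tau>(2))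
    show "\<tau> x = i (l x)" if "x \<in> simplex_boundary 2" for x using that by (rule \<tau>l)
    show "q (G t) = l (triangle_loop t)" if "t \<in> {0..1}" for t using that by (rule lift)
  qed (rule \<tau>(1) G that | assumption)+
  obtain H where H0: "continuous_map (prod_topology (top_of_set {0..1::real}) ?Y) euclidean H \<and>
      (\<forall>x. H (0, x) = (f \<circ> \<sigma>) x) \<and> (\<forall>x. H (1, x) = \<sigma>' x) \<and> (\<forall>t\<in>{0..1}. P (\<lambda>x. H (t, x)))"
    using hom unfolding homotopic_with_def by (elim exE) (rule that)
  have H: "continuous_map (prod_topology (top_of_set {0..1}) ?Y) euclidean H"
    "H (0, x) = f (\<sigma> x)" "H (1, x) = \<sigma>' x" for x
    using H0 unfolding comp_def by blast+
  have "compact_space ?Y"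
    by (simp add: compact_space_subtopology compact_simplex_boundary)
  then obtain \<psi> where \<psi>: "continuous_map ?Y euclidean \<psi>"
    "\<And>y. y \<in> topspace ?Y \<Longrightarrow> p (\<psi> y) = - H (0, y) + H (1, y)"
    using compact_homotopy_lift [OF p central_extension_local_sections [OF ce] _ H(1)] by metis
  have cocyc: "cech_cocycle X 2 \<N> id a" by (rule connecting_cocycle [OF KG \<N> a])
  have acoc: "cech_cocycle ?Y 2 \<N> ?V (\<lambda>is. a is \<circ> \<sigma>)" by (rule cech_cocycle_pullback [OF \<sigma> cocyc])
  have V: "open_cover ?Y \<N> ?V" using acoc by (simp add: cech_cocycle_def)
  have \<sigma>V: "continuous_map (subtopology ?Y W) (subtopology X U) \<sigma>" if "\<And>y. y \<in> W \<Longrightarrow> \<sigma> y \<in> U" for W U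
    using continuous_map_from_subtopology [OF \<sigma>] that by (auto simp: continuous_map_in_subtopology)
  have s': "local_lifts p ?Y \<sigma>' \<N> ?V (\<lambda>N y. s N (\<sigma> y) + \<psi> y)"
    unfolding local_lifts_def
  proof (intro ballI conjI)
    fix N assume N: "N \<in> \<N>"
    have sN: "continuous_map (subtopology X N) euclidean (s N)" "\<And>x. x \<in> N \<Longrightarrow> p (s N x) = f x"
      using s N unfolding local_lifts_def by auto
    have "continuous_map (subtopology ?Y (?V N)) (subtopology X N) \<sigma>" by (rule \<sigma>V) auto
    then have "continuous_map (subtopology ?Y (?V N)) euclidean (\<lambda>y. s N (\<sigma> y))"
      using continuous_map_compose [OF _ sN(1)] unfolding comp_def by blast
    then show "continuous_map (subtopology ?Y (?V N)) euclidean (\<lambda>y. s N (\<sigma> y) + \<psi> y)"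
      by (rule continuous_map_group_add) (rule continuous_map_from_subtopology [OF \<psi>(1)])
    fix y assume y: "y \<in> ?V N"
    then have "p (\<psi> y) = - f (\<sigma> y) + \<sigma>' y" using \<psi>(2) [of y] H(2,3) by simp
    moreover have "p (s N (\<sigma> y)) = f (\<sigma> y)" using sN(2) y by simp
    ultimately show "p (s N (\<sigma> y) + \<psi> y) = \<sigma>' y"
      by (simp add: additive_hom_add [OF p] add.assoc [symmetric])
  qed
  \<comment> \<open>Centrality enters here: \<open>\<psi> y\<close> commutes with
    \<open>i (g [M, N] (\<sigma> y))\<close>, so changing the lifts by \<open>\<psi>\<close> leaves
    the pulled-back cocycle as it is.\<close>
  have g': "difference_cochain i \<N> ?V (\<lambda>N y. s N (\<sigma> y) + \<psi> y) (\<lambda>is. g is \<circ> \<sigma>)"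
    unfolding difference_cochain_def
  proof (intro ballI)
    fix M N y assume MN: "M \<in> \<N>" "N \<in> \<N>" "y \<in> ?V M \<inter> ?V N"
    then have "s M (\<sigma> y) = s N (\<sigma> y) + i (g [M, N] (\<sigma> y))"
      using g unfolding difference_cochain_def by blast
    then have "s M (\<sigma> y) + \<psi> y = s N (\<sigma> y) + (i (g [M, N] (\<sigma> y)) + \<psi> y)"
      by (simp only: add.assoc)
    also have "\<dots> = s N (\<sigma> y) + \<psi> y + i (g [M, N] (\<sigma> y))"
      by (simp only: central [of "g [M, N] (\<sigma> y)" "\<psi> y"] add.assoc)
    finally show "s M (\<sigma> y) + \<psi> y = s N (\<sigma> y) + \<psi> y + i ((g [M, N] \<circ> \<sigma>) y)" by simp
  qed
  have a': "connecting_data j q ?Y \<N> ?V (\<lambda>is. g is \<circ> \<sigma>) (\<lambda>is. gt is \<circ> \<sigma>) (\<lambda>is. a is \<circ> \<sigma>)"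
    unfolding connecting_data_def One_nat_def cech_cochain_1
  proof (intro conjI ballI)
    fix M N assume MN: "M \<in> \<N>" "N \<in> \<N>"
    have "continuous_map (subtopology ?Y (?V M \<inter> ?V N)) (subtopology X (id M \<inter> id N)) \<sigma>"
      by (rule \<sigma>V) auto
    then show "continuous_map (subtopology ?Y (?V M \<inter> ?V N)) euclidean (gt [M, N] \<circ> \<sigma>)"
      by (rule continuous_map_compose) (rule connecting_dataD(1) [OF a MN])
    fix y assume "y \<in> ?V M \<inter> ?V N"
    then show "q ((gt [M, N] \<circ> \<sigma>) y) = (g [M, N] \<circ> \<sigma>) y"
      using connecting_dataD(2) [OF a MN, of "\<sigma> y"] by simp
  next
    fix L M N y assume "L \<in> \<N>" "M \<in> \<N>" "N \<in> \<N>" "y \<in> ?V L \<inter> ?V M \<inter> ?V N"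
    then show "j ((a [L, M, N] \<circ> \<sigma>) y) = (gt [M, N] \<circ> \<sigma>) y - (gt [L, N] \<circ> \<sigma>) y + (gt [L, M] \<circ> \<sigma>) y"
      using connecting_dataD(3) [OF a, of L M N "\<sigma> y"] by simp
  qed
  have "cech_cohomologous ?Y 2 \<N> ?V (\<lambda>is. a is \<circ> \<sigma>) {..3} sphere_cover b"
    by (rule connecting_cohomologous [OF KG a' b difference_cochains_cohomologous [OF ce V s' g' open_cover_sphere t z]])
  then have "cech_class ?Y 2 \<N> ?V (\<lambda>is. a is \<circ> \<sigma>) = cech_class ?Y 2 {..3} sphere_cover b"
    by (rule cech_class_eq [OF _ acoc connecting_cocycle [OF KG open_cover_sphere b]]) simp
  then show ?thesis using S2b cech_pullback_eq [OF \<sigma> cocyc] by simp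
qed

section \<open>Homotopy classes\<close>

lemma based_class_eq:
  assumes "homotopic_with (\<lambda>h. h (vertex 0) = x0) (top_of_set (simplex_boundary (Suc n))) X \<sigma> \<tau>"
  shows "based_class n X x0 \<sigma> = based_class n X x0 \<tau>"
  using homotopic_with_trans [OF assms] homotopic_with_trans [OF homotopic_with_symD [OF assms]]
  unfolding based_class_def by blast

lemma based_class_self:
  assumes "continuous_map (top_of_set (simplex_boundary (Suc n))) X \<sigma>" "\<sigma> (vertex 0) = x0"
  shows "\<sigma> \<in> based_class n X x0 \<sigma>"
  using assms unfolding based_class_def by (simp add: homotopic_with_refl)

lemma homotopy_group_map_based_class:
  assumes \<sigma>: "continuous_map (top_of_set (simplex_boundary (Suc n))) X \<sigma>" "\<sigma> (vertex 0) = x0"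
    and f: "continuous_map X Y f" "f x0 = y0"
  shows "homotopy_group_map n Y y0 f (based_class n X x0 \<sigma>) = based_class n Y y0 (f \<circ> \<sigma>)"
  unfolding homotopy_group_map_def
proof (rule the_equality)
  show "\<exists>\<tau>\<in>based_class n X x0 \<sigma>. based_class n Y y0 (f \<circ> \<sigma>) = based_class n Y y0 (f \<circ> \<tau>)"
    using based_class_self [OF \<sigma>] by blast
  fix T assume "\<exists>\<tau>\<in>based_class n X x0 \<sigma>. T = based_class n Y y0 (f \<circ> \<tau>)"
  then obtain \<tau> where \<tau>: "homotopic_with (\<lambda>h. h (vertex 0) = x0) (top_of_set (simplex_boundary (Suc n))) X \<sigma> \<tau>"
    and T: "T = based_class n Y y0 (f \<circ> \<tau>)"
    unfolding based_class_def by blast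
  have "homotopic_with (\<lambda>h. h (vertex 0) = y0) (top_of_set (simplex_boundary (Suc n))) Y (f \<circ> \<sigma>) (f \<circ> \<tau>)"
    by (rule homotopic_with_compose_continuous_map_left [OF \<tau> f(1)]) (simp add: f(2))
  then show "T = based_class n Y y0 (f \<circ> \<sigma>)" unfolding T by (rule based_class_eq [symmetric])
qed

text \<open>The difference of \<open>l'\<close> and \<open>l\<close> factors through the
  contractible group as \<open>q \<circ> F\<close>, so a contraction \<open>h\<close> of that group
  joins it to \<open>0\<close>. As \<open>h\<close> may move \<open>0\<close>, its track at
  \<open>0\<close> is subtracted to keep the base point; time runs backwards because
  \<open>h\<close> starts at the identity.\<close>

lemma contractible_lift_homotopic:
  fixes q :: "'w::topological_ab_group_add \<Rightarrow> 'z::topological_ab_group_add"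
  assumes q: "additive_hom q" "continuous_on UNIV q" and con: "contractible (UNIV :: 'w set)"
    and l: "continuous_on S l" and F: "continuous_on S F" and v: "v \<in> S" "F v = 0" "l v = 0"
    and l': "\<And>y. y \<in> S \<Longrightarrow> q (F y) = - l y + l' y"
  shows "homotopic_with (\<lambda>h. h v = 0) (top_of_set S) euclidean l l'"
proof -
  obtain c where "homotopic_with_canon (\<lambda>x. True) (UNIV :: 'w set) UNIV id (\<lambda>x. c)"
    using con unfolding contractible_def by blast
  then obtain h where h0: "continuous_map (prod_topology (top_of_set {0..1::real}) (top_of_set (UNIV :: 'w set))) (top_of_set UNIV) h \<and>
      (\<forall>x. h (0, x) = id x) \<and> (\<forall>x. h (1, x) = c) \<and> (\<forall>t\<in>{0..1::real}. True)"
    unfolding homotopic_with_def by (elim exE) (rule that)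
  have h: "continuous_on ({0..1} \<times> UNIV) h"
    using h0 unfolding prod_topology_subtopology_eu by simp
  have h01: "h (0, x) = x" "h (1, x) = c" for x
    using h0 by auto
  define H where "H ty = l (snd ty) + q (h (1 - fst ty, F (snd ty)) - h (1 - fst ty, 0))" for ty
  have "continuous_on ({0..1} \<times> S) (\<lambda>ty. h (1 - fst ty, F (snd ty)))"
    "continuous_on ({0..1} \<times> S) (\<lambda>ty. h (1 - fst ty, 0))"
    by (rule continuous_on_compose2 [OF h];
        force intro!: continuous_on_Pair continuous_on_diff continuous_on_const continuous_on_fst
          continuous_on_compose2 [OF F] continuous_on_snd continuous_on_id)+
  then have "continuous_on ({0..1} \<times> S) (\<lambda>ty. q (h (1 - fst ty, F (snd ty)) - h (1 - fst ty, 0)))"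
    by (intro continuous_on_compose2 [OF q(2)] continuous_on_diff) auto
  moreover have "continuous_on ({0..1::real} \<times> S) (\<lambda>ty. l (snd ty))"
    by (rule continuous_on_compose2 [OF l continuous_on_snd [OF continuous_on_id]]) auto
  ultimately have cH: "continuous_on ({0..1} \<times> S) H"
    unfolding H_def by (intro continuous_on_add)
  have "homotopic_with (\<lambda>h. h v = 0) (top_of_set S) euclidean (\<lambda>y. H (0, y)) (\<lambda>y. H (1, y))"
    unfolding homotopic_with_def
  proof (intro exI conjI allI ballI)
    show "continuous_map (prod_topology (top_of_set {0..1}) (top_of_set S)) euclidean H" using cH by simp
    show "H (t, v) = 0" for t using v by (simp add: H_def additive_hom_zero [OF q(1)])
  qed simp_all
  then show ?thesis
  proof (rule homotopic_with_eq)
    show "l y = H (0, y)" for y by (simp add: H_def h01 additive_hom_zero [OF q(1)])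
    show "l' y = H (1, y)" if "y \<in> topspace (top_of_set S)" for y
      using l' that by (simp add: H_def h01)
    show "(h v = 0) = (k v = 0)" if "\<And>x. x \<in> topspace (top_of_set S) \<Longrightarrow> h x = k x" for h k :: "'a \<Rightarrow> 'z"
      using that v(1) by simp
  qed
qed

text \<open>Path lifting as an instance of \<open>compact_homotopy_lift\<close>:
  \<open>(s, t) \<mapsto> l (triangle_loop (s * t))\<close> is a homotopy from the constant
  \<open>0\<close> to the path. It is stationary at \<open>t = 0\<close>, whence
  \<open>g 0 = 0\<close>.\<close>

lemma loop_path_lift:
  fixes q :: "'w::topological_ab_group_add \<Rightarrow> 'z::topological_ab_group_add"
    and j :: "'g::{topological_ab_group_add,discrete_topology} \<Rightarrow> 'w"
  assumes KG: "K_Gamma_1_group j q" and l: "continuous_on (simplex_boundary 2) l" "l (vertex 0) = 0"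
  obtains g \<gamma> where "path g" "g 0 = 0" "g 1 = j \<gamma>" "\<And>t. t \<in> {0..1} \<Longrightarrow> q (g t) = l (triangle_loop t)"
proof -
  have q: "additive_hom q" using KG by (simp add: K_Gamma_1_group_def)
  let ?I = "top_of_set {0..1::real}"
  let ?H = "\<lambda>st. l (triangle_loop (fst st * snd st))"
  have "continuous_on ({0..1} \<times> {0..1}) (\<lambda>st::real \<times> real. triangle_loop (fst st * snd st))"
    using path_triangle_loop unfolding path_def
    by (rule continuous_on_compose2) (auto intro!: continuous_intros mult_le_one)
  then have "continuous_on ({0..1} \<times> {0..1}) ?H"
    by (rule continuous_on_compose2 [OF l(1)]) (auto intro!: triangle_loop_boundary mult_le_one)
  then have H: "continuous_map (prod_topology ?I ?I) euclidean ?H" by simp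
  have "compact_space ?I" by (simp add: compact_space_subtopology)
  then obtain g where g: "continuous_map ?I euclidean g"
    "\<And>t. t \<in> topspace ?I \<Longrightarrow> q (g t) = - ?H (0, t) + ?H (1, t)"
    "\<And>t. t \<in> topspace ?I \<Longrightarrow> (\<And>s. s \<in> {0..1} \<Longrightarrow> ?H (s, t) = ?H (0, t)) \<Longrightarrow> g t = 0"
    using compact_homotopy_lift [OF q K_Gamma_1_local_sections [OF KG] _ H] by metis
  have lift: "q (g t) = l (triangle_loop t)" if "t \<in> {0..1}" for t
    using g(2) [of t] that by (simp add: triangle_loop_ends l(2))
  have "q (g 1) = 0" using lift [of 1] by (simp add: triangle_loop_ends l(2))
  then have "g 1 = j (inv_into UNIV j (g 1))" by (rule K_Gamma_1_kernelD [OF KG, symmetric])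
  moreover have "path g" using g(1) by (simp add: path_def)
  moreover have "g 0 = 0" by (rule g(3)) simp_all
  ultimately show thesis using lift that by blast
qed

text \<open>Since the homotopy is stationary at \<open>vertex 0\<close>, its lifted increment
  \<open>F\<close> vanishes there; subtracting \<open>F\<close> along the loop changes the loop
  below but neither end of the lift. So the end point is an invariant of the based class.\<close>

lemma based_homotopic_path_lift:
  fixes q :: "'w::topological_ab_group_add \<Rightarrow> 'z::topological_ab_group_add"
  assumes KG: "K_Gamma_1_group j q"
    and lh: "homotopic_with (\<lambda>h. h (vertex 0) = 0) (top_of_set (simplex_boundary 2)) euclidean l h"
    and g: "path g" "g 0 = 0" "\<And>t. t \<in> {0..1} \<Longrightarrow> q (g t) = h (triangle_loop t)"
  obtains g' where "path g'" "g' 0 = 0" "g' 1 = g 1" "\<And>t. t \<in> {0..1} \<Longrightarrow> q (g' t) = l (triangle_loop t)"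
proof -
  have q: "additive_hom q" using KG by (simp add: K_Gamma_1_group_def)
  let ?Y = "top_of_set (simplex_boundary 2)"
  have v0: "vertex 0 \<in> simplex_boundary 2" by (rule vertex_0_boundary) simp
  obtain H where H0: "continuous_map (prod_topology (top_of_set {0..1::real}) ?Y) euclidean H \<and>
      (\<forall>x. H (0, x) = l x) \<and> (\<forall>x. H (1, x) = h x) \<and> (\<forall>t\<in>{0..1}. H (t, vertex 0) = 0)"
    using lh unfolding homotopic_with_def by (elim exE) (rule that)
  have H: "continuous_map (prod_topology (top_of_set {0..1}) ?Y) euclidean H"
    "H (0, x) = l x" "H (1, x) = h x" "t \<in> {0..1} \<Longrightarrow> H (t, vertex 0) = 0" for x t
    using H0 by blast+
  have "compact_space ?Y" by (simp add: compact_space_subtopology compact_simplex_boundary)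
  then obtain F where F: "continuous_map ?Y euclidean F"
    "\<And>y. y \<in> topspace ?Y \<Longrightarrow> q (F y) = - H (0, y) + H (1, y)"
    "\<And>y. y \<in> topspace ?Y \<Longrightarrow> (\<And>t. t \<in> {0..1} \<Longrightarrow> H (t, y) = H (0, y)) \<Longrightarrow> F y = 0"
    using compact_homotopy_lift [OF q K_Gamma_1_local_sections [OF KG] _ H(1)] by metis
  have Fv: "F (vertex 0) = 0"
  proof (rule F(3))
    show "H (t, vertex 0) = H (0, vertex 0)" if "t \<in> {0..1}" for t
      using H(4) [OF that] H(4) [of 0] by simp
  qed (use v0 in simp)
  show thesis
  proof (rule that [of "\<lambda>t. g t - F (triangle_loop t)"])
    have "continuous_on {0..1} (\<lambda>t. F (triangle_loop t))"
    proof (rule continuous_on_compose2 [where g = F and f = triangle_loop])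
      show "continuous_on (simplex_boundary 2) F" using F(1) by simp
      show "continuous_on {0..1} triangle_loop" using path_triangle_loop by (simp add: path_def)
    qed (auto intro: triangle_loop_boundary)
    then show "path (\<lambda>t. g t - F (triangle_loop t))"
      using g(1) unfolding path_def by (intro continuous_on_diff)
    show "g 0 - F (triangle_loop 0) = 0" "g 1 - F (triangle_loop 1) = g 1"
      by (simp_all add: triangle_loop_ends Fv g(2))
    show "q (g t - F (triangle_loop t)) = l (triangle_loop t)" if "t \<in> {0..1}" for t
      using F(2) [of "triangle_loop t"] triangle_loop_boundary [OF that] g(3) [OF that]
      by (simp add: additive_hom_diff [OF q] H)
  qed
qed


section \<open>Evaluation of both homomorphisms on one class\<close>

theorem proposition5p7:
  fixes X :: "'x topology" and x0 :: 'x
    and f :: "'x \<Rightarrow> 'k::topological_group_add"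
    and i :: "'z::topological_ab_group_add \<Rightarrow> 'e::topological_group_add"
    and p :: "'e \<Rightarrow> 'k"
    and q :: "'w::topological_ab_group_add \<Rightarrow> 'z"
    and j :: "'g::{topological_ab_group_add,discrete_topology} \<Rightarrow> 'w"
  assumes "paracompact_space X" and "locally_contractible_space X" and "Hausdorff_space X"
    and "locally_contractible_space (euclidean :: 'k topology)"
    and "K_Gamma_1_group j q"
    and "central_extension i p"
    and "continuous_map X euclidean f" and "x0 \<in> topspace X" and "f x0 = 0"
  shows "\<forall>S\<in>homotopy_group_set 2 X x0.
           pi1_to_Gamma j q
             (connecting2 euclidean p (\<lambda>y z. y + i z) 0 (homotopy_group_map 2 euclidean 0 f S))
           = - alpha2 (iota1 X j q (delta0 X i p f)) S"
proof
  fix S assume "S \<in> homotopy_group_set 2 X x0"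
  note KG = assms(5) and ce = assms(6) and f = assms(7,9)
  let ?Y = "top_of_set (simplex_boundary 3)"
  have Suc2: "Suc 2 = 3" and Suc1: "Suc 1 = 2" by simp_all
  obtain \<sigma>0 where \<sigma>0: "continuous_map ?Y X \<sigma>0" "\<sigma>0 (vertex 0) = x0" and S: "S = based_class 2 X x0 \<sigma>0"
    using \<open>S \<in> homotopy_group_set 2 X x0\<close> unfolding homotopy_group_set_def Suc2 by blast
  have p: "additive_hom p" and i: "additive_hom i" "inj i" using ce by (auto simp: central_extension_def)
  have q: "additive_hom q" "continuous_on UNIV q" and con: "contractible (UNIV :: 'w set)"
    using KG by (auto simp: K_Gamma_1_group_def covering_space_imp_continuous)
  have v2: "vertex 0 \<in> simplex_boundary 2" by (rule vertex_0_boundary) simp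
  obtain \<N> s g gt a where \<N>: "open_cover X \<N> id" "local_lifts p X f \<N> id s"
    "difference_cochain i \<N> id s g" and a: "connecting_data j q X \<N> id g gt a"
    by (rule liftable_cover_exists [OF assms(1,3) ce KG f(1)]) (rule that)
  let ?c = "cech_class X 2 \<N> id a"
  have c: "iota1 X j q (delta0 X i p f) = ?c"
    unfolding delta0_eq [OF ce \<N>] by (rule iota1_eq [OF KG difference_cocycle [OF ce \<N>] a])
  define \<phi> where "\<phi> = f \<circ> \<sigma>0"
  let ?B = "based_class 2 euclidean 0 \<phi>"
  have B: "homotopy_group_map 2 euclidean 0 f S = ?B"
    unfolding S \<phi>_def by (rule homotopy_group_map_based_class) (simp_all add: Suc2 \<sigma>0 f)
  \<comment> \<open>The condition in \<open>connecting2\<close> for \<open>y0 = 0\<close>, kept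
    literally with \<open>p 0\<close> and \<open>0 + i (l x)\<close> so that it matches that
    definition after unfolding.\<close>
  define D where "D \<sigma> \<tau> l \<longleftrightarrow>
      (\<forall>k<3. \<forall>x\<in>simplex_face 3 k. \<sigma> x = p 0) \<and>
      continuous_map (top_of_set (simplex_face 3 3)) euclidean \<tau> \<and>
      (\<forall>x\<in>simplex_face 3 3. p (\<tau> x) = \<sigma> x) \<and> \<tau> (vertex 0) = 0 \<and>
      (\<forall>x\<in>simplex_boundary 2. \<tau> x = 0 + i (l x))" for \<sigma> \<tau> l
  have bd: "simplex_boundary 2 \<subseteq> simplex_face 3 3"
    unfolding simplex_face_3_3 by (rule simplex_boundary_2_subset)
  have Dl: "continuous_on (simplex_boundary 2) l" "l (vertex 0) = 0" if D: "D \<sigma> \<tau> l" for \<sigma> \<tau> l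
  proof -
    have \<tau>l: "\<tau> x = i (l x)" if "x \<in> simplex_boundary 2" for x
      using D that unfolding D_def by simp
    have "continuous_map (top_of_set (simplex_boundary 2)) euclidean l"
    proof (rule central_extension_continuous_kernel [OF ce])
      have "continuous_on (simplex_face 3 3) \<tau>" using D unfolding D_def by simp
      then show "continuous_map (top_of_set (simplex_boundary 2)) euclidean \<tau>"
        using bd by (simp add: continuous_on_subset)
    qed (simp add: \<tau>l)
    then show "continuous_on (simplex_boundary 2) l" by simp
    have "i (l (vertex 0)) = i 0"
      using D \<tau>l [OF v2] unfolding D_def by (simp add: additive_hom_zero [OF i(1)])
    then show "l (vertex 0) = 0" by (rule injD [OF i(2)])
  qed
  \<comment> \<open>All choices are variables here. Varying \<open>\<sigma>\<close> shows that
    \<open>alpha2\<close> is well defined; varying \<open>\<sigma>'\<close>, \<open>\<tau>\<close>,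
    \<open>l\<close> serves \<open>connecting2\<close>, and varying \<open>G\<close> serves
    \<open>pi1_to_Gamma\<close>.\<close>
  have KEY: "S2 (cech_pullback ?Y \<sigma> 2 ?c) = - \<gamma>"
    if \<sigma>: "\<sigma> \<in> S" and \<sigma>': "\<sigma>' \<in> ?B" and D: "D \<sigma>' \<tau> l"
      and G: "path G" "G 0 = 0" "G 1 = j \<gamma>" and lift: "\<And>t. t \<in> {0..1} \<Longrightarrow> q (G t) = l (triangle_loop t)"
    for \<sigma> \<sigma>' \<tau> l G \<gamma>
  proof (rule S2_pullback_eq [OF ce KG \<N> a, where \<sigma>' = \<sigma>' and \<tau> = \<tau> and l = l and G = G and P = "\<lambda>h. h (vertex 0) = 0"])
    have h: "homotopic_with (\<lambda>h. h (vertex 0) = x0) ?Y X \<sigma>0 \<sigma>"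
      using \<sigma> unfolding S based_class_def Suc2 by blast
    then show "continuous_map ?Y X \<sigma>" using homotopic_with_imp_continuous_maps by blast
    have "homotopic_with (\<lambda>h. h (vertex 0) = 0) ?Y euclidean \<phi> (f \<circ> \<sigma>)"
      unfolding \<phi>_def by (rule homotopic_with_compose_continuous_map_left [OF h f(1)]) (simp add: f(2))
    moreover have "homotopic_with (\<lambda>h. h (vertex 0) = 0) ?Y euclidean \<phi> \<sigma>'"
      using \<sigma>' unfolding based_class_def Suc2 by blast
    ultimately show "homotopic_with (\<lambda>h. h (vertex 0) = 0) ?Y euclidean (f \<circ> \<sigma>) \<sigma>'"
      using homotopic_with_trans homotopic_with_symD by blast
    show "\<sigma>' x = 0" if "k < 3" "x \<in> simplex_face 3 k" for k x
      using D that unfolding D_def by (simp add: additive_hom_zero [OF p])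
    show "continuous_on (simplex_face 3 3) \<tau>" using D unfolding D_def by simp
    show "p (\<tau> x) = \<sigma>' x" if "x \<in> simplex_face 3 3" for x
      using D that unfolding D_def by blast
    show "\<tau> x = i (l x)" if "x \<in> simplex_boundary 2" for x
      using D that unfolding D_def by simp
    show "q (G t) = l (triangle_loop t)" if "t \<in> {0..1}" for t using that by (rule lift)
  qed (rule G)+
  have \<sigma>0S: "\<sigma>0 \<in> S" unfolding S by (rule based_class_self) (simp_all add: Suc2 \<sigma>0)

  have c\<phi>: "continuous_on (simplex_boundary 3) \<phi>"
    using continuous_map_compose [OF \<sigma>0(1) f(1)] by (simp add: \<phi>_def)
  obtain \<sigma> where \<sigma>: "homotopic_with (\<lambda>h. h (vertex 0) = 0) ?Y euclidean \<phi> \<sigma>"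
    "\<And>k x. k < 3 \<Longrightarrow> x \<in> simplex_face 3 k \<Longrightarrow> \<sigma> x = 0"
    by (rule sphere_map_deform [OF c\<phi>]) (simp_all add: \<phi>_def \<sigma>0 f that)
  have \<sigma>B: "\<sigma> \<in> ?B" using \<sigma>(1) unfolding based_class_def Suc2 by blast
  have c\<sigma>: "continuous_on (simplex_boundary 3) \<sigma>"
    using homotopic_with_imp_continuous_maps [OF \<sigma>(1)] by simp
  \<comment> \<open>The disc \<open>F_3\<close> contracts linearly to \<open>e_0\<close>, where
    \<open>\<sigma>\<close> is \<open>0\<close>, so \<open>\<sigma>\<close> lifts over it. The
    contraction fixes \<open>e_0\<close>, which gives \<open>\<tau> (vertex 0) = 0\<close>.\<close>
  have "\<exists>\<tau> l. D \<sigma> \<tau> l"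
  proof -
    let ?F = "simplex_face 3 3"
    define C where "C tx n = (1 - fst tx) * vertex 0 n + fst tx * snd tx n"
      for tx :: "real \<times> (nat \<Rightarrow> real)" and n :: nat
    have CF: "C (t, x) \<in> simplex_boundary 3" if t: "t \<in> {0..1}" and x: "x \<in> ?F" for t x
    proof -
      have x: "x \<in> standard_simplex 3" "x 3 = 0" using x by (auto simp: simplex_face_def)
      have "(\<lambda>n. (1 - t) * vertex 0 n + t * x n) \<in> simplex_boundary 3"
        by (rule simplex_boundary_segment [OF vertex_simplex x(1) _ _ order_refl _ x(2)])
          (use t in \<open>auto simp: vertex_def\<close>)
      then show ?thesis by (simp add: C_def [abs_def])
    qed
    have "continuous_on ({0..1} \<times> ?F) C"
      unfolding C_def [abs_def] by (rule continuous_on_segment)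
    then have "continuous_on ({0..1} \<times> ?F) (\<lambda>tx. \<sigma> (C tx))"
      by (rule continuous_on_compose2 [OF c\<sigma>]) (use CF in auto)
    then have H: "continuous_map (prod_topology (top_of_set {0..1}) (top_of_set ?F)) euclidean (\<lambda>tx. \<sigma> (C tx))"
      by simp
    have cF: "compact_space (top_of_set ?F)"
      unfolding simplex_face_3_3 by (simp add: compact_space_subtopology compact_standard_simplex)
    have C0: "C (0, y) = vertex 0" "C (1, y) = y" for y by (simp_all add: C_def [abs_def])
    obtain \<tau> where \<tau>: "continuous_map (top_of_set ?F) euclidean \<tau>"
      "\<And>y. y \<in> topspace (top_of_set ?F) \<Longrightarrow> p (\<tau> y) = - \<sigma> (C (0, y)) + \<sigma> (C (1, y))" "\<tau> (vertex 0) = 0"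
    proof (rule compact_homotopy_lift [OF p central_extension_local_sections [OF ce] cF H])
      fix F assume F: "continuous_map (top_of_set ?F) euclidean F"
        "\<And>y. y \<in> topspace (top_of_set ?F) \<Longrightarrow> p (F y) = - \<sigma> (C (0, y)) + \<sigma> (C (1, y))"
        "\<And>y. y \<in> topspace (top_of_set ?F) \<Longrightarrow> (\<And>t. t \<in> {0..1} \<Longrightarrow> \<sigma> (C (t, y)) = \<sigma> (C (0, y))) \<Longrightarrow> F y = 0"
      show thesis
      proof (rule that [OF F(1,2)])
        show "F (vertex 0) = 0"
        proof (rule F(3))
          show "vertex 0 \<in> topspace (top_of_set ?F)" using v2 bd by auto
          have "C (t, vertex 0) = vertex 0" for t by (simp add: C_def [abs_def] algebra_simps)
          then show "\<sigma> (C (t, vertex 0)) = \<sigma> (C (0, vertex 0))" for t by simp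
        qed
      qed
    qed
    have \<sigma>v: "\<sigma> (vertex 0) = 0"
      by (rule \<sigma>(2) [of 1]) (simp_all add: simplex_face_def vertex_simplex, simp add: vertex_def)
    have p\<tau>: "p (\<tau> y) = \<sigma> y" if "y \<in> ?F" for y
      using \<tau>(2) [of y] that unfolding C0 \<sigma>v by simp
    have "\<tau> x = 0 + i (inv_into UNIV i (\<tau> x))" if x: "x \<in> simplex_boundary 2" for x
    proof -
      obtain k where "k < 3" "x \<in> simplex_face 3 k" using simplex_boundary_2_face [OF x] by blast
      then have "\<sigma> x = 0" by (rule \<sigma>(2))
      moreover have "x \<in> ?F" using x bd by blast
      ultimately have "p (\<tau> x) = 0" using p\<tau> by simp
      then show ?thesis using central_extension_kernelD [OF ce] by simp
    qed
    then have "D \<sigma> \<tau> (\<lambda>x. inv_into UNIV i (\<tau> x))"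
      unfolding D_def using \<tau>(1,3) p\<tau> \<sigma>(2) additive_hom_zero [OF p] by (intro conjI ballI allI impI) auto
    then show ?thesis by blast
  qed
  then obtain \<tau> l where D: "D \<sigma> \<tau> l" by blast
  obtain G \<gamma> where G: "path G" "G 0 = 0" "G 1 = j \<gamma>" "\<And>t. t \<in> {0..1} \<Longrightarrow> q (G t) = l (triangle_loop t)"
    by (rule loop_path_lift [OF KG Dl [OF D]]) (rule that)
  let ?T = "based_class 1 euclidean 0 l"

  have unique: "based_class 1 euclidean 0 l' = ?T" if \<sigma>': "\<sigma>' \<in> ?B" and D': "D \<sigma>' \<tau>' l'" for \<sigma>' \<tau>' l'
  proof -
    obtain G' \<gamma>' where G': "path G'" "G' 0 = 0" "G' 1 = j \<gamma>'" "\<And>t. t \<in> {0..1} \<Longrightarrow> q (G' t) = l' (triangle_loop t)"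
      by (rule loop_path_lift [OF KG Dl [OF D']]) (rule that)
    \<comment> \<open>Both sides are the value of \<open>S2\<close> on the same pullback along
      \<open>\<sigma>0\<close>.\<close>
    have "- \<gamma> = - \<gamma>'"
      using KEY [OF \<sigma>0S \<sigma>B D G] KEY [OF \<sigma>0S \<sigma>' D' G'] by simp
    then have "\<gamma>' = \<gamma>" by simp
    obtain F where F: "continuous_on (simplex_boundary 2) F" "\<And>y. y \<in> simplex_boundary 2 \<Longrightarrow> q (F y) = - l y + l' y"
      "F (vertex 0) = 0"
    proof (rule closed_loop_lift [of "\<lambda>t. G' t - G t" q "\<lambda>y. - l y + l' y"])
      show "path (\<lambda>t. G' t - G t)"
        using G(1) G'(1) unfolding path_def by (intro continuous_on_diff)
      show "q (G' t - G t) = - l (triangle_loop t) + l' (triangle_loop t)" if "t \<in> {0..1}" for t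
        using G(4) [OF that] G'(4) [OF that] by (simp add: additive_hom_diff [OF q(1)])
    qed (simp_all add: G(2,3) G'(2,3) \<open>\<gamma>' = \<gamma>\<close> that)
    have "homotopic_with (\<lambda>h. h (vertex 0) = 0) (top_of_set (simplex_boundary 2)) euclidean l l'"
    proof (rule contractible_lift_homotopic [where q = q and F = F])
      show "q (F y) = - l y + l' y" if "y \<in> simplex_boundary 2" for y using that by (rule F(2))
    qed (rule q con Dl(1) [OF D] F(1) v2 F(3) Dl(2) [OF D])+
    then show ?thesis
      using based_class_eq [of 0 1 euclidean l l'] unfolding Suc1 by simp
  qed
  have conn: "connecting2 euclidean p (\<lambda>y z. y + i z) 0 ?B = ?T"
    unfolding connecting2_def
  proof (rule the_equality)
    show "\<exists>\<sigma>\<in>?B. \<exists>\<tau> l'.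
        (\<forall>k<3. \<forall>x\<in>simplex_face 3 k. \<sigma> x = p 0) \<and>
        continuous_map (top_of_set (simplex_face 3 3)) euclidean \<tau> \<and>
        (\<forall>x\<in>simplex_face 3 3. p (\<tau> x) = \<sigma> x) \<and> \<tau> (vertex 0) = 0 \<and>
        (\<forall>x\<in>simplex_boundary 2. \<tau> x = 0 + i (l' x)) \<and> ?T = based_class 1 euclidean 0 l'"
      using \<sigma>B D unfolding D_def by blast
    fix T assume "\<exists>\<sigma>\<in>?B. \<exists>\<tau> l'.
        (\<forall>k<3. \<forall>x\<in>simplex_face 3 k. \<sigma> x = p 0) \<and>
        continuous_map (top_of_set (simplex_face 3 3)) euclidean \<tau> \<and>
        (\<forall>x\<in>simplex_face 3 3. p (\<tau> x) = \<sigma> x) \<and> \<tau> (vertex 0) = 0 \<and>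
        (\<forall>x\<in>simplex_boundary 2. \<tau> x = 0 + i (l' x)) \<and> T = based_class 1 euclidean 0 l'"
    then obtain \<sigma>' \<tau>' l' where "\<sigma>' \<in> ?B" "D \<sigma>' \<tau>' l'" "T = based_class 1 euclidean 0 l'"
      unfolding D_def by blast
    then show "T = ?T" using unique by blast
  qed
  have pi1: "pi1_to_Gamma j q ?T = \<gamma>"
    unfolding pi1_to_Gamma_def
  proof (rule the_equality)
    have "l \<in> ?T" by (rule based_class_self) (simp_all only: Suc1 continuous_map_iff_continuous Dl [OF D])
    then show "\<exists>h\<in>?T. \<exists>g. path g \<and> pathstart g = 0 \<and> (\<forall>t\<in>{0..1}. q (g t) = h (triangle_loop t)) \<and> pathfinish g = j \<gamma>"
      using G unfolding pathstart_def pathfinish_def by blast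
    fix \<gamma>' assume "\<exists>h\<in>?T. \<exists>g. path g \<and> pathstart g = 0 \<and> (\<forall>t\<in>{0..1}. q (g t) = h (triangle_loop t)) \<and> pathfinish g = j \<gamma>'"
    then obtain h g where h: "h \<in> ?T" and g: "path g" "g 0 = 0" "g 1 = j \<gamma>'"
      and gh: "\<And>t. t \<in> {0..1} \<Longrightarrow> q (g t) = h (triangle_loop t)"
      unfolding pathstart_def pathfinish_def by blast
    have lh: "homotopic_with (\<lambda>h. h (vertex 0) = 0) (top_of_set (simplex_boundary 2)) euclidean l h"
      using h unfolding based_class_def Suc1 by blast
    \<comment> \<open>Moved from \<open>h\<close> to \<open>l\<close>, the path lift can be put into
      \<open>KEY\<close> with the same \<open>\<sigma>\<close>, \<open>\<tau>\<close> and
      \<open>l\<close>, and its end point is still \<open>j \<gamma>'\<close>.\<close>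
    obtain G' where G': "path G'" "G' 0 = 0" "G' 1 = g 1" "\<And>t. t \<in> {0..1} \<Longrightarrow> q (G' t) = l (triangle_loop t)"
      by (rule based_homotopic_path_lift [OF KG lh g(1,2) gh]) (simp_all add: that)
    have "- \<gamma> = - \<gamma>'"
      using KEY [OF \<sigma>0S \<sigma>B D G] KEY [OF \<sigma>0S \<sigma>B D G'(1,2) _ G'(4)] G'(3) g(3) by simp
    then show "\<gamma>' = \<gamma>" by simp
  qed
  have "alpha2 ?c S = - \<gamma>"
    unfolding alpha2_def
  proof (rule the_equality)
    show "\<exists>\<sigma>\<in>S. - \<gamma> = S2 (cech_pullback ?Y \<sigma> 2 ?c)"
      using KEY [OF \<sigma>0S \<sigma>B D G] \<sigma>0S by metis
    show "s = - \<gamma>" if "\<exists>\<sigma>\<in>S. s = S2 (cech_pullback ?Y \<sigma> 2 ?c)" for s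
      using that KEY [OF _ \<sigma>B D G] by blast
  qed
  then show "pi1_to_Gamma j q (connecting2 euclidean p (\<lambda>y z. y + i z) 0 (homotopy_group_map 2 euclidean 0 f S)) =
      - alpha2 (iota1 X j q (delta0 X i p f)) S"
    unfolding c B conn pi1 by simp
qed

end
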